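(* Let $M$ be a smooth real Banach manifold with tangent bundle $\tau_M:TM\to M$, and let $N:TM\to TM$ be a Nijenhuis operator on $M$. Then its tangent lift $\mathrm d_T(N)=\kappa\circ TN\circ\kappa:TTM\to TTM$ is a Nijenhuis operator on the Banach manifold $TM$. Moreover, $\mathrm d_T(N)$ is projectable with respect to the fibration $\tau_M:TM\to M$ onto the operator $N$, i.e. $$T\tau_M\circ \mathrm d_T(N)=N\circ T\tau_M,$$ where $T\tau_M:TTM\to TM$ is the tangent map of $\tau_M$.
   Context: All manifolds are smooth ($C^\infty$) real Banach manifolds, possibly infinite-dimensional. A vector bundle morphism between Banach vector bundles is a smooth fibre-preserving map that is bounded linear on fibres; locally, for trivial bundles $E\times F$ and $E'\times F'$, it has the form $\Phi(p,y)=(\Phi_0(p),\Phi_p(y))$ with $\Phi_0$ smooth and $\Phi_p\in B(F,F')$ a bounded linear operator. An $\mathcal N$-operator on a Banach manifold $M$ is a vector bundle morphism $N:TM\to TM$ covering the identity on $M$. If $M$ is modelled on a Banach space $E$, then locally $TM=E\times E$, vector fields are smooth maps $X:E\to E$, and $N$ is interpreted as a smooth map $E\to B(E)$, where $B(E)$ denotes the bounded linear operators on $E$. The Lie bracket of (local) vector fields is given locally by $[X,Y]_p=D_pX(Y_p)-D_pY(X_p)$ (the overall sign convention does not affect the statement). The Nijenhuis torsion of $N$ is defined on local vector fields by $$\mathcal T_N(X,Y)=[NX,NY]-N\big([NX,Y]+[X,NY]-N[X,Y]\big);$$ it is known to be tensorial, i.e. $\mathcal T_N(X,Y)_p$ depends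 only on $X_p,Y_p$. All definitions are local: only local vector fields are used, and global ones need not exist. $N$ is called a Nijenhuis operator if $\mathcal T_N=0$. A fibration $\tau:P\to P_0$ is a smooth surjective submersion of Banach manifolds. An $\mathcal N$-operator $\tilde N$ on $P$ is projectable onto an $\mathcal N$-operator $N_0$ on $P_0$ if $N_0\circ T\tau=T\tau\circ\tilde N$. The canonical flip $\kappa:TTM\to TTM$ is the diffeomorphism with $\kappa^2=\mathrm{id}$ that interchanges the order of differentiation: for a smooth map $\phi:\mathbb R^2\to M$, $\kappa$ sends $\frac{\partial}{\partial s}\big|_{s=0}\frac{\partial}{\partial t}\big|_{t=0}\phi(t,s)$ to $\frac{\partial}{\partial t}\big|_{t=0}\frac{\partial}{\partial s}\big|_{s=0}\phi(t,s)$. In a local chart, identifying $M$ with the model Banach space $E$ and $TTM$ with $E\times E\times E\times E$ (elements $(x,\dot x,\delta x,\delta\dot x)$, where $(x,\dot x)\in TM$ is the base point and $(\delta x,\delta\dot x)$ is the tangent vector at it), $\kappa(x,\dot x,\delta x,\delta\dot x)=(x,\delta x,\dot x,\delta\dot x)$. $TN:TTM\to TTM$ denotes the tangent map of the smooth map $N:TM\to TM$. The tangent bundle projection of the manifold $TM$ is locally $(x,\dot x,\delta x,\delta\dot x)\mapsto(x,\dot x)$, and $T\tau_M$ is locally $(x,\dot x,\delta x,\delta\dot x)\mapsto(x,\delta x)$. *)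

theory Defs
  imports "HOL-Analysis.Analysis"
begin

section \<open>Smooth maps between Banach spaces\<close>

text \<open>
  The \<open>k\<close>-th Frechet derivative at a point is an element of
  \<open>L(E, L(E, \<dots> L(E, F)))\<close>, a space that depends on \<open>k\<close>. It is represented by
  the corresponding bounded \<open>k\<close>-linear map, applied to lists of length \<open>k\<close>; values on
  lists of other lengths are irrelevant. The estimate in \<open>smooth_on\<close> says that
  \<open>D (Suc k) x\<close> is the Frechet derivative of \<open>D k\<close> at \<open>x\<close> for the operator
  norm on \<open>k\<close>-linear maps, the first list entry being the new direction.
\<close>

definition bounded_multilinear ::
    "nat \<Rightarrow> ('a::real_normed_vector list \<Rightarrow> 'b::real_normed_vector) \<Rightarrow> bool" where
  "bounded_multilinear k m \<longleftrightarrow>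
     (\<forall>us ws. length us + length ws + 1 = k \<longrightarrow> linear (\<lambda>v. m (us @ v # ws))) \<and>
     (\<exists>C. \<forall>vs. length vs = k \<longrightarrow> norm (m vs) \<le> C * prod_list (map norm vs))"

definition smooth_on ::
    "'a::real_normed_vector set \<Rightarrow> ('a \<Rightarrow> 'b::real_normed_vector) \<Rightarrow> bool" where
  "smooth_on U f \<longleftrightarrow> open U \<and>
     (\<exists>D :: nat \<Rightarrow> 'a \<Rightarrow> 'a list \<Rightarrow> 'b.
        (\<forall>x\<in>U. D 0 x [] = f x) \<and>
        (\<forall>k. \<forall>x\<in>U. bounded_multilinear k (D k x)) \<and>
        (\<forall>k. \<forall>x\<in>U. \<forall>\<epsilon>>0. \<exists>\<delta>>0. \<forall>y\<in>U. norm (y - x) < \<delta> \<longrightarrow>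
           (\<forall>vs. length vs = k \<longrightarrow>
              norm (D k y vs - D k x vs - D (Suc k) x ((y - x) # vs))
                \<le> \<epsilon> * norm (y - x) * prod_list (map norm vs))))"


section \<open>Banach manifolds\<close>

text \<open>
  A chart is a pair of its domain and its coordinate map (values outside the domain are
  irrelevant). A manifold is given by an atlas, which need not be maximal; the
  underlying set is the union of the chart domains, and the topology is the one
  determined by the atlas. No separation or countability axiom is imposed.
\<close>

type_synonym ('m, 'e) chart = "'m set \<times> ('m \<Rightarrow> 'e)"

definition points :: "('m, 'e) chart set \<Rightarrow> 'm set" where
  "points M = (\<Union>c\<in>M. fst c)"

definition charts_at :: "('m, 'e) chart set \<Rightarrow> 'm \<Rightarrow> ('m, 'e) chart set" where
  "charts_at M p = {c \<in> M. p \<in> fst c}"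

definition chart_inv :: "('m, 'e) chart \<Rightarrow> 'e \<Rightarrow> 'm" where
  "chart_inv c = inv_into (fst c) (snd c)"

definition local_rep ::
    "('m, 'e) chart \<Rightarrow> ('n, 'f) chart \<Rightarrow> ('m \<Rightarrow> 'n) \<Rightarrow> 'e \<Rightarrow> 'f" where
  "local_rep c d f = snd d \<circ> f \<circ> chart_inv c"

definition banach_manifold :: "('m, 'e::banach) chart set \<Rightarrow> bool" where
  "banach_manifold M \<longleftrightarrow>
     (\<forall>c\<in>M. inj_on (snd c) (fst c) \<and> open (snd c ` fst c)) \<and>
     (\<forall>c\<in>M. \<forall>d\<in>M. smooth_on (snd c ` (fst c \<inter> fst d)) (local_rep c d id))"

text \<open>Openness of the sets in the following definition (part of \<open>smooth_on\<close>) is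
  continuity of \<open>f\<close>.\<close>

definition smooth_map ::
    "('m, 'e::banach) chart set \<Rightarrow> ('n, 'f::banach) chart set \<Rightarrow> ('m \<Rightarrow> 'n) \<Rightarrow> bool" where
  "smooth_map M N f \<longleftrightarrow>
     f ` points M \<subseteq> points N \<and>
     (\<forall>c\<in>M. \<forall>d\<in>N. smooth_on (snd c ` {p \<in> fst c. f p \<in> fst d}) (local_rep c d f))"

definition open_subset :: "('m, 'e::banach) chart set \<Rightarrow> 'm set \<Rightarrow> bool" where
  "open_subset M W \<longleftrightarrow> W \<subseteq> points M \<and> (\<forall>c\<in>M. open (snd c ` (fst c \<inter> W)))"


section \<open>The tangent bundle\<close>

text \<open>
  A tangent vector at \<open>p\<close> is a pair \<open>(p, \<xi>)\<close>, where \<open>\<xi>\<close> assigns to every chart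
  \<open>c\<close> around \<open>p\<close> the coordinate vector \<open>\<xi> c\<close>, the coordinate vectors being
  related by the derivatives of the transition maps. The functions \<open>\<xi>\<close> are extensional,
  so that equality of tangent vectors is equality in the logic.
\<close>

type_synonym ('m, 'e) tvec = "'m \<times> (('m, 'e) chart \<Rightarrow> 'e)"

definition tangent_vectors :: "('m, 'e::banach) chart set \<Rightarrow> ('m, 'e) tvec set" where
  "tangent_vectors M = {(p, \<xi>). p \<in> points M \<and> \<xi> \<in> extensional (charts_at M p) \<and>
     (\<forall>c\<in>charts_at M p. \<forall>d\<in>charts_at M p.
        \<xi> d = frechet_derivative (local_rep c d id) (at (snd c p)) (\<xi> c))}"

definition tangent_chart ::
    "('m, 'e::banach) chart set \<Rightarrow> ('m, 'e) chart \<Rightarrow> (('m, 'e) tvec, 'e \<times> 'e) chart" where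
  "tangent_chart M c =
     ({v \<in> tangent_vectors M. fst v \<in> fst c}, \<lambda>v. (snd c (fst v), snd v c))"

definition tangent_bundle ::
    "('m, 'e::banach) chart set \<Rightarrow> (('m, 'e) tvec, 'e \<times> 'e) chart set" where
  "tangent_bundle M = tangent_chart M ` M"

abbreviation tangent_proj :: "('m, 'e) tvec \<Rightarrow> 'm" where
  "tangent_proj \<equiv> fst"

definition tangent_zero :: "('m, 'e::banach) chart set \<Rightarrow> 'm \<Rightarrow> ('m, 'e) tvec" where
  "tangent_zero M p = (p, \<lambda>c\<in>charts_at M p. 0)"

definition tangent_add ::
    "('m, 'e::banach) chart set \<Rightarrow> ('m, 'e) tvec \<Rightarrow> ('m, 'e) tvec \<Rightarrow> ('m, 'e) tvec" where
  "tangent_add M v w = (fst v, \<lambda>c\<in>charts_at M (fst v). snd v c + snd w c)"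

definition tangent_diff ::
    "('m, 'e::banach) chart set \<Rightarrow> ('m, 'e) tvec \<Rightarrow> ('m, 'e) tvec \<Rightarrow> ('m, 'e) tvec" where
  "tangent_diff M v w = (fst v, \<lambda>c\<in>charts_at M (fst v). snd v c - snd w c)"

text \<open>For smooth \<open>f\<close> the chart \<open>c\<close> chosen at the base point does not matter.\<close>

definition tangent_map ::
    "('m, 'e::banach) chart set \<Rightarrow> ('n, 'f::banach) chart set \<Rightarrow> ('m \<Rightarrow> 'n) \<Rightarrow>
     ('m, 'e) tvec \<Rightarrow> ('n, 'f) tvec" where
  "tangent_map M N f v =
     (let c = (SOME c. c \<in> charts_at M (fst v)) in
      (f (fst v), \<lambda>d\<in>charts_at N (f (fst v)).
         frechet_derivative (local_rep c d f) (at (snd c (fst v))) (snd v c)))"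

text \<open>
  The canonical flip on the second tangent bundle, given by its expression
  \<open>(x, x', \<delta>x, \<delta>x') \<mapsto> (x, \<delta>x, x', \<delta>x')\<close> in every chart of \<open>M\<close>.
\<close>

definition flip_coords :: "('e \<times> 'e) \<times> ('e \<times> 'e) \<Rightarrow> ('e \<times> 'e) \<times> ('e \<times> 'e)" where
  "flip_coords = (\<lambda>((x, x'), (dx, dx')). ((x, dx), (x', dx')))"

definition canonical_flip ::
    "('m, 'e::banach) chart set \<Rightarrow>
     (('m, 'e) tvec, 'e \<times> 'e) tvec \<Rightarrow> (('m, 'e) tvec, 'e \<times> 'e) tvec" where
  "canonical_flip M w =
     (let p = tangent_proj (tangent_proj w);
          coords = (\<lambda>c. snd (tangent_chart (tangent_bundle M) (tangent_chart M c)))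
      in THE w'. w' \<in> tangent_vectors (tangent_bundle M) \<and>
           tangent_proj (tangent_proj w') = p \<and>
           (\<forall>c\<in>charts_at M p. coords c w' = flip_coords (coords c w)))"


section \<open>Nijenhuis operators\<close>

definition N_operator ::
    "('m, 'e::banach) chart set \<Rightarrow> (('m, 'e) tvec \<Rightarrow> ('m, 'e) tvec) \<Rightarrow> bool" where
  "N_operator M N \<longleftrightarrow>
     smooth_map (tangent_bundle M) (tangent_bundle M) N \<and>
     (\<forall>v\<in>tangent_vectors M. tangent_proj (N v) = tangent_proj v) \<and>
     (\<forall>p\<in>points M. \<forall>c\<in>charts_at M p. \<exists>L. bounded_linear L \<and>
        (\<forall>v\<in>tangent_vectors M. tangent_proj v = p \<longrightarrow> snd (N v) c = L (snd v c)))"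

text \<open>Local vector fields on the open set \<open>W\<close>; only the values on \<open>W\<close> matter.\<close>

definition field_rep ::
    "('m, 'e) chart \<Rightarrow> ('m \<Rightarrow> ('m, 'e) tvec) \<Rightarrow> 'e \<Rightarrow> 'e" where
  "field_rep c X x = snd (X (chart_inv c x)) c"

definition vector_field_on ::
    "('m, 'e::banach) chart set \<Rightarrow> 'm set \<Rightarrow> ('m \<Rightarrow> ('m, 'e) tvec) \<Rightarrow> bool" where
  "vector_field_on M W X \<longleftrightarrow>
     open_subset M W \<and>
     (\<forall>p\<in>W. X p \<in> tangent_vectors M \<and> tangent_proj (X p) = p) \<and>
     (\<forall>c\<in>M. smooth_on (snd c ` (fst c \<inter> W)) (field_rep c X))"

definition lie_bracket ::
    "('m, 'e::banach) chart set \<Rightarrow> ('m \<Rightarrow> ('m, 'e) tvec) \<Rightarrow> ('m \<Rightarrow> ('m, 'e) tvec) \<Rightarrow>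
     'm \<Rightarrow> ('m, 'e) tvec" where
  "lie_bracket M X Y p = (p, \<lambda>c\<in>charts_at M p.
     frechet_derivative (field_rep c X) (at (snd c p)) (snd (Y p) c) -
     frechet_derivative (field_rep c Y) (at (snd c p)) (snd (X p) c))"

definition nijenhuis_torsion ::
    "('m, 'e::banach) chart set \<Rightarrow> (('m, 'e) tvec \<Rightarrow> ('m, 'e) tvec) \<Rightarrow>
     ('m \<Rightarrow> ('m, 'e) tvec) \<Rightarrow> ('m \<Rightarrow> ('m, 'e) tvec) \<Rightarrow> 'm \<Rightarrow> ('m, 'e) tvec" where
  "nijenhuis_torsion M N X Y p =
     tangent_diff M (lie_bracket M (N \<circ> X) (N \<circ> Y) p)
       (N (tangent_diff M
             (tangent_add M (lie_bracket M (N \<circ> X) Y p) (lie_bracket M X (N \<circ> Y) p))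
             (N (lie_bracket M X Y p))))"

definition nijenhuis_operator ::
    "('m, 'e::banach) chart set \<Rightarrow> (('m, 'e) tvec \<Rightarrow> ('m, 'e) tvec) \<Rightarrow> bool" where
  "nijenhuis_operator M N \<longleftrightarrow> N_operator M N \<and>
     (\<forall>W X Y. vector_field_on M W X \<longrightarrow> vector_field_on M W Y \<longrightarrow>
        (\<forall>p\<in>W. nijenhuis_torsion M N X Y p = tangent_zero M p))"

definition tangent_lift ::
    "('m, 'e::banach) chart set \<Rightarrow> (('m, 'e) tvec \<Rightarrow> ('m, 'e) tvec) \<Rightarrow>
     (('m, 'e) tvec, 'e \<times> 'e) tvec \<Rightarrow> (('m, 'e) tvec, 'e \<times> 'e) tvec" where
  "tangent_lift M N =
     canonical_flip M \<circ> tangent_map (tangent_bundle M) (tangent_bundle M) N \<circ> canonical_flip M"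


section \<open>Fibrations and projectability\<close>

text \<open>A submersion of Banach manifolds: the derivative is onto at every point and its
  kernel is complemented, i.e. the range of a bounded linear projection.\<close>

definition submersion ::
    "('m, 'e::banach) chart set \<Rightarrow> ('n, 'f::banach) chart set \<Rightarrow> ('m \<Rightarrow> 'n) \<Rightarrow> bool" where
  "submersion P P\<^sub>0 \<tau> \<longleftrightarrow> smooth_map P P\<^sub>0 \<tau> \<and>
     (\<forall>p\<in>points P. \<forall>c\<in>charts_at P p. \<forall>d\<in>charts_at P\<^sub>0 (\<tau> p).
        let L = frechet_derivative (local_rep c d \<tau>) (at (snd c p)) in
        surj L \<and> (\<exists>Q. bounded_linear Q \<and> Q \<circ> Q = Q \<and> range Q = {v. L v = 0}))"

definition fibration ::
    "('m, 'e::banach) chart set \<Rightarrow> ('n, 'f::banach) chart set \<Rightarrow> ('m \<Rightarrow> 'n) \<Rightarrow> bool" where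
  "fibration P P\<^sub>0 \<tau> \<longleftrightarrow> submersion P P\<^sub>0 \<tau> \<and> \<tau> ` points P = points P\<^sub>0"

definition projectable ::
    "('m, 'e::banach) chart set \<Rightarrow> ('n, 'f::banach) chart set \<Rightarrow> ('m \<Rightarrow> 'n) \<Rightarrow>
     (('m, 'e) tvec \<Rightarrow> ('m, 'e) tvec) \<Rightarrow> (('n, 'f) tvec \<Rightarrow> ('n, 'f) tvec) \<Rightarrow> bool" where
  "projectable P P\<^sub>0 \<tau> N N\<^sub>0 \<longleftrightarrow>
     fibration P P\<^sub>0 \<tau> \<and> N_operator P N \<and> N_operator P\<^sub>0 N\<^sub>0 \<and>
     (\<forall>v\<in>tangent_vectors P. tangent_map P P\<^sub>0 \<tau> (N v) = N\<^sub>0 (tangent_map P P\<^sub>0 \<tau> v))"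

end

theory Submission
  imports Defs
begin

text \<open>
  In a chart an operator \<open>N\<close> on the tangent bundle is a smooth map \<open>n (x, a)\<close>, linear in \<open>a\<close>.
  Since the torsion is tensorial, its value on the coordinate vectors \<open>a\<close>, \<open>b\<close> at \<open>x\<close> is an expression
  \<open>torsion_rep n x a b\<close> in \<open>n\<close> and its first derivative, and the operator is Nijenhuis iff
  this expression vanishes identically in every chart
  (\<open>nijenhuis_operator_iff_torsion_rep\<close>; one direction tests the torsion on fields that
  are constant in the chart).

  In the induced chart the tangent lift is
  \<open>lift_rep n ((x, v), (a, a')) = (n (x, a), Dn (x, a) (v, a'))\<close>: it is the fibre part of the
  tangent map of \<open>(x, a) \<mapsto> (x, n (x, a))\<close> conjugated by the flip. Forming the torsion
  commutes with this operation. The torsion of \<open>lift_rep n\<close> at \<open>(x, v)\<close> on \<open>(a, a')\<close>,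
  \<open>(b, b')\<close> has as first component \<open>torsion_rep n x a b\<close>, and as second component the
  derivative of \<open>torsion_rep n\<close> at \<open>(x, a, b)\<close> in the direction \<open>(v, a', b')\<close>, so both vanish
  if \<open>torsion_rep n\<close> does (\<open>torsion_lift_rep\<close>). Projectability is the first component of
  \<open>lift_rep\<close>.

  Two facts of calculus carry the argument. Compositions of smooth maps, and the map
  \<open>(x, v) \<mapsto> Df x v\<close> for smooth \<open>f\<close>, are smooth (\<open>smooth_on_compose\<close>, \<open>smooth_on_deriv\<close>); both
  come from a class of multilinear expressions that is closed under differentiation.
  Second derivatives are symmetric (\<open>second_deriv_sym\<close>): this is why the
  canonical flip and the Lie bracket do not depend on the chart, and why
  the second component above is a derivative of the torsion.
\<close>

section \<open>Smooth multilinear-valued maps\<close>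

abbreviation norm_prod :: "'a::real_normed_vector list \<Rightarrow> real" where
  "norm_prod vs \<equiv> prod_list (map norm vs)"

text \<open>
  The estimate of \<open>smooth_on\<close> for a single order: \<open>G'\<close> is the derivative of \<open>G\<close> for the operator
  norm on \<open>k\<close>-linear maps.
\<close>
definition multilinear_deriv ::
    "'a::real_normed_vector set \<Rightarrow> nat \<Rightarrow> ('a \<Rightarrow> 'a list \<Rightarrow> 'b::real_normed_vector) \<Rightarrow>
     ('a \<Rightarrow> 'a list \<Rightarrow> 'b) \<Rightarrow> bool" where
  "multilinear_deriv U k G G' \<longleftrightarrow>
     (\<forall>x\<in>U. \<forall>\<epsilon>>0. \<exists>\<delta>>0. \<forall>y\<in>U. norm (y - x) < \<delta> \<longrightarrow>
        (\<forall>vs. length vs = k \<longrightarrow>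
           norm (G y vs - G x vs - G' x ((y - x) # vs)) \<le> \<epsilon> * norm (y - x) * norm_prod vs))"

text \<open>
  Smoothness of maps with \<open>k\<close>-linear values. Being coinductive, it reduces a smoothness proof to
  exhibiting a class of maps that is closed under differentiation, without naming
  all higher derivatives.
\<close>
coinductive msmooth ::
    "'a::real_normed_vector set \<Rightarrow> nat \<Rightarrow> ('a \<Rightarrow> 'a list \<Rightarrow> 'b::real_normed_vector) \<Rightarrow> bool"
  for U where
  msmoothI: "\<forall>x\<in>U. bounded_multilinear k (G x) \<Longrightarrow> multilinear_deriv U k G G' \<Longrightarrow>
    msmooth U (Suc k) G' \<Longrightarrow> msmooth U k G"

lemma norm_prod_nonneg [simp]: "0 \<le> norm_prod vs"
  by (induction vs) auto

lemma smooth_on_iff_msmooth: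
  "smooth_on U f \<longleftrightarrow> open U \<and> msmooth U 0 (\<lambda>x vs. f x)"
proof
  assume "smooth_on U f"
  then obtain D where U: "open U" and D0: "\<forall>x\<in>U. D 0 x [] = f x"
    and bm: "\<forall>k. \<forall>x\<in>U. bounded_multilinear k (D k x)"
    and dv: "\<forall>k. multilinear_deriv U k (D k) (D (Suc k))"
    unfolding smooth_on_def multilinear_deriv_def by blast
  have *: "msmooth U k (D k)" for k
    by (coinduction arbitrary: k) (use bm dv in blast)
  have "msmooth U 0 (\<lambda>x vs. f x)"
  proof (rule msmoothI)
    show "\<forall>x\<in>U. bounded_multilinear 0 (\<lambda>vs. f x)"
      by (auto simp: bounded_multilinear_def)
    show "multilinear_deriv U 0 (\<lambda>x vs. f x) (D 1)"
      using dv[rule_format, of 0] D0 by (simp add: multilinear_deriv_def)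
    show "msmooth U (Suc 0) (D 1)" using *[of 1] by simp
  qed
  with U show "open U \<and> msmooth U 0 (\<lambda>x vs. f x)" by blast
next
  assume as: "open U \<and> msmooth U 0 (\<lambda>x vs. f x)"
  \<comment> \<open>The coinductive predicate only yields one derivative at a time; dependent choice
      assembles them into the sequence demanded by the definition.\<close>
  have "\<exists>D. \<forall>k. (msmooth U k (D k) \<and> (k = 0 \<longrightarrow> D k = (\<lambda>x vs. f x))) \<and>
          multilinear_deriv U k (D k) (D (Suc k))"
  proof (rule dependent_nat_choice)
    fix G k assume "msmooth U k G \<and> (k = 0 \<longrightarrow> G = (\<lambda>x vs. f x))"
    then show "\<exists>H. (msmooth U (Suc k) H \<and> (Suc k = 0 \<longrightarrow> H = (\<lambda>x vs. f x))) \<and>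
          multilinear_deriv U k G H"
      by (metis msmooth.cases nat.distinct(1))
  qed (use as in blast)
  then obtain D where D: "\<And>k. msmooth U k (D k)" "D 0 = (\<lambda>x vs. f x)"
      "\<And>k. multilinear_deriv U k (D k) (D (Suc k))" by blast
  then have "\<forall>k. \<forall>x\<in>U. bounded_multilinear k (D k x)" by (metis msmooth.cases)
  with as D show "smooth_on U f"
    unfolding smooth_on_def multilinear_deriv_def[symmetric]
    by (intro conjI exI[of _ D]) auto
qed

text \<open>
  An error bounded by any fixed multiple of \<open>\<epsilon>\<close> suffices, which spares all later proofs the
  bookkeeping of constants; the multiple may depend on the point.
\<close>
lemma multilinear_derivI:
  assumes "\<And>x. x \<in> U \<Longrightarrow> \<exists>B. \<forall>\<epsilon>>0. \<exists>\<delta>>0. \<forall>y\<in>U. norm (y - x) < \<delta> \<longrightarrow>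
        (\<forall>vs. length vs = k \<longrightarrow>
           norm (G y vs - G x vs - G' x ((y - x) # vs)) \<le> B * \<epsilon> * norm (y - x) * norm_prod vs)"
  shows "multilinear_deriv U k G G'"
  unfolding multilinear_deriv_def
proof (intro ballI allI impI)
  fix x and \<epsilon> :: real assume x: "x \<in> U" and \<epsilon>: "\<epsilon> > 0"
  obtain B where B: "\<And>\<epsilon>. \<epsilon> > 0 \<Longrightarrow> \<exists>\<delta>>0. \<forall>y\<in>U. norm (y - x) < \<delta> \<longrightarrow>
        (\<forall>vs. length vs = k \<longrightarrow>
           norm (G y vs - G x vs - G' x ((y - x) # vs)) \<le> B * \<epsilon> * norm (y - x) * norm_prod vs)"
    using assms[OF x] by blast
  define \<eta> where "\<eta> = \<epsilon> / (\<bar>B\<bar> + 1)"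
  have \<eta>: "\<eta> > 0" using \<epsilon> by (simp add: \<eta>_def)
  have "B * \<epsilon> \<le> (\<bar>B\<bar> + 1) * \<epsilon>" using \<epsilon> by (intro mult_right_mono) auto
  then have le: "B * \<eta> \<le> \<epsilon>" by (simp add: \<eta>_def divide_le_eq algebra_simps)
  have le': "B * \<eta> * norm (y - x) * norm_prod vs \<le> \<epsilon> * norm (y - x) * norm_prod vs" for y vs
    using le by (intro mult_right_mono) auto
  obtain \<delta> where "\<delta> > 0" "\<forall>y\<in>U. norm (y - x) < \<delta> \<longrightarrow>
        (\<forall>vs. length vs = k \<longrightarrow>
           norm (G y vs - G x vs - G' x ((y - x) # vs)) \<le> B * \<eta> * norm (y - x) * norm_prod vs)"
    using B[OF \<eta>] by blast
  then show "\<exists>\<delta>>0. \<forall>y\<in>U. norm (y - x) < \<delta> \<longrightarrow>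
        (\<forall>vs. length vs = k \<longrightarrow>
           norm (G y vs - G x vs - G' x ((y - x) # vs)) \<le> \<epsilon> * norm (y - x) * norm_prod vs)"
    using le' by (meson order_trans)
qed

lemma multilinear_derivD:
  assumes "multilinear_deriv U k G G'" "x \<in> U" "\<epsilon> > 0"
  obtains \<delta> where "\<delta> > 0" "\<And>y vs. y \<in> U \<Longrightarrow> norm (y - x) < \<delta> \<Longrightarrow> length vs = k \<Longrightarrow>
     norm (G y vs - G x vs - G' x ((y - x) # vs)) \<le> \<epsilon> * norm (y - x) * norm_prod vs"
  using assms unfolding multilinear_deriv_def by meson

lemma bounded_multilinear_linear:
  "bounded_multilinear k m \<Longrightarrow> length us + length ws + 1 = k \<Longrightarrow> linear (\<lambda>v. m (us @ v # ws))"
  by (auto simp: bounded_multilinear_def)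

lemma bounded_multilinear_linear_hd:
  "bounded_multilinear (Suc k) m \<Longrightarrow> length ws = k \<Longrightarrow> linear (\<lambda>v. m (v # ws))"
  using bounded_multilinear_linear[of "Suc k" m "[]" ws] by simp

lemma bounded_multilinear_bound:
  assumes "bounded_multilinear k m"
  obtains C where "C \<ge> 0" "\<And>vs. length vs = k \<Longrightarrow> norm (m vs) \<le> C * norm_prod vs"
proof -
  obtain C where C: "\<And>vs. length vs = k \<Longrightarrow> norm (m vs) \<le> C * norm_prod vs"
    using assms by (auto simp: bounded_multilinear_def)
  have "norm (m vs) \<le> \<bar>C\<bar> * norm_prod vs" if "length vs = k" for vs
    using C[OF that] mult_right_mono[OF abs_ge_self norm_prod_nonneg, of C vs] by linarith
  then show thesis by (intro that[of "\<bar>C\<bar>"]) auto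
qed

lemma multilinear_deriv_lipschitz:
  assumes "multilinear_deriv U k G G'" "bounded_multilinear (Suc k) (G' x)" "x \<in> U"
  obtains \<delta> L where "\<delta> > 0" "L \<ge> 0" "\<And>y vs. y \<in> U \<Longrightarrow> norm (y - x) < \<delta> \<Longrightarrow> length vs = k \<Longrightarrow>
     norm (G y vs - G x vs) \<le> L * norm (y - x) * norm_prod vs"
proof -
  obtain \<delta> where \<delta>: "\<delta> > 0" "\<And>y vs. y \<in> U \<Longrightarrow> norm (y - x) < \<delta> \<Longrightarrow> length vs = k \<Longrightarrow>
     norm (G y vs - G x vs - G' x ((y - x) # vs)) \<le> 1 * norm (y - x) * norm_prod vs"
    using multilinear_derivD[OF assms(1,3), of 1] by auto
  obtain C where C: "C \<ge> 0" "\<And>vs. length vs = Suc k \<Longrightarrow> norm (G' x vs) \<le> C * norm_prod vs"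
    using bounded_multilinear_bound[OF assms(2)] by blast
  have "norm (G y vs - G x vs) \<le> (1 + C) * norm (y - x) * norm_prod vs"
    if y: "y \<in> U" "norm (y - x) < \<delta>" "length vs = k" for y vs
  proof -
    have "norm (G' x ((y - x) # vs)) \<le> C * (norm (y - x) * norm_prod vs)"
      using C(2)[of "(y - x) # vs"] y by simp
    then have "norm (G y vs - G x vs) \<le> 1 * norm (y - x) * norm_prod vs + C * (norm (y - x) * norm_prod vs)"
      using \<delta>(2)[OF y] norm_triangle_sub[of "G y vs - G x vs" "G' x ((y - x) # vs)"] by linarith
    then show ?thesis by (simp add: algebra_simps)
  qed
  then show thesis using that[of \<delta> "1 + C"] \<delta>(1) C(1) by simp
qed

lemma bounded_multilinear_add:
  assumes "bounded_multilinear k m" "bounded_multilinear k m'"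
  shows "bounded_multilinear k (\<lambda>vs. m vs + m' vs)"
proof -
  obtain C where C: "\<And>vs. length vs = k \<Longrightarrow> norm (m vs) \<le> C * norm_prod vs"
    using bounded_multilinear_bound[OF assms(1)] by blast
  obtain C' where C': "\<And>vs. length vs = k \<Longrightarrow> norm (m' vs) \<le> C' * norm_prod vs"
    using bounded_multilinear_bound[OF assms(2)] by blast
  have "norm (m vs + m' vs) \<le> (C + C') * norm_prod vs" if "length vs = k" for vs
    using norm_triangle_ineq[of "m vs" "m' vs"] C[OF that] C'[OF that] by (simp add: distrib_right)
  moreover have "linear (\<lambda>v. m (us @ v # ws) + m' (us @ v # ws))"
    if "length us + length ws + 1 = k" for us ws
    by (intro linear_compose_add bounded_multilinear_linear[OF assms(1) that]
          bounded_multilinear_linear[OF assms(2) that])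
  ultimately show ?thesis unfolding bounded_multilinear_def by blast
qed

lemma multilinear_deriv_add:
  assumes "multilinear_deriv U k G G'" "multilinear_deriv U k H H'"
  shows "multilinear_deriv U k (\<lambda>x vs. G x vs + H x vs) (\<lambda>x vs. G' x vs + H' x vs)"
proof (rule multilinear_derivI, rule exI[of _ 2], intro allI impI)
  fix x and \<epsilon> :: real assume x: "x \<in> U" and \<epsilon>: "\<epsilon> > 0"
  obtain d where d: "d > 0" "\<And>y vs. y \<in> U \<Longrightarrow> norm (y - x) < d \<Longrightarrow> length vs = k \<Longrightarrow>
     norm (G y vs - G x vs - G' x ((y - x) # vs)) \<le> \<epsilon> * norm (y - x) * norm_prod vs"
    using multilinear_derivD[OF assms(1) x \<epsilon>] by blast
  obtain e where e: "e > 0" "\<And>y vs. y \<in> U \<Longrightarrow> norm (y - x) < e \<Longrightarrow> length vs = k \<Longrightarrow>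
     norm (H y vs - H x vs - H' x ((y - x) # vs)) \<le> \<epsilon> * norm (y - x) * norm_prod vs"
    using multilinear_derivD[OF assms(2) x \<epsilon>] by blast
  have "norm (G y vs + H y vs - (G x vs + H x vs) - (G' x ((y - x) # vs) + H' x ((y - x) # vs)))
          \<le> 2 * \<epsilon> * norm (y - x) * norm_prod vs"
    if "y \<in> U" "norm (y - x) < min d e" "length vs = k" for y vs
  proof -
    have "norm (G y vs - G x vs - G' x ((y - x) # vs)) \<le> \<epsilon> * norm (y - x) * norm_prod vs"
      "norm (H y vs - H x vs - H' x ((y - x) # vs)) \<le> \<epsilon> * norm (y - x) * norm_prod vs"
      using that d(2) e(2) by auto
    then show ?thesis
      using norm_triangle_ineq[of "G y vs - G x vs - G' x ((y - x) # vs)" "H y vs - H x vs - H' x ((y - x) # vs)"]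
      by (simp add: algebra_simps)
  qed
  then show "\<exists>\<delta>>0. \<forall>y\<in>U. norm (y - x) < \<delta> \<longrightarrow> (\<forall>vs. length vs = k \<longrightarrow>
      norm (G y vs + H y vs - (G x vs + H x vs) - (G' x ((y - x) # vs) + H' x ((y - x) # vs)))
          \<le> 2 * \<epsilon> * norm (y - x) * norm_prod vs)"
    using d(1) e(1) by (intro exI[of _ "min d e"]) auto
qed

section \<open>Substitution of multilinear maps\<close>

definition pick :: "nat list \<Rightarrow> 'a list \<Rightarrow> 'a list" where
  "pick I vs = map ((!) vs) I"

text \<open>
  The value of \<open>a\<close> is substituted for one argument of \<open>m\<close>; the entries of the argument list are
  distributed over the free slots by their indices. The positions of the slots matter because a
  derivative puts its new direction at the head of the list: this turns \<open>K\<close> into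
  \<open>0 # map Suc K\<close> when \<open>m\<close> is differentiated, and \<open>I\<close> into \<open>0 # map Suc I\<close> when \<open>a\<close> is.
\<close>
definition plug ::
    "nat list \<Rightarrow> nat list \<Rightarrow> nat list \<Rightarrow> ('x \<Rightarrow> 'p list \<Rightarrow> 'c) \<Rightarrow> ('x \<Rightarrow> 'p list \<Rightarrow> 'p) \<Rightarrow>
     'x \<Rightarrow> 'p list \<Rightarrow> 'c" where
  "plug K I J m a = (\<lambda>x vs. m x (pick K vs @ a x (pick I vs) # pick J vs))"

lemma length_pick [simp]: "length (pick I vs) = length I"
  by (simp add: pick_def)

lemma pick_append [simp]: "pick (I @ J) vs = pick I vs @ pick J vs"
  by (simp add: pick_def)

lemma pick_Cons [simp]: "pick (i # I) vs = vs ! i # pick I vs"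
  by (simp add: pick_def)

lemma pick_Nil [simp]: "pick [] vs = []"
  by (simp add: pick_def)

lemma pick_Suc [simp]: "pick (map Suc I) (v # vs) = pick I vs"
  by (simp add: pick_def)

lemma norm_prod_pick:
  assumes "mset I = mset [0..<k]" "length vs = k"
  shows "norm_prod (pick I vs) = norm_prod vs"
proof -
  have "mset (pick I vs) = mset vs"
    using assms by (metis map_nth mset_map pick_def)
  then show ?thesis by (metis mset_map prod_mset_prod_list)
qed

lemma pick_slot_notin:
  assumes "length us \<notin> set I"
  shows "pick I (us @ v # ws) = pick I (us @ w # ws)"
  using assms unfolding pick_def by (auto simp: nth_append nth_Cons split: nat.split)

text \<open>
  Each index occurs exactly once in \<open>K @ I @ J\<close>, so varying one argument varies exactly one slot of
  \<open>m\<close> or of \<open>a\<close>.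
\<close>
lemma bounded_multilinear_plug:
  assumes m: "bounded_multilinear (length K + 1 + length J) (m x)"
    and a: "bounded_multilinear (length I) (a x)"
    and perm: "mset (K @ I @ J) = mset [0..<k]"
  shows "bounded_multilinear k (plug K I J m a x)"
proof -
  have dist: "distinct (K @ I @ J)" and set: "set (K @ I @ J) = {..<k}"
    using perm by (metis distinct_upt mset_eq_imp_distinct_iff, metis perm atLeast0LessThan mset_eq_setD set_upt)
  have "linear (\<lambda>v. plug K I J m a x (us @ v # ws))" if len: "length us + length ws + 1 = k" for us ws
  proof -
    let ?i = "length us"
    define c where "c A = pick A (us @ 0 # ws)" for A
    have c: "pick A (us @ v # ws) = c A" if "?i \<notin> set A" for A v
      unfolding c_def by (rule pick_slot_notin[OF that])
    have "?i \<in> set (K @ I @ J)" unfolding set using len by simp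
    then consider "?i \<in> set K" | "?i \<in> set I" | "?i \<in> set J" by auto
    then show ?thesis
    proof cases
      case 1
      then obtain K1 K2 where K: "K = K1 @ ?i # K2" by (meson split_list)
      then have n: "?i \<notin> set K1" "?i \<notin> set K2" "?i \<notin> set I" "?i \<notin> set J" using dist by auto
      have "plug K I J m a x (us @ v # ws) = m x (c K1 @ v # (c K2 @ a x (c I) # c J))" for v
        by (simp add: plug_def K c n)
      then show ?thesis
        using bounded_multilinear_linear[OF m, of "c K1" "c K2 @ a x (c I) # c J"]
        by (simp add: K c_def)
    next
      case 2
      then obtain I1 I2 where I: "I = I1 @ ?i # I2" by (meson split_list)
      then have n: "?i \<notin> set I1" "?i \<notin> set I2" "?i \<notin> set K" "?i \<notin> set J" using dist by auto
      have "(\<lambda>v. plug K I J m a x (us @ v # ws)) =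
          (\<lambda>v. m x (c K @ v # c J)) \<circ> (\<lambda>v. a x (c I1 @ v # c I2))"
        by (simp add: fun_eq_iff plug_def I c n)
      moreover have "linear (\<lambda>v. m x (c K @ v # c J))"
        using bounded_multilinear_linear[OF m, of "c K" "c J"] by (simp add: c_def)
      moreover have "linear (\<lambda>v. a x (c I1 @ v # c I2))"
        using bounded_multilinear_linear[OF a, of "c I1" "c I2"] by (simp add: I c_def)
      ultimately show ?thesis by (metis linear_compose)
    next
      case 3
      then obtain J1 J2 where J: "J = J1 @ ?i # J2" by (meson split_list)
      then have n: "?i \<notin> set J1" "?i \<notin> set J2" "?i \<notin> set I" "?i \<notin> set K" using dist by auto
      have "plug K I J m a x (us @ v # ws) = m x ((c K @ a x (c I) # c J1) @ v # c J2)" for v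
        by (simp add: plug_def J c n)
      then show ?thesis
        using bounded_multilinear_linear[OF m, of "c K @ a x (c I) # c J1" "c J2"]
        by (simp add: J c_def)
    qed
  qed
  moreover have "\<exists>C. \<forall>vs. length vs = k \<longrightarrow> norm (plug K I J m a x vs) \<le> C * norm_prod vs"
  proof -
    obtain C where C: "C \<ge> 0" "\<And>vs. length vs = length K + 1 + length J \<Longrightarrow> norm (m x vs) \<le> C * norm_prod vs"
      using bounded_multilinear_bound[OF m] by blast
    obtain A where A: "A \<ge> 0" "\<And>vs. length vs = length I \<Longrightarrow> norm (a x vs) \<le> A * norm_prod vs"
      using bounded_multilinear_bound[OF a] by blast
    have "norm (plug K I J m a x vs) \<le> C * A * norm_prod vs" if "length vs = k" for vs
    proof -
      have "norm (plug K I J m a x vs) \<le>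
          C * (norm_prod (pick K vs) * (norm (a x (pick I vs)) * norm_prod (pick J vs)))"
        using C(2)[of "pick K vs @ a x (pick I vs) # pick J vs"] by (simp add: plug_def)
      also have "\<dots> \<le> C * (norm_prod (pick K vs) * ((A * norm_prod (pick I vs)) * norm_prod (pick J vs)))"
        by (intro mult_left_mono mult_right_mono A C) auto
      also have "\<dots> = C * A * norm_prod vs"
        using norm_prod_pick[OF perm that] by simp
      finally show ?thesis .
    qed
    then show ?thesis by blast
  qed
  ultimately show ?thesis unfolding bounded_multilinear_def by blast
qed

text \<open>
  The product rule: substitution is bilinear in \<open>m\<close> and \<open>a\<close>. The list entries at the indices \<open>K\<close>, \<open>I\<close>
  and \<open>J\<close> form \<open>p\<close>, \<open>q\<close> and \<open>r\<close> below, and the error splits into the first-order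
  remainder of \<open>m\<close>, that of \<open>a\<close>, and a mixed term that is quadratic in \<open>y - x\<close>.
\<close>
lemma multilinear_deriv_plug:
  assumes m: "multilinear_deriv U (length K + 1 + length J) m m'"
    and a: "multilinear_deriv U (length I) a a'"
    and bm: "\<And>x. x \<in> U \<Longrightarrow> bounded_multilinear (length K + 1 + length J) (m x)"
    and bm': "\<And>x. x \<in> U \<Longrightarrow> bounded_multilinear (Suc (length K + 1 + length J)) (m' x)"
    and ba: "\<And>x. x \<in> U \<Longrightarrow> bounded_multilinear (length I) (a x)"
    and ba': "\<And>x. x \<in> U \<Longrightarrow> bounded_multilinear (Suc (length I)) (a' x)"
    and perm: "mset (K @ I @ J) = mset [0..<k]"
  shows "multilinear_deriv U k (plug K I J m a)
    (\<lambda>x vs. plug (0 # map Suc K) (map Suc I) (map Suc J) m' a x vs +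
            plug (map Suc K) (0 # map Suc I) (map Suc J) m a' x vs)"
proof (rule multilinear_derivI)
  fix x assume x: "x \<in> U"
  obtain Cm where Cm: "Cm \<ge> 0" "\<And>vs. length vs = length K + 1 + length J \<Longrightarrow> norm (m x vs) \<le> Cm * norm_prod vs"
    using bounded_multilinear_bound[OF bm[OF x]] by blast
  obtain Cm' where Cm': "Cm' \<ge> 0" "\<And>vs. length vs = Suc (length K + 1 + length J) \<Longrightarrow> norm (m' x vs) \<le> Cm' * norm_prod vs"
    using bounded_multilinear_bound[OF bm'[OF x]] by blast
  obtain Ca where Ca: "Ca \<ge> 0" "\<And>vs. length vs = length I \<Longrightarrow> norm (a x vs) \<le> Ca * norm_prod vs"
    using bounded_multilinear_bound[OF ba[OF x]] by blast
  obtain d L where d: "d > 0" and L: "L \<ge> 0"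
    "\<And>y vs. y \<in> U \<Longrightarrow> norm (y - x) < d \<Longrightarrow> length vs = length I \<Longrightarrow>
      norm (a y vs - a x vs) \<le> L * norm (y - x) * norm_prod vs"
    using multilinear_deriv_lipschitz[OF a ba'[OF x] x] by blast
  define B where "B = (Ca + L) + Cm' * L + Cm"
  show "\<exists>B. \<forall>\<epsilon>>0. \<exists>\<delta>>0. \<forall>y\<in>U. norm (y - x) < \<delta> \<longrightarrow> (\<forall>vs. length vs = k \<longrightarrow>
      norm (plug K I J m a y vs - plug K I J m a x vs -
        (plug (0 # map Suc K) (map Suc I) (map Suc J) m' a x ((y - x) # vs) +
         plug (map Suc K) (0 # map Suc I) (map Suc J) m a' x ((y - x) # vs)))
      \<le> B * \<epsilon> * norm (y - x) * norm_prod vs)"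
  proof (rule exI[of _ B], intro allI impI)
    fix \<epsilon> :: real assume \<epsilon>: "\<epsilon> > 0"
    obtain d1 where d1: "d1 > 0" "\<And>y vs. y \<in> U \<Longrightarrow> norm (y - x) < d1 \<Longrightarrow> length vs = length K + 1 + length J \<Longrightarrow>
       norm (m y vs - m x vs - m' x ((y - x) # vs)) \<le> \<epsilon> * norm (y - x) * norm_prod vs"
      using multilinear_derivD[OF m x \<epsilon>] by blast
    obtain d2 where d2: "d2 > 0" "\<And>y vs. y \<in> U \<Longrightarrow> norm (y - x) < d2 \<Longrightarrow> length vs = length I \<Longrightarrow>
       norm (a y vs - a x vs - a' x ((y - x) # vs)) \<le> \<epsilon> * norm (y - x) * norm_prod vs"
      using multilinear_derivD[OF a x \<epsilon>] by blast
    \<comment> \<open>The bound \<open>\<epsilon>\<close> on the distance controls the quadratic mixed term, the bound \<open>1\<close> makes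
        \<open>a y\<close> bounded by \<open>Ca + L\<close>.\<close>
    define \<delta> where "\<delta> = Min {d, d1, d2, \<epsilon>, 1}"
    have \<delta>: "\<delta> > 0" using d d1 d2 \<epsilon> by (simp add: \<delta>_def)
    have "norm (plug K I J m a y vs - plug K I J m a x vs -
        (plug (0 # map Suc K) (map Suc I) (map Suc J) m' a x ((y - x) # vs) +
         plug (map Suc K) (0 # map Suc I) (map Suc J) m a' x ((y - x) # vs)))
      \<le> B * \<epsilon> * norm (y - x) * norm_prod vs"
      if y: "y \<in> U" "norm (y - x) < \<delta>" and len: "length vs = k" for y vs
    proof -
      let ?h = "norm (y - x)"
      define p q r where "p = pick K vs" and "q = pick I vs" and "r = pick J vs"
      define u w where "u = a y q" and "w = a x q"
      have lens [simp]: "length p = length K" "length q = length I" "length r = length J"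
        by (simp_all add: p_def q_def r_def)
      have h: "?h < d" "?h < d1" "?h < d2" "?h < \<epsilon>" "?h < 1" using y(2) by (auto simp: \<delta>_def)
      have P: "norm_prod p * norm_prod q * norm_prod r = norm_prod vs"
        using norm_prod_pick[OF perm len] by (simp add: p_def q_def r_def mult.assoc)
      note nn [simp] = norm_prod_nonneg[of p] norm_prod_nonneg[of q] norm_prod_nonneg[of r]
      have uw: "norm (u - w) \<le> L * ?h * norm_prod q"
        unfolding u_def w_def by (rule L(2)) (use y h in auto)
      have "L * ?h * norm_prod q \<le> L * 1 * norm_prod q"
        using h L(1) by (intro mult_right_mono mult_left_mono) auto
      then have u: "norm u \<le> (Ca + L) * norm_prod q"
        using uw norm_triangle_sub[of u w] Ca(2)[of q] by (simp add: w_def distrib_right)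
      have uw': "norm (u - w - a' x ((y - x) # q)) \<le> \<epsilon> * ?h * norm_prod q"
        unfolding u_def w_def by (rule d2(2)) (use y h in auto)
      have lin: "linear (\<lambda>v. m x (p @ v # r))"
        using bounded_multilinear_linear[OF bm[OF x], of p r] by simp
      have lin': "linear (\<lambda>v. m' x ((y - x) # p @ v # r))"
        using bounded_multilinear_linear[OF bm'[OF x], of "(y - x) # p" r] by simp
      have "plug K I J m a y vs - plug K I J m a x vs -
        (plug (0 # map Suc K) (map Suc I) (map Suc J) m' a x ((y - x) # vs) +
         plug (map Suc K) (0 # map Suc I) (map Suc J) m a' x ((y - x) # vs)) =
         m y (p @ u # r) - m x (p @ w # r) - (m' x ((y - x) # p @ w # r) +
         m x (p @ a' x ((y - x) # q) # r))"
        by (simp add: plug_def p_def q_def r_def u_def w_def)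
      also have "\<dots> = (m y (p @ u # r) - m x (p @ u # r) - m' x ((y - x) # p @ u # r)) +
          m' x ((y - x) # p @ (u - w) # r) + m x (p @ (u - w - a' x ((y - x) # q)) # r)"
        using linear_diff[OF lin'] linear_diff[OF lin] by simp
      finally have eq: "plug K I J m a y vs - plug K I J m a x vs -
        (plug (0 # map Suc K) (map Suc I) (map Suc J) m' a x ((y - x) # vs) +
         plug (map Suc K) (0 # map Suc I) (map Suc J) m a' x ((y - x) # vs)) = \<dots>" .
      have "norm (m y (p @ u # r) - m x (p @ u # r) - m' x ((y - x) # p @ u # r)) \<le>
          \<epsilon> * ?h * norm_prod (p @ u # r)"
        by (rule d1(2)) (use y h in auto)
      also have "\<dots> = \<epsilon> * ?h * (norm_prod p * (norm u * norm_prod r))" by simp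
      also have "\<dots> \<le> \<epsilon> * ?h * (norm_prod p * (((Ca + L) * norm_prod q) * norm_prod r))"
        using \<epsilon> by (intro mult_left_mono mult_right_mono u) auto
      also have "\<dots> = (Ca + L) * \<epsilon> * ?h * norm_prod vs" using P by (simp add: algebra_simps)
      finally have 1: "norm (m y (p @ u # r) - m x (p @ u # r) - m' x ((y - x) # p @ u # r)) \<le>
          (Ca + L) * \<epsilon> * ?h * norm_prod vs" .
      have "norm (m' x ((y - x) # p @ (u - w) # r)) \<le> Cm' * norm_prod ((y - x) # p @ (u - w) # r)"
        by (rule Cm') simp
      also have "\<dots> = Cm' * (?h * (norm_prod p * (norm (u - w) * norm_prod r)))" by simp
      also have "\<dots> \<le> Cm' * (?h * (norm_prod p * ((L * ?h * norm_prod q) * norm_prod r)))"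
        by (intro mult_left_mono mult_right_mono uw) (use Cm' in auto)
      also have "\<dots> = Cm' * L * ?h * ?h * norm_prod vs" using P by (simp add: algebra_simps)
      also have "\<dots> \<le> Cm' * L * \<epsilon> * ?h * norm_prod vs"
        using h Cm'(1) L(1) by (intro mult_left_mono mult_right_mono) auto
      finally have 2: "norm (m' x ((y - x) # p @ (u - w) # r)) \<le> Cm' * L * \<epsilon> * ?h * norm_prod vs" .
      have "norm (m x (p @ (u - w - a' x ((y - x) # q)) # r)) \<le> Cm * norm_prod (p @ (u - w - a' x ((y - x) # q)) # r)"
        by (rule Cm) simp
      also have "\<dots> = Cm * (norm_prod p * (norm (u - w - a' x ((y - x) # q)) * norm_prod r))" by simp
      also have "\<dots> \<le> Cm * (norm_prod p * ((\<epsilon> * ?h * norm_prod q) * norm_prod r))"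
        by (intro mult_left_mono mult_right_mono uw') (use Cm in auto)
      also have "\<dots> = Cm * \<epsilon> * ?h * norm_prod vs" using P by (simp add: algebra_simps)
      finally have 3: "norm (m x (p @ (u - w - a' x ((y - x) # q)) # r)) \<le> Cm * \<epsilon> * ?h * norm_prod vs" .
      show ?thesis
        unfolding eq B_def distrib_right
        by (intro order_trans[OF norm_triangle_ineq] add_mono 1 2[unfolded distrib_right] 1[unfolded distrib_right] 3)
    qed
    then show "\<exists>\<delta>>0. \<forall>y\<in>U. norm (y - x) < \<delta> \<longrightarrow> (\<forall>vs. length vs = k \<longrightarrow>
      norm (plug K I J m a y vs - plug K I J m a x vs -
        (plug (0 # map Suc K) (map Suc I) (map Suc J) m' a x ((y - x) # vs) +
         plug (map Suc K) (0 # map Suc I) (map Suc J) m a' x ((y - x) # vs)))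
      \<le> B * \<epsilon> * norm (y - x) * norm_prod vs)"
      using \<delta> by blast
  qed
qed

text \<open>
  The chain rule. Domain and codomain of \<open>f\<close> coincide, so that the derivative \<open>m' (f x) (f' x v # vs)\<close>
  is again an instance of \<open>plug\<close> with all arguments in one space.
\<close>
lemma multilinear_deriv_compose:
  fixes U V :: "'a::real_normed_vector set" and f :: "'a \<Rightarrow> 'a"
  assumes m: "multilinear_deriv V k m m'"
    and f: "multilinear_deriv U 0 (\<lambda>x vs. f x) f'"
    and fU: "f ` U \<subseteq> V"
    and bm': "\<And>y. y \<in> V \<Longrightarrow> bounded_multilinear (Suc k) (m' y)"
    and bf': "\<And>x. x \<in> U \<Longrightarrow> bounded_multilinear 1 (f' x)"
  shows "multilinear_deriv U k (\<lambda>x. m (f x)) (plug [] [0] [1..<Suc k] (\<lambda>x. m' (f x)) f')"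
proof (rule multilinear_derivI)
  fix x assume x: "x \<in> U"
  have fx: "f x \<in> V" using x fU by blast
  obtain C where C: "C \<ge> 0" "\<And>vs. length vs = Suc k \<Longrightarrow> norm (m' (f x) vs) \<le> C * norm_prod vs"
    using bounded_multilinear_bound[OF bm'[OF fx]] by blast
  obtain d L where d: "d > 0" and L: "L \<ge> 0"
    "\<And>y. y \<in> U \<Longrightarrow> norm (y - x) < d \<Longrightarrow> norm (f y - f x) \<le> L * norm (y - x)"
    using multilinear_deriv_lipschitz[OF f _ x] bf'[OF x]
    by (metis One_nat_def list.simps(8) list.size(3) mult.right_neutral prod_list.Nil)
  show "\<exists>B. \<forall>\<epsilon>>0. \<exists>\<delta>>0. \<forall>y\<in>U. norm (y - x) < \<delta> \<longrightarrow> (\<forall>vs. length vs = k \<longrightarrow>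
      norm (m (f y) vs - m (f x) vs - plug [] [0] [1..<Suc k] (\<lambda>x. m' (f x)) f' x ((y - x) # vs))
      \<le> B * \<epsilon> * norm (y - x) * norm_prod vs)"
  proof (rule exI[of _ "L + C"], intro allI impI)
    fix \<epsilon> :: real assume \<epsilon>: "\<epsilon> > 0"
    obtain d1 where d1: "d1 > 0" "\<And>y vs. y \<in> V \<Longrightarrow> norm (y - f x) < d1 \<Longrightarrow> length vs = k \<Longrightarrow>
       norm (m y vs - m (f x) vs - m' (f x) ((y - f x) # vs)) \<le> \<epsilon> * norm (y - f x) * norm_prod vs"
      using multilinear_derivD[OF m fx \<epsilon>] by blast
    obtain d2 where d2: "d2 > 0" "\<And>y. y \<in> U \<Longrightarrow> norm (y - x) < d2 \<Longrightarrow>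
       norm (f y - f x - f' x [y - x]) \<le> \<epsilon> * norm (y - x)"
      using multilinear_derivD[OF f x \<epsilon>] by (metis (no_types) list.simps(8) list.size(3) mult.right_neutral prod_list.Nil)
    \<comment> \<open>\<open>d1 / (L + 1)\<close> forces \<open>f y\<close> into the \<open>d1\<close>-ball around \<open>f x\<close>.\<close>
    define \<delta> where "\<delta> = Min {d, d1 / (L + 1), d2}"
    have \<delta>: "\<delta> > 0" using d d1 d2 L by (simp add: \<delta>_def)
    have "norm (m (f y) vs - m (f x) vs - plug [] [0] [1..<Suc k] (\<lambda>x. m' (f x)) f' x ((y - x) # vs))
      \<le> (L + C) * \<epsilon> * norm (y - x) * norm_prod vs"
      if y: "y \<in> U" "norm (y - x) < \<delta>" and len: "length vs = k" for y vs
    proof -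
      let ?h = "norm (y - x)"
      have h: "?h < d" "?h < d1 / (L + 1)" "?h < d2" using y(2) by (auto simp: \<delta>_def)
      have lip: "norm (f y - f x) \<le> L * ?h" using L(2) y h by blast
      also have "\<dots> \<le> (L + 1) * ?h" by (intro mult_right_mono) auto
      also have "\<dots> < d1" using h(2) L(1) by (simp add: pos_less_divide_eq mult.commute)
      finally have n: "norm (f y - f x) < d1" .
      have tl: "pick [1..<Suc k] ((y - x) # vs) = vs"
        using map_nth[of vs] pick_Suc[of "[0..<k]" "y - x" vs] len
        by (simp add: map_Suc_upt pick_def del: upt_Suc)
      have lin: "linear (\<lambda>v. m' (f x) (v # vs))"
        by (rule bounded_multilinear_linear_hd[OF bm'[OF fx] len])
      have eq: "m (f y) vs - m (f x) vs - plug [] [0] [1..<Suc k] (\<lambda>x. m' (f x)) f' x ((y - x) # vs)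
         = (m (f y) vs - m (f x) vs - m' (f x) ((f y - f x) # vs)) + m' (f x) ((f y - f x - f' x [y - x]) # vs)"
        using linear_diff[OF lin] tl by (simp add: plug_def del: upt_Suc)
      have "norm (m (f y) vs - m (f x) vs - m' (f x) ((f y - f x) # vs)) \<le> \<epsilon> * norm (f y - f x) * norm_prod vs"
        by (rule d1(2)) (use y n len fU in auto)
      also have "\<dots> \<le> \<epsilon> * (L * ?h) * norm_prod vs"
        using \<epsilon> lip by (intro mult_left_mono mult_right_mono) auto
      finally have 1: "norm (m (f y) vs - m (f x) vs - m' (f x) ((f y - f x) # vs)) \<le> L * \<epsilon> * ?h * norm_prod vs"
        by (simp add: algebra_simps)
      have "norm (m' (f x) ((f y - f x - f' x [y - x]) # vs)) \<le> C * (norm (f y - f x - f' x [y - x]) * norm_prod vs)"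
        using C(2)[of "(f y - f x - f' x [y - x]) # vs"] len by simp
      also have "\<dots> \<le> C * ((\<epsilon> * ?h) * norm_prod vs)"
        using d2(2)[OF y(1) h(3)] C(1) by (intro mult_left_mono mult_right_mono) auto
      finally have 2: "norm (m' (f x) ((f y - f x - f' x [y - x]) # vs)) \<le> C * \<epsilon> * ?h * norm_prod vs"
        by (simp add: algebra_simps)
      show ?thesis
        unfolding eq distrib_right by (intro order_trans[OF norm_triangle_ineq] add_mono 1 2)
    qed
    then show "\<exists>\<delta>>0. \<forall>y\<in>U. norm (y - x) < \<delta> \<longrightarrow> (\<forall>vs. length vs = k \<longrightarrow>
      norm (m (f y) vs - m (f x) vs - plug [] [0] [1..<Suc k] (\<lambda>x. m' (f x)) f' x ((y - x) # vs))
      \<le> (L + C) * \<epsilon> * norm (y - x) * norm_prod vs)"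
      using \<delta> by blast
  qed
qed

text \<open>
  The derivative of a composition is a substitution into a composition, and the derivative of a
  substitution is a sum of two substitutions. The class generated by these operations is therefore
  closed under differentiation, which replaces the explicit formula for the higher
  derivatives of a composition.
\<close>
inductive smooth_expression ::
    "'p::real_normed_vector set \<Rightarrow> 'p set \<Rightarrow> ('p \<Rightarrow> 'p) \<Rightarrow> nat \<Rightarrow>
     ('p \<Rightarrow> 'p list \<Rightarrow> 'c::real_normed_vector) \<Rightarrow> bool"
  for U V f where
  base: "msmooth U k G \<Longrightarrow> smooth_expression U V f k G"
| comp: "msmooth V k G \<Longrightarrow> smooth_expression U V f k (\<lambda>x. G (f x))"
| add: "smooth_expression U V f k G \<Longrightarrow> smooth_expression U V f k H \<Longrightarrow>
    smooth_expression U V f k (\<lambda>x vs. G x vs + H x vs)"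
| plug: "smooth_expression U V f (length K + 1 + length J) m \<Longrightarrow> msmooth U (length I) a \<Longrightarrow>
    mset (K @ I @ J) = mset [0..<k] \<Longrightarrow> smooth_expression U V f k (plug K I J m a)"

lemma msmooth_bounded_multilinear: "msmooth U k G \<Longrightarrow> x \<in> U \<Longrightarrow> bounded_multilinear k (G x)"
  by (meson msmooth.cases)

lemma msmooth_deriv:
  assumes "msmooth U k G"
  obtains G' where "multilinear_deriv U k G G'" "msmooth U (Suc k) G'"
  using assms by (meson msmooth.cases)

text \<open>
  Closure under differentiation. Boundedness of the derivative is part of the induction because
  the product rule for \<open>plug\<close> needs it for the derivative of \<open>m\<close>.
\<close>
lemma smooth_expression_deriv:
  assumes "smooth_expression U V f k G" and f: "msmooth U 0 (\<lambda>x vs. f x)" and fU: "f ` U \<subseteq> V"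
  shows "(\<forall>x\<in>U. bounded_multilinear k (G x)) \<and>
    (\<exists>G'. multilinear_deriv U k G G' \<and> smooth_expression U V f (Suc k) G' \<and>
      (\<forall>x\<in>U. bounded_multilinear (Suc k) (G' x)))"
  using assms(1)
proof induction
  case (base k G)
  then show ?case by (meson msmooth_bounded_multilinear msmooth_deriv smooth_expression.base)
next
  case (comp k G)
  obtain G' where G': "multilinear_deriv V k G G'" "msmooth V (Suc k) G'"
    using msmooth_deriv[OF comp] by blast
  obtain f' where f': "multilinear_deriv U 0 (\<lambda>x vs. f x) f'" "msmooth U 1 f'"
    using msmooth_deriv[OF f] by auto
  have perm: "mset ([] @ [0] @ [1..<Suc k]) = mset [0..<Suc k]"
    by (simp add: upt_conv_Cons del: upt_Suc)
  have e: "smooth_expression U V f (Suc k) (plug [] [0] [1..<Suc k] (\<lambda>x. G' (f x)) f')"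
    using smooth_expression.comp[OF G'(2), of U f] f'(2)
    by (intro smooth_expression.plug[OF _ _ perm]) (simp_all del: upt_Suc)
  have "multilinear_deriv U k (\<lambda>x. G (f x)) (plug [] [0] [1..<Suc k] (\<lambda>x. G' (f x)) f')"
    by (rule multilinear_deriv_compose[OF G'(1) f'(1) fU])
       (use msmooth_bounded_multilinear G'(2) f'(2) in blast)+
  moreover have "bounded_multilinear (Suc k) (plug [] [0] [1..<Suc k] (\<lambda>x. G' (f x)) f' x)" if "x \<in> U" for x
    using that fU msmooth_bounded_multilinear[OF G'(2), of "f x"]
      msmooth_bounded_multilinear[OF f'(2) that]
    by (intro bounded_multilinear_plug[OF _ _ perm]) (auto simp del: upt_Suc)
  moreover have "\<forall>x\<in>U. bounded_multilinear k (G (f x))"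
    using msmooth_bounded_multilinear[OF comp] fU by blast
  ultimately show ?case using e by blast
next
  case (add k G H)
  then obtain G' H' where "multilinear_deriv U k G G'" "smooth_expression U V f (Suc k) G'"
      "\<forall>x\<in>U. bounded_multilinear (Suc k) (G' x)"
      "multilinear_deriv U k H H'" "smooth_expression U V f (Suc k) H'"
      "\<forall>x\<in>U. bounded_multilinear (Suc k) (H' x)" by blast
  then have "multilinear_deriv U k (\<lambda>x vs. G x vs + H x vs) (\<lambda>x vs. G' x vs + H' x vs)"
    and "smooth_expression U V f (Suc k) (\<lambda>x vs. G' x vs + H' x vs)"
    and "\<forall>x\<in>U. bounded_multilinear (Suc k) (\<lambda>vs. G' x vs + H' x vs)"
    by (auto intro: multilinear_deriv_add smooth_expression.add bounded_multilinear_add)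
  moreover have "\<forall>x\<in>U. bounded_multilinear k (\<lambda>vs. G x vs + H x vs)"
    using add.IH by (auto intro: bounded_multilinear_add)
  ultimately show ?case by blast
next
  case (plug K J m I a k)
  then obtain m' where m': "multilinear_deriv U (length K + 1 + length J) m m'"
      "smooth_expression U V f (Suc (length K + 1 + length J)) m'"
      "\<forall>x\<in>U. bounded_multilinear (Suc (length K + 1 + length J)) (m' x)" by blast
  obtain a' where a': "multilinear_deriv U (length I) a a'" "msmooth U (Suc (length I)) a'"
    using msmooth_deriv[OF plug.hyps(2)] by blast
  have up: "[0..<Suc k] = 0 # map Suc [0..<k]" by (simp add: map_Suc_upt upt_conv_Cons del: upt_Suc)
  have ms: "image_mset Suc (mset K) + (image_mset Suc (mset I) + image_mset Suc (mset J)) = image_mset Suc (mset [0..<k])"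
    using arg_cong[OF plug.hyps(3), of "image_mset Suc"] by simp
  have perm1: "mset ((0 # map Suc K) @ map Suc I @ map Suc J) = mset [0..<Suc k]"
    unfolding up using ms by simp
  have perm2: "mset (map Suc K @ (0 # map Suc I) @ map Suc J) = mset [0..<Suc k]"
    unfolding up using ms by simp
  let ?D1 = "plug (0 # map Suc K) (map Suc I) (map Suc J) m' a"
  let ?D2 = "plug (map Suc K) (0 # map Suc I) (map Suc J) m a'"
  have ba: "bounded_multilinear (length I) (a x)" if "x \<in> U" for x
    by (rule msmooth_bounded_multilinear[OF plug.hyps(2) that])
  have ba': "bounded_multilinear (Suc (length I)) (a' x)" if "x \<in> U" for x
    by (rule msmooth_bounded_multilinear[OF a'(2) that])
  have bm: "bounded_multilinear (length K + 1 + length J) (m x)" if "x \<in> U" for x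
    using plug.IH that by blast
  have "multilinear_deriv U k (plug K I J m a) (\<lambda>x vs. ?D1 x vs + ?D2 x vs)"
    by (rule multilinear_deriv_plug[OF m'(1) a'(1) bm _ ba ba' plug.hyps(3)]) (use m' in auto)
  moreover have "smooth_expression U V f (Suc k) (\<lambda>x vs. ?D1 x vs + ?D2 x vs)"
    by (intro smooth_expression.add smooth_expression.plug perm1 perm2)
       (use m' a' plug.hyps in auto)
  moreover have "bounded_multilinear (Suc k) (\<lambda>vs. ?D1 x vs + ?D2 x vs)" if x: "x \<in> U" for x
    by (intro bounded_multilinear_add bounded_multilinear_plug perm1 perm2)
       (use m' ba[OF x] ba'[OF x] bm[OF x] x in auto)
  moreover have "bounded_multilinear k (plug K I J m a x)" if "x \<in> U" for x
    by (rule bounded_multilinear_plug[OF bm ba plug.hyps(3)]) fact+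
  ultimately show ?case by blast
qed

lemma smooth_expression_msmooth:
  assumes "smooth_expression U V f k G" and f: "msmooth U 0 (\<lambda>x vs. f x)" and fU: "f ` U \<subseteq> V"
  shows "msmooth U k G"
  using assms(1)
proof (coinduction arbitrary: k G)
  case msmooth
  show ?case using smooth_expression_deriv[OF msmooth f fU] by auto
qed

lemma msmooth_add:
  assumes "msmooth U k G" "msmooth U k H"
  shows "msmooth U k (\<lambda>x vs. G x vs + H x vs)"
  using assms
proof (coinduction arbitrary: k G H)
  case msmooth
  obtain G' H' where "multilinear_deriv U k G G'" "msmooth U (Suc k) G'"
     "multilinear_deriv U k H H'" "msmooth U (Suc k) H'"
    using msmooth msmooth_deriv by metis
  then have "multilinear_deriv U k (\<lambda>x vs. G x vs + H x vs) (\<lambda>x vs. G' x vs + H' x vs)"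
    and "\<exists>A B. (\<lambda>x vs. G' x vs + H' x vs) = (\<lambda>x vs. A x vs + B x vs) \<and> msmooth U (Suc k) A \<and> msmooth U (Suc k) B"
    by (blast intro: multilinear_deriv_add)+
  moreover have "\<forall>x\<in>U. bounded_multilinear k (\<lambda>vs. G x vs + H x vs)"
    using msmooth by (auto intro: bounded_multilinear_add msmooth_bounded_multilinear)
  ultimately show ?case by blast
qed

section \<open>Smooth maps\<close>

lemma msmooth_subset:
  assumes "msmooth U k G" "V \<subseteq> U"
  shows "msmooth V k G"
  using assms(1)
proof (coinduction arbitrary: k G)
  case msmooth
  obtain G' where G': "multilinear_deriv U k G G'" "msmooth U (Suc k) G'"
    using msmooth_deriv[OF msmooth] by blast
  have "multilinear_deriv V k G G'"
    using G'(1) \<open>V \<subseteq> U\<close> unfolding multilinear_deriv_def by (meson subsetD)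
  with G'(2) msmooth_bounded_multilinear[OF msmooth] \<open>V \<subseteq> U\<close> show ?case by blast
qed

lemma msmooth_cong:
  assumes "msmooth U k G" "\<And>x vs. x \<in> U \<Longrightarrow> length vs = k \<Longrightarrow> G x vs = H x vs"
  shows "msmooth U k H"
proof -
  obtain G' where G': "multilinear_deriv U k G G'" "msmooth U (Suc k) G'"
    using msmooth_deriv[OF assms(1)] by blast
  have "multilinear_deriv U k H G'"
    using G'(1) assms(2) unfolding multilinear_deriv_def by simp
  moreover have "bounded_multilinear k (H x)" if "x \<in> U" for x
    using msmooth_bounded_multilinear[OF assms(1) that] assms(2)[OF that]
    unfolding bounded_multilinear_def by simp
  ultimately show ?thesis using G'(2) by (blast intro: msmoothI)
qed

lemma msmooth_compose_linear:
  assumes "msmooth U k G" and T: "bounded_linear T"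
  shows "msmooth U k (\<lambda>x vs. T (G x vs))"
  using assms(1)
proof (coinduction arbitrary: k G)
  case msmooth
  interpret T: bounded_linear T by (rule T)
  obtain G' where G': "multilinear_deriv U k G G'" "msmooth U (Suc k) G'"
    using msmooth_deriv[OF msmooth] by blast
  obtain K where K: "K > 0" "\<And>x. norm (T x) \<le> norm x * K" using T.pos_bounded by blast
  have "multilinear_deriv U k (\<lambda>x vs. T (G x vs)) (\<lambda>x vs. T (G' x vs))"
  proof (rule multilinear_derivI, rule exI[of _ K], intro allI impI)
    fix x and \<epsilon> :: real assume x: "x \<in> U" and \<epsilon>: "\<epsilon> > 0"
    obtain d where d: "d > 0" "\<And>y vs. y \<in> U \<Longrightarrow> norm (y - x) < d \<Longrightarrow> length vs = k \<Longrightarrow>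
       norm (G y vs - G x vs - G' x ((y - x) # vs)) \<le> \<epsilon> * norm (y - x) * norm_prod vs"
      using multilinear_derivD[OF G'(1) x \<epsilon>] by blast
    have "norm (T (G y vs) - T (G x vs) - T (G' x ((y - x) # vs))) \<le> K * \<epsilon> * norm (y - x) * norm_prod vs"
      if "y \<in> U" "norm (y - x) < d" "length vs = k" for y vs
    proof -
      have "norm (T (G y vs) - T (G x vs) - T (G' x ((y - x) # vs))) \<le>
          norm (G y vs - G x vs - G' x ((y - x) # vs)) * K"
        using K(2)[of "G y vs - G x vs - G' x ((y - x) # vs)"] by (simp only: T.diff)
      also have "\<dots> \<le> (\<epsilon> * norm (y - x) * norm_prod vs) * K"
        using d(2)[OF that] K(1) by (intro mult_right_mono) auto
      finally show ?thesis by (simp only: mult_ac)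
    qed
    then show "\<exists>\<delta>>0. \<forall>y\<in>U. norm (y - x) < \<delta> \<longrightarrow> (\<forall>vs. length vs = k \<longrightarrow>
        norm (T (G y vs) - T (G x vs) - T (G' x ((y - x) # vs))) \<le> K * \<epsilon> * norm (y - x) * norm_prod vs)"
      using d(1) by blast
  qed
  moreover have "bounded_multilinear k (\<lambda>vs. T (G x vs))" if x: "x \<in> U" for x
  proof -
    have bm: "bounded_multilinear k (G x)" by (rule msmooth_bounded_multilinear[OF msmooth x])
    obtain C where C: "C \<ge> 0" "\<And>vs. length vs = k \<Longrightarrow> norm (G x vs) \<le> C * norm_prod vs"
      using bounded_multilinear_bound[OF bm] by blast
    have "norm (T (G x vs)) \<le> (K * C) * norm_prod vs" if "length vs = k" for vs
      using order_trans[OF K(2)[of "G x vs"] mult_right_mono[OF C(2)[OF that], of K]] K(1)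
      by (simp add: mult_ac)
    moreover have "linear (\<lambda>v. T (G x (us @ v # ws)))" if "length us + length ws + 1 = k" for us ws
      using linear_compose[OF bounded_multilinear_linear[OF bm that] T.linear] by (simp add: o_def)
    ultimately show ?thesis unfolding bounded_multilinear_def by blast
  qed
  ultimately show ?case using G'(2) by blast
qed

lemma norm_prod_map_nonneg [simp]: "0 \<le> prod_list (map (norm \<circ> L) vs)"
  using norm_prod_nonneg[of "map L vs"] by simp

lemma norm_prod_map_linear_le:
  assumes "\<And>x. norm (L x) \<le> norm x * K" "K \<ge> 0"
  shows "norm_prod (map L vs) \<le> K ^ length vs * norm_prod vs"
proof (induction vs)
  case (Cons v vs)
  have "norm_prod (map L (v # vs)) \<le> (norm v * K) * (K ^ length vs * norm_prod vs)"
    using assms Cons by (auto intro!: mult_mono)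
  then show ?case by (simp add: algebra_simps)
qed simp

text \<open>
  Directions are transported by \<open>L\<close> as well, so this changes the space of directions; it is the
  bridge between expressions over a product space and maps on its factors.
\<close>
lemma msmooth_linear_compose:
  assumes "msmooth U k G" and L: "bounded_linear L"
  shows "msmooth (L -` U) k (\<lambda>x vs. G (L x) (map L vs))"
  using assms(1)
proof (coinduction arbitrary: k G)
  case msmooth
  interpret L: bounded_linear L by (rule L)
  obtain G' where G': "multilinear_deriv U k G G'" "msmooth U (Suc k) G'"
    using msmooth_deriv[OF msmooth] by blast
  obtain K where K: "K > 0" "\<And>x. norm (L x) \<le> norm x * K" using L.pos_bounded by blast
  note P = norm_prod_map_linear_le[of L, OF K(2) less_imp_le[OF K(1)]]
  have "multilinear_deriv (L -` U) k (\<lambda>x vs. G (L x) (map L vs)) (\<lambda>x vs. G' (L x) (map L vs))"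
  proof (rule multilinear_derivI, rule exI[of _ "K * K ^ k"], intro allI impI)
    fix x and \<epsilon> :: real assume x: "x \<in> L -` U" and \<epsilon>: "\<epsilon> > 0"
    then have Lx: "L x \<in> U" by simp
    obtain d where d: "d > 0" "\<And>y vs. y \<in> U \<Longrightarrow> norm (y - L x) < d \<Longrightarrow> length vs = k \<Longrightarrow>
       norm (G y vs - G (L x) vs - G' (L x) ((y - L x) # vs)) \<le> \<epsilon> * norm (y - L x) * norm_prod vs"
      using multilinear_derivD[OF G'(1) Lx \<epsilon>] by blast
    have "norm (G (L y) (map L vs) - G (L x) (map L vs) - G' (L x) (map L ((y - x) # vs)))
        \<le> K * K ^ k * \<epsilon> * norm (y - x) * norm_prod vs"
      if y: "y \<in> L -` U" "norm (y - x) < d / K" and len: "length vs = k" for y vs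
    proof -
      have "norm (L y - L x) \<le> norm (y - x) * K" using K(2)[of "y - x"] by (simp add: L.diff)
      moreover have "\<dots> < d" using y(2) K(1) by (simp add: pos_less_divide_eq)
      ultimately have n: "norm (L y - L x) \<le> norm (y - x) * K" "norm (L y - L x) < d" by auto
      have "norm (G (L y) (map L vs) - G (L x) (map L vs) - G' (L x) (map L ((y - x) # vs)))
        \<le> \<epsilon> * norm (L y - L x) * norm_prod (map L vs)"
        using d(2)[of "L y" "map L vs"] y n len by (simp add: L.diff)
      also have "\<dots> \<le> \<epsilon> * (norm (y - x) * K) * (K ^ k * norm_prod vs)"
        using P[of vs] n \<epsilon> K len by (intro mult_mono) auto
      finally show ?thesis by (simp add: algebra_simps)
    qed
    then show "\<exists>\<delta>>0. \<forall>y\<in>L -` U. norm (y - x) < \<delta> \<longrightarrow> (\<forall>vs. length vs = k \<longrightarrow>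
        norm (G (L y) (map L vs) - G (L x) (map L vs) - G' (L x) (map L ((y - x) # vs)))
        \<le> K * K ^ k * \<epsilon> * norm (y - x) * norm_prod vs)"
      using d(1) K(1) by (intro exI[of _ "d / K"]) auto
  qed
  moreover have "bounded_multilinear k (\<lambda>vs. G (L x) (map L vs))" if x: "x \<in> L -` U" for x
  proof -
    have bm: "bounded_multilinear k (G (L x))" using msmooth_bounded_multilinear[OF msmooth] x by simp
    obtain C where C: "C \<ge> 0" "\<And>vs. length vs = k \<Longrightarrow> norm (G (L x) vs) \<le> C * norm_prod vs"
      using bounded_multilinear_bound[OF bm] by blast
    have "norm (G (L x) (map L vs)) \<le> (C * K ^ k) * norm_prod vs" if "length vs = k" for vs
    proof -
      have "norm (G (L x) (map L vs)) \<le> C * norm_prod (map L vs)" using C(2)[of "map L vs"] that by simp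
      also have "\<dots> \<le> C * (K ^ k * norm_prod vs)" using P[of vs] C(1) that by (intro mult_left_mono) auto
      finally show ?thesis by simp
    qed
    moreover have "linear (\<lambda>v. G (L x) (map L (us @ v # ws)))" if "length us + length ws + 1 = k" for us ws
      using linear_compose[OF L.linear bounded_multilinear_linear[OF bm, of "map L us" "map L ws"]] that
      by (simp add: o_def)
    ultimately show ?thesis unfolding bounded_multilinear_def by blast
  qed
  ultimately show ?case using G'(2) by blast
qed

lemma smooth_on_open: "smooth_on U f \<Longrightarrow> open U"
  by (simp add: smooth_on_def)

lemma smooth_on_subset: "smooth_on U f \<Longrightarrow> open V \<Longrightarrow> V \<subseteq> U \<Longrightarrow> smooth_on V f"
  unfolding smooth_on_iff_msmooth using msmooth_subset by blast

lemma smooth_on_cong: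
  "smooth_on U f \<Longrightarrow> (\<And>x. x \<in> U \<Longrightarrow> f x = g x) \<Longrightarrow> smooth_on U g"
  unfolding smooth_on_iff_msmooth by (auto elim!: msmooth_cong)

lemma smooth_on_bounded_linear:
  assumes f: "bounded_linear f" and U: "open U"
  shows "smooth_on U f"
proof -
  interpret f: bounded_linear f by (rule f)
  obtain K where K: "\<And>x. norm (f x) \<le> norm x * K" using f.bounded by blast
  define D where "D k x vs = (if k = 0 then f x else if k = 1 then f (hd vs) else 0)" for k :: nat and x vs
  have "bounded_multilinear k (D k x)" for k x
  proof -
    consider "k = 0" | "k = 1" | "k \<ge> 2" by linarith
    then show ?thesis
    proof cases
      case 1 then show ?thesis by (auto simp: bounded_multilinear_def D_def)
    next
      case 2
      have "norm (f (hd vs)) \<le> K * norm_prod vs" if "length vs = 1" for vs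
        using that K by (cases vs) (auto simp: mult.commute)
      with 2 show ?thesis by (auto simp: bounded_multilinear_def D_def f.linear)
    next
      case 3 then show ?thesis by (auto simp: bounded_multilinear_def D_def linear_zero intro!: exI[of _ 0])
    qed
  qed
  moreover have "norm (D k y vs - D k x vs - D (Suc k) x ((y - x) # vs)) = 0" if "length vs = k" for k x y vs
    by (simp add: D_def f.diff)
  ultimately show ?thesis
    unfolding smooth_on_def using U by (intro conjI exI[of _ D]) (auto simp: D_def intro!: exI[of _ "1::real"])
qed

lemma smooth_on_const: "open U \<Longrightarrow> smooth_on U (\<lambda>x. c)"
  unfolding smooth_on_def
  by (intro conjI exI[of _ "\<lambda>k x vs. if k = 0 then c else 0"])
     (auto simp: bounded_multilinear_def linear_zero intro!: exI[of _ "1::real"] exI[of _ "norm c"])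

lemma smooth_on_linear_compose:
  "smooth_on U f \<Longrightarrow> bounded_linear T \<Longrightarrow> smooth_on U (\<lambda>x. T (f x))"
  unfolding smooth_on_iff_msmooth using msmooth_compose_linear by blast

lemma smooth_on_add:
  "smooth_on U f \<Longrightarrow> smooth_on U g \<Longrightarrow> smooth_on U (\<lambda>x. f x + g x)"
  unfolding smooth_on_iff_msmooth using msmooth_add by blast

lemma bounded_linear_inl: "bounded_linear (\<lambda>x. (x, 0))"
  and bounded_linear_inr: "bounded_linear (\<lambda>x. (0, x))"
  by (intro bounded_linear_Pair bounded_linear_ident bounded_linear_zero)+

lemma smooth_on_Pair:
  assumes "smooth_on U f" "smooth_on U g"
  shows "smooth_on U (\<lambda>x. (f x, g x))"
  using smooth_on_add[OF smooth_on_linear_compose[OF assms(1) bounded_linear_inl]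
      smooth_on_linear_compose[OF assms(2) bounded_linear_inr]] by simp

text \<open>
  The class \<open>smooth_expression\<close> lives on a single space. Both maps are therefore moved to the product
  of their domains, \<open>f\<close> as \<open>(x, y) \<mapsto> (0, f x)\<close> and \<open>g\<close> as \<open>(x, y) \<mapsto> g y\<close>, and the
  composition is restricted to \<open>x \<mapsto> (x, 0)\<close>.
\<close>
lemma smooth_on_compose:
  fixes f :: "'a::real_normed_vector \<Rightarrow> 'b::real_normed_vector" and g :: "'b \<Rightarrow> 'c::real_normed_vector"
  assumes g: "smooth_on V g" and f: "smooth_on U f" and fU: "f ` U \<subseteq> V"
  shows "smooth_on U (\<lambda>x. g (f x))"
proof -
  let ?f = "\<lambda>p :: 'a \<times> 'b. (0 :: 'a, f (fst p))" and ?g = "\<lambda>p :: 'a \<times> 'b. g (snd p)"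
  let ?U = "fst -` U :: ('a \<times> 'b) set" and ?V = "snd -` V :: ('a \<times> 'b) set"
  have g': "msmooth ?V 0 (\<lambda>p vs. ?g p)"
    using g msmooth_linear_compose[OF _ bounded_linear_snd, of V 0 "\<lambda>x vs. g x"]
    by (simp add: smooth_on_iff_msmooth)
  have f': "msmooth ?U 0 (\<lambda>p vs. ?f p)"
    using f msmooth_linear_compose[OF msmooth_compose_linear[OF _ bounded_linear_inr] bounded_linear_fst,
        of U 0 "\<lambda>x vs. f x"]
    by (simp add: smooth_on_iff_msmooth)
  have "msmooth ?U 0 (\<lambda>p vs. ?g (?f p))"
    by (rule smooth_expression_msmooth[OF smooth_expression.comp[OF g'] f']) (use fU in auto)
  from msmooth_linear_compose[OF this bounded_linear_inl]
  have "msmooth U 0 (\<lambda>x vs. g (f x))" by (simp add: vimage_def)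
  then show ?thesis using f by (simp add: smooth_on_iff_msmooth)
qed

section \<open>First and second derivatives\<close>

abbreviation deriv_at :: "('a::real_normed_vector \<Rightarrow> 'b::real_normed_vector) \<Rightarrow> 'a \<Rightarrow> 'a \<Rightarrow> 'b" where
  "deriv_at f x \<equiv> frechet_derivative f (at x)"

text \<open>
  The first argument \<open>h\<close> is the direction of the second differentiation, as the head of the list is in
  \<open>smooth_on\<close>.
\<close>
definition second_deriv ::
    "('a::real_normed_vector \<Rightarrow> 'b::real_normed_vector) \<Rightarrow> 'a \<Rightarrow> 'a \<Rightarrow> 'a \<Rightarrow> 'b" where
  "second_deriv f x h v = deriv_at (\<lambda>y. deriv_at f y v) x h"

lemma multilinear_deriv_has_derivative:
  assumes "multilinear_deriv U k G G'" "bounded_multilinear (Suc k) (G' x)" "open U" "x \<in> U" "length vs = k"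
  shows "((\<lambda>y. G y vs) has_derivative (\<lambda>v. G' x (v # vs))) (at x)"
  unfolding has_derivative_at_alt
proof (intro conjI allI impI)
  have lin: "linear (\<lambda>v. G' x (v # vs))" by (rule bounded_multilinear_linear_hd[OF assms(2,5)])
  obtain C where C: "\<And>vs. length vs = Suc k \<Longrightarrow> norm (G' x vs) \<le> C * norm_prod vs"
    using bounded_multilinear_bound[OF assms(2)] by blast
  have "norm (G' x (v # vs)) \<le> norm v * (C * norm_prod vs)" for v
    using C[of "v # vs"] assms(5) by (simp add: algebra_simps)
  then show "bounded_linear (\<lambda>v. G' x (v # vs))"
    using lin unfolding linear_iff by (intro bounded_linear_intro[of _ "C * norm_prod vs"]) auto
next
  fix e :: real assume e: "e > 0"
  define \<epsilon> where "\<epsilon> = e / (norm_prod vs + 1)"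
  have P: "0 < norm_prod vs + 1" using norm_prod_nonneg[of vs] by linarith
  then have \<epsilon>: "\<epsilon> > 0" and le: "\<epsilon> * norm_prod vs \<le> e"
    using e by (auto simp: \<epsilon>_def field_simps)
  obtain d where d: "d > 0" "\<And>y. y \<in> U \<Longrightarrow> norm (y - x) < d \<Longrightarrow>
       norm (G y vs - G x vs - G' x ((y - x) # vs)) \<le> \<epsilon> * norm (y - x) * norm_prod vs"
    using multilinear_derivD[OF assms(1,4) \<epsilon>] assms(5) by metis
  obtain r where r: "r > 0" "\<And>y. norm (y - x) < r \<Longrightarrow> y \<in> U"
    using assms(3,4) by (auto simp: open_dist dist_norm)
  have "norm (G y vs - G x vs - G' x ((y - x) # vs)) \<le> e * norm (y - x)" if "norm (y - x) < min d r" for y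
    using d(2)[of y] r(2)[of y] that mult_right_mono[OF le norm_ge_zero[of "y - x"]]
    by (simp add: algebra_simps)
  then show "\<exists>d>0. \<forall>y. norm (y - x) < d \<longrightarrow> norm (G y vs - G x vs - G' x ((y - x) # vs)) \<le> e * norm (y - x)"
    using d(1) r(1) by (intro exI[of _ "min d r"]) auto
qed

text \<open>
  The link between the multilinear derivatives of \<open>smooth_on\<close>, in which estimates are uniform in the
  directions, and Frechet derivatives.
\<close>
lemma smooth_on_derivs:
  assumes f: "smooth_on U f"
  obtains f' f'' where
    "msmooth U 1 f'" "\<And>x. x \<in> U \<Longrightarrow> bounded_multilinear 2 (f'' x)"
    "\<And>x. x \<in> U \<Longrightarrow> (f has_derivative (\<lambda>v. f' x [v])) (at x)"
    "\<And>x v. x \<in> U \<Longrightarrow> deriv_at f x v = f' x [v]"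
    "\<And>x v. x \<in> U \<Longrightarrow> ((\<lambda>y. f' y [v]) has_derivative (\<lambda>h. f'' x [h, v])) (at x)"
    "\<And>x h v. x \<in> U \<Longrightarrow> second_deriv f x h v = f'' x [h, v]"
    "multilinear_deriv U 1 f' f''"
proof -
  have U: "open U" and f0: "msmooth U 0 (\<lambda>x vs. f x)" using f by (auto simp: smooth_on_iff_msmooth)
  obtain f' where f': "multilinear_deriv U 0 (\<lambda>x vs. f x) f'" "msmooth U 1 f'"
    using msmooth_deriv[OF f0] by auto
  obtain f'' where f'': "multilinear_deriv U 1 f' f''" "msmooth U 2 f''"
    using msmooth_deriv[OF f'(2)] by (auto simp: numeral_2_eq_2)
  have b1: "bounded_multilinear (Suc 0) (f' x)" if "x \<in> U" for x
    using msmooth_bounded_multilinear[OF f'(2) that] by simp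
  have b2: "bounded_multilinear 2 (f'' x)" if "x \<in> U" for x
    using msmooth_bounded_multilinear[OF f''(2) that] .
  have 1: "(f has_derivative (\<lambda>v. f' x [v])) (at x)" if "x \<in> U" for x
    using multilinear_deriv_has_derivative[OF f'(1) b1[OF that] U that, of "[]"] by simp
  then have 2: "deriv_at f x v = f' x [v]" if "x \<in> U" for x v
    using frechet_derivative_at that by metis
  have 3: "((\<lambda>y. f' y [v]) has_derivative (\<lambda>h. f'' x [h, v])) (at x)" if "x \<in> U" for x v
    using multilinear_deriv_has_derivative[OF f''(1) _ U that, of "[v]"] b2[OF that]
    by (simp add: numeral_2_eq_2)
  have "((\<lambda>y. deriv_at f y v) has_derivative (\<lambda>h. f'' x [h, v])) (at x)" if "x \<in> U" for x v
    by (rule has_derivative_transform_within_open[OF 3[OF that, of v] U that]) (simp add: 2)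
  then have 4: "second_deriv f x h v = f'' x [h, v]" if "x \<in> U" for x h v
    unfolding second_deriv_def using frechet_derivative_at that by metis
  show thesis by (rule that[OF f'(2) b2 1 2 3 4 f''(1)])
qed

lemma smooth_on_has_derivative:
  assumes "smooth_on U f" "x \<in> U"
  shows "(f has_derivative deriv_at f x) (at x)"
proof -
  obtain f' where "(f has_derivative f') (at x)"
    using smooth_on_derivs[OF assms(1)] assms(2) by metis
  then show ?thesis using frechet_derivative_works differentiable_def by blast
qed

text \<open>
  Evaluation is a substitution: on the product space, \<open>Df x v\<close> arises by plugging the \<open>0\<close>-linear map
  \<open>(x, v) \<mapsto> v\<close> into the only slot of \<open>Df\<close>.
\<close>
lemma smooth_on_deriv:
  assumes "smooth_on U f"
  shows "smooth_on (U \<times> UNIV) (\<lambda>(x, v). deriv_at f x v)"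
proof -
  obtain f' f'' where f': "msmooth U 1 f'" and eq: "\<And>x v. x \<in> U \<Longrightarrow> deriv_at f x v = f' x [v]"
    using smooth_on_derivs[OF assms] by metis
  let ?W = "fst -` U :: ('a \<times> 'a) set"
  let ?m = "\<lambda>p ps. f' (fst p) (map fst ps)" and ?a = "\<lambda>p :: 'a \<times> 'a. \<lambda>ps :: ('a \<times> 'a) list. (snd p, 0 :: 'a)"
  have W: "open ?W" "?W = U \<times> UNIV"
    using smooth_on_open[OF assms] by (auto intro: open_vimage_fst)
  have m: "msmooth ?W 1 ?m" by (rule msmooth_linear_compose[OF f' bounded_linear_fst])
  have "smooth_on ?W (\<lambda>p. (snd p, 0 :: 'a))"
    by (intro smooth_on_bounded_linear bounded_linear_Pair bounded_linear_snd bounded_linear_zero W)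
  then have a: "msmooth ?W 0 ?a" by (simp add: smooth_on_iff_msmooth)
  have "smooth_on ?W (\<lambda>x. x)" by (intro smooth_on_bounded_linear bounded_linear_ident W)
  then have i: "msmooth ?W 0 (\<lambda>x vs. x)" by (simp add: smooth_on_iff_msmooth)
  have "smooth_expression ?W ?W (\<lambda>x. x) 0 (plug [] [] [] ?m ?a)"
    by (rule smooth_expression.plug) (use m a in \<open>auto intro: smooth_expression.base\<close>)
  then have "msmooth ?W 0 (plug [] [] [] ?m ?a)"
    by (rule smooth_expression_msmooth[OF _ i]) auto
  then have "msmooth ?W 0 (\<lambda>p vs. case p of (x, v) \<Rightarrow> deriv_at f x v)"
    by (rule msmooth_cong) (auto simp: plug_def eq)
  then show ?thesis using W by (simp add: smooth_on_iff_msmooth)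
qed

text \<open>
  The second difference \<open>f (x + tu + tv) - f (x + tu) - f (x + tv) + f x\<close> is symmetric in \<open>u\<close> and \<open>v\<close>.
  The mean value inequality for \<open>s \<mapsto> f (x + stu + tv) - f (x + stu)\<close> shows that it equals
  \<open>t\<^sup>2 f'' x [v, u]\<close> up to an error that is small compared with \<open>t\<^sup>2\<close>.
\<close>
lemma bilinear_symmetric_of_second_deriv:
  fixes f :: "'a::real_normed_vector \<Rightarrow> 'b::real_normed_vector"
  assumes U: "open U" "x \<in> U"
    and f: "\<And>y. y \<in> U \<Longrightarrow> (f has_derivative (\<lambda>v. f' y [v])) (at y)"
    and f': "multilinear_deriv U 1 f' f''" and bm: "bounded_multilinear 2 (f'' x)"
  shows "f'' x [u, v] = f'' x [v, u]"
proof -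
  obtain r where r: "r > 0" "\<And>y. norm (y - x) < r \<Longrightarrow> y \<in> U"
    using U by (auto simp: open_dist dist_norm)
  have lin1: "linear (\<lambda>v. f'' x [v, w])" for w
    using bounded_multilinear_linear[OF bm, of "[]" "[w]"] by simp
  have lin2: "linear (\<lambda>v. f'' x [w, v])" for w
    using bounded_multilinear_linear[OF bm, of "[w]" "[]"] by simp
  let ?S = "\<lambda>t u v. f (x + t *\<^sub>R u + t *\<^sub>R v) - f (x + t *\<^sub>R u) - f (x + t *\<^sub>R v) + f x"
  have main: "\<exists>t0>0. \<forall>t. 0 < t \<and> t < t0 \<longrightarrow>
      norm (?S t u v - t\<^sup>2 *\<^sub>R f'' x [v, u]) \<le> 2 * \<epsilon> * (norm u + norm v) * norm u * t\<^sup>2"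
    if \<epsilon>: "\<epsilon> > 0" for \<epsilon> :: real and u v
  proof -
    obtain d where d: "d > 0" "\<And>y vs. y \<in> U \<Longrightarrow> norm (y - x) < d \<Longrightarrow> length vs = 1 \<Longrightarrow>
       norm (f' y vs - f' x vs - f'' x ((y - x) # vs)) \<le> \<epsilon> * norm (y - x) * norm_prod vs"
      using multilinear_derivD[OF f' U(2) \<epsilon>] by blast
    define t0 where "t0 = min d r / (norm u + norm v + 1)"
    have pos: "norm u + norm v + 1 > 0" by (smt (verit) norm_ge_zero)
    have t0: "t0 > 0" using d(1) r(1) pos by (simp add: t0_def)
    have "norm (?S t u v - t\<^sup>2 *\<^sub>R f'' x [v, u]) \<le> 2 * \<epsilon> * (norm u + norm v) * norm u * t\<^sup>2"
      if t: "0 < t" "t < t0" for t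
    proof -
      have tt: "t * (norm u + norm v) < min d r"
      proof -
        have "t * (norm u + norm v) \<le> t * (norm u + norm v + 1)" using t by simp
        also have "\<dots> < min d r" using t pos by (simp add: t0_def pos_less_divide_eq)
        finally show ?thesis .
      qed
      have in1: "norm ((s * t) *\<^sub>R u + t *\<^sub>R v) \<le> t * (norm u + norm v)"
        and in2: "norm ((s * t) *\<^sub>R u) \<le> t * (norm u + norm v)" if "s \<in> {0..1}" for s
      proof -
        have "norm ((s * t) *\<^sub>R u) \<le> t * norm u"
          using that t by (simp add: abs_mult mult_right_mono mult_left_le_one_le)
        moreover have "norm (t *\<^sub>R v) = t * norm v" using t by simp
        ultimately show "norm ((s * t) *\<^sub>R u + t *\<^sub>R v) \<le> t * (norm u + norm v)"
          using norm_triangle_ineq[of "(s * t) *\<^sub>R u" "t *\<^sub>R v"] unfolding distrib_left by linarith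
        show "norm ((s * t) *\<^sub>R u) \<le> t * (norm u + norm v)"
          using \<open>norm ((s * t) *\<^sub>R u) \<le> t * norm u\<close> t
          by (smt (verit) distrib_left mult_nonneg_nonneg norm_ge_zero)
      qed
      \<comment> \<open>Subtracting \<open>s t\<^sup>2 f'' x [v, u]\<close> makes \<open>\<phi> 1 - \<phi> 0\<close> the quantity to be estimated and
          leaves a derivative of size \<open>\<epsilon> t\<^sup>2\<close>.\<close>
      define \<phi> where "\<phi> s = f (x + ((s * t) *\<^sub>R u + t *\<^sub>R v)) - f (x + (s * t) *\<^sub>R u) - (s * t\<^sup>2) *\<^sub>R f'' x [v, u]" for s
      define \<phi>' where "\<phi>' s c = c *\<^sub>R (f' (x + ((s * t) *\<^sub>R u + t *\<^sub>R v)) [t *\<^sub>R u] - f' (x + (s * t) *\<^sub>R u) [t *\<^sub>R u]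
            - t\<^sup>2 *\<^sub>R f'' x [v, u])" for s c
      have inU: "x + ((s * t) *\<^sub>R u + t *\<^sub>R v) \<in> U" "x + (s * t) *\<^sub>R u \<in> U"
        "norm ((s * t) *\<^sub>R u + t *\<^sub>R v) < d" "norm ((s * t) *\<^sub>R u) < d" if "s \<in> {0..1}" for s
        using r(2)[of "x + ((s * t) *\<^sub>R u + t *\<^sub>R v)"] r(2)[of "x + (s * t) *\<^sub>R u"] in1[OF that] in2[OF that] tt by auto
      have der: "(\<phi> has_derivative \<phi>' s) (at s within {0..1})" if s: "s \<in> {0..1}" for s
      proof -
        have l1: "f' y [c *\<^sub>R w] = c *\<^sub>R f' y [w]" if "y \<in> U" for y c w
          using has_derivative_linear[OF f[OF that]] unfolding linear_iff by blast
        have a: "((\<lambda>s. f (x + ((s * t) *\<^sub>R u + t *\<^sub>R v))) has_derivative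
            (\<lambda>c. f' (x + ((s * t) *\<^sub>R u + t *\<^sub>R v)) [(c * t) *\<^sub>R u])) (at s within {0..1})"
          by (rule has_derivative_compose[where f = "\<lambda>s. x + ((s * t) *\<^sub>R u + t *\<^sub>R v)", OF _ f[OF inU(1)[OF s]]]) (auto intro!: derivative_eq_intros)
        have b: "((\<lambda>s. f (x + (s * t) *\<^sub>R u)) has_derivative
            (\<lambda>c. f' (x + (s * t) *\<^sub>R u) [(c * t) *\<^sub>R u])) (at s within {0..1})"
          by (rule has_derivative_compose[where f = "\<lambda>s. x + (s * t) *\<^sub>R u", OF _ f[OF inU(2)[OF s]]]) (auto intro!: derivative_eq_intros)
        have c: "((\<lambda>s. (s * t\<^sup>2) *\<^sub>R f'' x [v, u]) has_derivative (\<lambda>c. (c * t\<^sup>2) *\<^sub>R f'' x [v, u])) (at s within {0..1})"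
          by (auto intro!: derivative_eq_intros)
        have "(\<phi> has_derivative (\<lambda>c. f' (x + ((s * t) *\<^sub>R u + t *\<^sub>R v)) [(c * t) *\<^sub>R u] -
            f' (x + (s * t) *\<^sub>R u) [(c * t) *\<^sub>R u] - (c * t\<^sup>2) *\<^sub>R f'' x [v, u])) (at s within {0..1})"
          unfolding \<phi>_def by (intro has_derivative_diff a b c)
        also have "(\<lambda>c. f' (x + ((s * t) *\<^sub>R u + t *\<^sub>R v)) [(c * t) *\<^sub>R u] -
            f' (x + (s * t) *\<^sub>R u) [(c * t) *\<^sub>R u] - (c * t\<^sup>2) *\<^sub>R f'' x [v, u]) = \<phi>' s"
          using l1[OF inU(1)[OF s]] l1[OF inU(2)[OF s]]
          by (simp add: \<phi>'_def fun_eq_iff scaleR_diff_right)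
        finally show ?thesis .
      qed
      have bd: "onorm (\<phi>' s) \<le> 2 * \<epsilon> * (norm u + norm v) * norm u * t\<^sup>2" if s: "s \<in> {0..1}" for s
      proof -
        let ?a = "(s * t) *\<^sub>R u + t *\<^sub>R v" and ?b = "(s * t) *\<^sub>R u"
        have 1: "norm (f' (x + ?a) [t *\<^sub>R u] - f' x [t *\<^sub>R u] - f'' x [?a, t *\<^sub>R u]) \<le> \<epsilon> * norm ?a * (t * norm u)"
          using d(2)[of "x + ?a" "[t *\<^sub>R u]"] inU[OF s] t by simp
        have 2: "norm (f' (x + ?b) [t *\<^sub>R u] - f' x [t *\<^sub>R u] - f'' x [?b, t *\<^sub>R u]) \<le> \<epsilon> * norm ?b * (t * norm u)"
          using d(2)[of "x + ?b" "[t *\<^sub>R u]"] inU[OF s] t by simp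
        have 3: "\<epsilon> * norm ?a * (t * norm u) \<le> \<epsilon> * (t * (norm u + norm v)) * (t * norm u)"
          using in1[OF s] \<epsilon> t by (intro mult_right_mono mult_left_mono) auto
        have 4: "\<epsilon> * norm ?b * (t * norm u) \<le> \<epsilon> * (t * (norm u + norm v)) * (t * norm u)"
          using in2[OF s] \<epsilon> t by (intro mult_right_mono mult_left_mono) auto
        have "f'' x [?a, t *\<^sub>R u] - f'' x [?b, t *\<^sub>R u] = f'' x [t *\<^sub>R v, t *\<^sub>R u]"
          using linear_diff[OF lin1[of "t *\<^sub>R u"], of ?a ?b] by simp
        also have "\<dots> = t\<^sup>2 *\<^sub>R f'' x [v, u]"
          using linear_scale[OF lin1] linear_scale[OF lin2] by (simp add: power2_eq_square)
        finally have 5: "f' (x + ?a) [t *\<^sub>R u] - f' (x + ?b) [t *\<^sub>R u] - t\<^sup>2 *\<^sub>R f'' x [v, u] =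
           (f' (x + ?a) [t *\<^sub>R u] - f' x [t *\<^sub>R u] - f'' x [?a, t *\<^sub>R u]) -
           (f' (x + ?b) [t *\<^sub>R u] - f' x [t *\<^sub>R u] - f'' x [?b, t *\<^sub>R u])" by (simp add: algebra_simps)
        have "norm (f' (x + ?a) [t *\<^sub>R u] - f' (x + ?b) [t *\<^sub>R u] - t\<^sup>2 *\<^sub>R f'' x [v, u]) \<le>
            2 * (\<epsilon> * (t * (norm u + norm v)) * (t * norm u))"
          unfolding 5 using 1 2 3 4 norm_triangle_ineq4 by (smt (verit))
        also have "\<dots> = 2 * \<epsilon> * (norm u + norm v) * norm u * t\<^sup>2" by (simp add: power2_eq_square)
        finally have "norm (f' (x + ?a) [t *\<^sub>R u] - f' (x + ?b) [t *\<^sub>R u] - t\<^sup>2 *\<^sub>R f'' x [v, u]) \<le> \<dots>" .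
        from mult_left_mono[OF this abs_ge_zero]
        have "norm (\<phi>' s c) \<le> (2 * \<epsilon> * (norm u + norm v) * norm u * t\<^sup>2) * norm c" for c
          unfolding \<phi>'_def norm_scaleR real_norm_def by (metis mult.commute)
        then show ?thesis by (rule onorm_le)
      qed
      have "norm (\<phi> 1 - \<phi> 0) \<le> 2 * \<epsilon> * (norm u + norm v) * norm u * t\<^sup>2 * norm (1 - 0 :: real)"
        by (rule differentiable_bound[OF _ der bd]) auto
      moreover have "\<phi> 1 - \<phi> 0 = ?S t u v - t\<^sup>2 *\<^sub>R f'' x [v, u]" by (simp add: \<phi>_def algebra_simps)
      ultimately show ?thesis by simp
    qed
    with t0 show ?thesis by blast
  qed
  define c where "c = 2 * (norm u + norm v) * (norm u + norm v)"
  have c0: "c \<ge> 0" by (simp add: c_def)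
  have small: "norm (f'' x [u, v] - f'' x [v, u]) \<le> c * \<epsilon>" if \<epsilon>: "\<epsilon> > 0" for \<epsilon>
  proof -
    obtain t1 where t1: "t1 > 0" "\<And>t. 0 < t \<Longrightarrow> t < t1 \<Longrightarrow>
      norm (?S t u v - t\<^sup>2 *\<^sub>R f'' x [v, u]) \<le> 2 * \<epsilon> * (norm u + norm v) * norm u * t\<^sup>2"
      using main[OF \<epsilon>] by blast
    obtain t2 where t2: "t2 > 0" "\<And>t. 0 < t \<Longrightarrow> t < t2 \<Longrightarrow>
      norm (?S t v u - t\<^sup>2 *\<^sub>R f'' x [u, v]) \<le> 2 * \<epsilon> * (norm v + norm u) * norm v * t\<^sup>2"
      using main[OF \<epsilon>] by blast
    define t where "t = min t1 t2 / 2"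
    have t: "0 < t" "t < t1" "t < t2" using t1 t2 by (auto simp: t_def)
    have S: "?S t v u = ?S t u v" by (simp add: algebra_simps)
    have "t\<^sup>2 *\<^sub>R (f'' x [u, v] - f'' x [v, u]) =
        (?S t u v - t\<^sup>2 *\<^sub>R f'' x [v, u]) - (?S t u v - t\<^sup>2 *\<^sub>R f'' x [u, v])" by (simp add: algebra_simps)
    then have "norm (t\<^sup>2 *\<^sub>R (f'' x [u, v] - f'' x [v, u])) \<le>
       2 * \<epsilon> * (norm u + norm v) * norm u * t\<^sup>2 + 2 * \<epsilon> * (norm v + norm u) * norm v * t\<^sup>2"
      using t1(2)[OF t(1,2)] t2(2)[OF t(1,3)] norm_triangle_ineq4 unfolding S by (smt (verit))
    also have "\<dots> = t\<^sup>2 * (c * \<epsilon>)" by (simp add: c_def algebra_simps)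
    finally have "t\<^sup>2 * norm (f'' x [u, v] - f'' x [v, u]) \<le> t\<^sup>2 * (c * \<epsilon>)" by simp
    then show ?thesis using t(1) by simp
  qed
  have "norm (f'' x [u, v] - f'' x [v, u]) \<le> 0"
  proof (rule field_le_epsilon)
    fix e :: real assume e: "e > 0"
    have "c * (e / (c + 1)) \<le> e" using e c0 by (simp add: field_simps)
    then show "norm (f'' x [u, v] - f'' x [v, u]) \<le> 0 + e"
      using small[of "e / (c + 1)"] e c0 by auto
  qed
  then show ?thesis by simp
qed

lemma second_deriv_sym:
  assumes "smooth_on U f" "x \<in> U"
  shows "second_deriv f x u v = second_deriv f x v u"
proof -
  obtain f' f'' where *: "\<And>x. x \<in> U \<Longrightarrow> bounded_multilinear 2 (f'' x)"
    "\<And>x. x \<in> U \<Longrightarrow> (f has_derivative (\<lambda>v. f' x [v])) (at x)"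
    "\<And>x h v. x \<in> U \<Longrightarrow> second_deriv f x h v = f'' x [h, v]"
    "multilinear_deriv U 1 f' f''"
    using smooth_on_derivs[OF assms(1)] by metis
  show ?thesis
    unfolding *(3)[OF assms(2)]
    by (rule bilinear_symmetric_of_second_deriv[OF smooth_on_open[OF assms(1)] assms(2) *(2) *(4) *(1)])
       (use assms(2) in auto)
qed

text \<open>
  The derivative of the total map \<open>(y, w) \<mapsto> Df y w\<close> is already known to exist, so it is determined by
  its two partial derivatives; in \<open>w\<close> the map is linear.
\<close>
lemma deriv_has_derivative:
  assumes f: "smooth_on U f" and x: "x \<in> U"
  shows "((\<lambda>(y, w). deriv_at f y w) has_derivative (\<lambda>(h, k). second_deriv f x h v + deriv_at f x k)) (at (x, v))"
proof -
  obtain f' f'' where *: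
    "\<And>x. x \<in> U \<Longrightarrow> (f has_derivative (\<lambda>v. f' x [v])) (at x)"
    "\<And>x v. x \<in> U \<Longrightarrow> deriv_at f x v = f' x [v]"
    "\<And>x v. x \<in> U \<Longrightarrow> ((\<lambda>y. f' y [v]) has_derivative (\<lambda>h. f'' x [h, v])) (at x)"
    "\<And>x h v. x \<in> U \<Longrightarrow> second_deriv f x h v = f'' x [h, v]"
    by (rule smooth_on_derivs[OF f]) (rule that)
  let ?g = "\<lambda>(y, w). deriv_at f y w"
  obtain G where G: "(?g has_derivative G) (at (x, v))"
    using smooth_on_has_derivative[OF smooth_on_deriv[OF f]] x by blast
  have "((\<lambda>y. ?g (y, v)) has_derivative (\<lambda>h. G (h, 0))) (at x)"
    by (rule has_derivative_compose[where f = "\<lambda>y. (y, v)", OF _ G]) (auto intro!: derivative_eq_intros)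
  moreover have "((\<lambda>y. ?g (y, v)) has_derivative (\<lambda>h. second_deriv f x h v)) (at x)"
    unfolding *(4)[OF x]
    by (rule has_derivative_transform_within_open[OF *(3)[OF x, of v] smooth_on_open[OF f] x]) (simp add: *)
  ultimately have 1: "(\<lambda>h. G (h, 0)) = (\<lambda>h. second_deriv f x h v)" by (rule has_derivative_unique)
  have "((\<lambda>w. ?g (x, w)) has_derivative (\<lambda>k. G (0, k))) (at v)"
    by (rule has_derivative_compose[where f = "\<lambda>w. (x, w)", OF _ G]) (auto intro!: derivative_eq_intros)
  moreover have "bounded_linear (deriv_at f x)"
    using smooth_on_has_derivative[OF f x] has_derivative_bounded_linear by blast
  then have "((\<lambda>w. ?g (x, w)) has_derivative deriv_at f x) (at v)"
    by (simp add: bounded_linear_imp_has_derivative)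
  ultimately have 2: "(\<lambda>k. G (0, k)) = deriv_at f x" by (rule has_derivative_unique)
  have "G (h, k) = second_deriv f x h v + deriv_at f x k" for h k
    using linear_add[OF has_derivative_linear[OF G], of "(h, 0)" "(0, k)"] fun_cong[OF 1, of h] fun_cong[OF 2, of k]
    by simp
  then have "G = (\<lambda>(h, k). second_deriv f x h v + deriv_at f x k)" by auto
  then show ?thesis using G by simp
qed

section \<open>Charts and transition maps\<close>

abbreviation transition_deriv ::
    "('m, 'e::banach) chart \<Rightarrow> ('m, 'e) chart \<Rightarrow> 'm \<Rightarrow> 'e \<Rightarrow> 'e" where
  "transition_deriv c d p \<equiv> deriv_at (local_rep c d id) (snd c p)"

lemma charts_atI: "c \<in> M \<Longrightarrow> p \<in> fst c \<Longrightarrow> c \<in> charts_at M p"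
  and charts_atD: "c \<in> charts_at M p \<Longrightarrow> c \<in> M" "c \<in> charts_at M p \<Longrightarrow> p \<in> fst c"
  by (auto simp: charts_at_def)

lemma in_points_iff: "p \<in> points M \<longleftrightarrow> (\<exists>c. c \<in> charts_at M p)"
  unfolding points_def charts_at_def by blast

lemma chart_inv_image:
  assumes "x \<in> snd c ` fst c"
  shows "chart_inv c x \<in> fst c" "snd c (chart_inv c x) = x"
  using assms by (auto simp: chart_inv_def inv_into_into f_inv_into_f)

lemma chart_inv_coordinate:
  assumes "banach_manifold M" "c \<in> M" "p \<in> fst c"
  shows "chart_inv c (snd c p) = p"
  using assms by (simp add: banach_manifold_def chart_inv_def)

lemma local_rep_coordinate:
  assumes "banach_manifold M" "c \<in> M" "p \<in> fst c"
  shows "local_rep c d f (snd c p) = snd d (f p)"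
  using chart_inv_coordinate[OF assms] by (simp add: local_rep_def)

lemma chart_image_Int:
  assumes "banach_manifold M" "c \<in> M" "A \<subseteq> fst c" "B \<subseteq> fst c"
  shows "snd c ` (A \<inter> B) = snd c ` A \<inter> snd c ` B"
  using assms inj_on_image_Int[of "snd c" "fst c" A B] by (auto simp: banach_manifold_def)

lemma transition_smooth:
  assumes "banach_manifold M" "c \<in> M" "d \<in> M"
  shows "smooth_on (snd c ` (fst c \<inter> fst d)) (local_rep c d id)"
  using assms by (simp add: banach_manifold_def)

lemma open_chart_image: "banach_manifold M \<Longrightarrow> c \<in> M \<Longrightarrow> open (snd c ` fst c)"
  by (simp add: banach_manifold_def)

lemma open_chart_overlap:
  "banach_manifold M \<Longrightarrow> c \<in> M \<Longrightarrow> d \<in> M \<Longrightarrow> open (snd c ` (fst c \<inter> fst d))"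
  by (rule smooth_on_open[OF transition_smooth])

lemma transition_has_derivative:
  assumes "banach_manifold M" "c \<in> charts_at M p" "d \<in> charts_at M p"
  shows "(local_rep c d id has_derivative transition_deriv c d p) (at (snd c p))"
  by (rule smooth_on_has_derivative[OF transition_smooth[OF assms(1), of c d]])
     (use assms(2,3) in \<open>auto simp: charts_at_def\<close>)

lemma smooth_map_local_rep:
  "smooth_map M Q f \<Longrightarrow> c \<in> M \<Longrightarrow> d \<in> Q \<Longrightarrow> smooth_on (snd c ` {p \<in> fst c. f p \<in> fst d}) (local_rep c d f)"
  by (simp add: smooth_map_def)

lemma smooth_map_has_derivative:
  assumes "smooth_map M Q f" "c \<in> charts_at M p" "d \<in> charts_at Q (f p)"
  shows "(local_rep c d f has_derivative deriv_at (local_rep c d f) (snd c p)) (at (snd c p))"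
proof (rule smooth_on_has_derivative)
  show "smooth_on (snd c ` {p \<in> fst c. f p \<in> fst d}) (local_rep c d f)"
    using assms by (auto simp: smooth_map_def charts_at_def)
qed (use assms in \<open>auto simp: charts_at_def\<close>)

text \<open>
  On the part of the chart overlap that \<open>f\<close> sends into both target charts, changing the chart before
  or after \<open>f\<close> gives the same map; the two sides are its derivative by the chain rule.
\<close>
lemma deriv_local_rep_change:
  assumes M: "banach_manifold M" and Q: "banach_manifold Q" and f: "smooth_map M Q f"
    and c: "c \<in> charts_at M p" "c' \<in> charts_at M p"
    and d: "d \<in> charts_at Q (f p)" "d' \<in> charts_at Q (f p)"
  shows "deriv_at (local_rep c' d' f) (snd c' p) (transition_deriv c c' p u) =
    transition_deriv d d' (f p) (deriv_at (local_rep c d f) (snd c p) u)"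
proof -
  note cM = c[THEN charts_atD(1)] c[THEN charts_atD(2)] and dQ = d[THEN charts_atD(1)] d[THEN charts_atD(2)]
  define S where "S = snd c ` ((fst c \<inter> fst c') \<inter> ({p \<in> fst c. f p \<in> fst d} \<inter> {p \<in> fst c. f p \<in> fst d'}))"
  have "S = snd c ` (fst c \<inter> fst c') \<inter> (snd c ` {p \<in> fst c. f p \<in> fst d} \<inter> snd c ` {p \<in> fst c. f p \<in> fst d'})"
    unfolding S_def using chart_image_Int[OF M cM(1)] by (metis (no_types, lifting) Int_lower1 le_infI1 mem_Collect_eq subsetI)
  moreover have "open (snd c ` (fst c \<inter> fst c'))" by (rule open_chart_overlap[OF M cM(1,2)])
  moreover have "open (snd c ` {p \<in> fst c. f p \<in> fst d})" "open (snd c ` {p \<in> fst c. f p \<in> fst d'})"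
    by (rule smooth_on_open[OF smooth_map_local_rep[OF f]]; fact)+
  ultimately have S: "open S" by auto
  have p: "snd c p \<in> S" using cM dQ by (auto simp: S_def)
  have t: "local_rep c c' id (snd c p) = snd c' p" "local_rep c d f (snd c p) = snd d (f p)"
    by (simp_all add: local_rep_coordinate[OF M cM(1,3)])
  have 1: "((\<lambda>x. local_rep c' d' f (local_rep c c' id x)) has_derivative
      (\<lambda>u. deriv_at (local_rep c' d' f) (snd c' p) (transition_deriv c c' p u))) (at (snd c p))"
    by (rule has_derivative_compose[OF transition_has_derivative[OF M c]])
       (unfold t, rule smooth_map_has_derivative[OF f c(2) d(2)])
  have 2: "((\<lambda>x. local_rep d d' id (local_rep c d f x)) has_derivative
      (\<lambda>u. transition_deriv d d' (f p) (deriv_at (local_rep c d f) (snd c p) u))) (at (snd c p))"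
    by (rule has_derivative_compose[OF smooth_map_has_derivative[OF f c(1) d(1)]])
       (unfold t, rule transition_has_derivative[OF Q d])
  have "local_rep c' d' f (local_rep c c' id x) = local_rep d d' id (local_rep c d f x)" if x: "x \<in> S" for x
  proof -
    obtain q where "x = snd c q" "q \<in> fst c" "q \<in> fst c'" "f q \<in> fst d" "f q \<in> fst d'"
      using x by (auto simp: S_def)
    then show ?thesis
      by (simp add: local_rep_coordinate[OF M cM(1)] local_rep_coordinate[OF M cM(2)]
          local_rep_coordinate[OF Q dQ(1)])
  qed
  then have "((\<lambda>x. local_rep d d' id (local_rep c d f x)) has_derivative
      (\<lambda>u. deriv_at (local_rep c' d' f) (snd c' p) (transition_deriv c c' p u))) (at (snd c p))"
    by (rule has_derivative_transform_within_open[OF 1 S p])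
  from has_derivative_unique[OF this 2] show ?thesis by (rule fun_cong)
qed

lemma smooth_map_id: "banach_manifold M \<Longrightarrow> smooth_map M M id"
  unfolding smooth_map_def using transition_smooth[of M] by (auto simp: Collect_conj_eq)

lemma transition_deriv_self:
  assumes "banach_manifold M" "c \<in> charts_at M p"
  shows "transition_deriv c c p u = u"
proof -
  note cM = charts_atD[OF assms(2)]
  have "(local_rep c c id has_derivative (\<lambda>u. u)) (at (snd c p))"
  proof (rule has_derivative_transform_within_open[OF has_derivative_ident open_chart_image[OF assms(1) cM(1)]])
    fix x assume "x \<in> snd c ` fst c"
    then show "x = local_rep c c id x" using chart_inv_image[of x c] by (simp add: local_rep_def)
  qed (use cM in auto)
  then show ?thesis using frechet_derivative_at by metis
qed

lemma transition_deriv_compose: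
  assumes "banach_manifold M" "c \<in> charts_at M p" "d \<in> charts_at M p" "e \<in> charts_at M p"
  shows "transition_deriv d e p (transition_deriv c d p u) = transition_deriv c e p u"
  using deriv_local_rep_change[OF assms(1,1) smooth_map_id[OF assms(1)], of c p c d e u] assms(2-4)
  by (simp add: transition_deriv_self[OF assms(1,2)])

section \<open>The tangent bundle\<close>

lemma tangent_vectors_iff:
  "v \<in> tangent_vectors M \<longleftrightarrow> fst v \<in> points M \<and> snd v \<in> extensional (charts_at M (fst v)) \<and>
     (\<forall>c\<in>charts_at M (fst v). \<forall>d\<in>charts_at M (fst v). snd v d = transition_deriv c d (fst v) (snd v c))"
  by (simp add: tangent_vectors_def case_prod_unfold)

lemma tangent_vectorI:
  assumes "fst v \<in> points M" "snd v \<in> extensional (charts_at M (fst v))"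
    "\<And>c d. c \<in> charts_at M (fst v) \<Longrightarrow> d \<in> charts_at M (fst v) \<Longrightarrow>
       snd v d = transition_deriv c d (fst v) (snd v c)"
  shows "v \<in> tangent_vectors M"
  unfolding tangent_vectors_iff using assms by blast

lemma tangent_vector_base: "v \<in> tangent_vectors M \<Longrightarrow> fst v \<in> points M"
  and tangent_vector_extensional: "v \<in> tangent_vectors M \<Longrightarrow> snd v \<in> extensional (charts_at M (fst v))"
  and tangent_vector_change:
    "v \<in> tangent_vectors M \<Longrightarrow> c \<in> charts_at M (fst v) \<Longrightarrow> d \<in> charts_at M (fst v) \<Longrightarrow>
      snd v d = transition_deriv c d (fst v) (snd v c)"
  unfolding tangent_vectors_iff by blast+

definition tangent_vector_of ::
    "('m, 'e::banach) chart set \<Rightarrow> ('m, 'e) chart \<Rightarrow> 'm \<Rightarrow> 'e \<Rightarrow> ('m, 'e) tvec" where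
  "tangent_vector_of M c p u = (p, \<lambda>d\<in>charts_at M p. transition_deriv c d p u)"

lemma tangent_vector_of:
  assumes "banach_manifold M" "c \<in> charts_at M p"
  shows tangent_vector_of_in: "tangent_vector_of M c p u \<in> tangent_vectors M"
    and fst_tangent_vector_of: "fst (tangent_vector_of M c p u) = p"
    and snd_tangent_vector_of: "snd (tangent_vector_of M c p u) c = u"
proof -
  show "fst (tangent_vector_of M c p u) = p" "snd (tangent_vector_of M c p u) c = u"
    using assms by (simp_all add: tangent_vector_of_def transition_deriv_self)
  show "tangent_vector_of M c p u \<in> tangent_vectors M"
  proof (rule tangent_vectorI)
    show "fst (tangent_vector_of M c p u) \<in> points M"
      using assms(2) unfolding tangent_vector_of_def in_points_iff fst_conv by blast
    show "snd (tangent_vector_of M c p u) \<in> extensional (charts_at M (fst (tangent_vector_of M c p u)))"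
      by (simp add: tangent_vector_of_def)
  qed (simp add: tangent_vector_of_def transition_deriv_compose[OF assms])
qed

lemma tangent_vector_base_chart:
  assumes "v \<in> tangent_vectors M"
  obtains c where "c \<in> charts_at M (fst v)"
  using tangent_vector_base[OF assms] unfolding in_points_iff by blast

text \<open>
  One chart suffices to compare tangent vectors, because the other coordinates are determined by it.
\<close>
lemma tangent_vector_eqI:
  assumes "v \<in> tangent_vectors M" "w \<in> tangent_vectors M" "fst v = fst w"
    and "c \<in> charts_at M (fst v)" "snd v c = snd w c"
  shows "v = w"
proof (rule prod_eqI)
  show "snd v = snd w"
  proof (rule extensionalityI[of _ "charts_at M (fst v)"])
    show "snd v \<in> extensional (charts_at M (fst v))" "snd w \<in> extensional (charts_at M (fst v))"
      using tangent_vector_extensional[OF assms(1)] tangent_vector_extensional[OF assms(2)] assms(3)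
      by simp_all
    show "snd v d = snd w d" if "d \<in> charts_at M (fst v)" for d
      using tangent_vector_change[OF assms(1) assms(4) that] tangent_vector_change[OF assms(2), of c d] that assms(3-5)
      by metis
  qed
qed (rule assms)

lemma snd_tangent_chart [simp]: "snd (tangent_chart M c) v = (snd c (fst v), snd v c)"
  and in_tangent_chart [simp]: "v \<in> fst (tangent_chart M c) \<longleftrightarrow> v \<in> tangent_vectors M \<and> fst v \<in> fst c"
  by (simp_all add: tangent_chart_def)

lemma tangent_chart_image:
  assumes "banach_manifold M" "c \<in> M" "A \<subseteq> fst c"
  shows "snd (tangent_chart M c) ` {v \<in> tangent_vectors M. fst v \<in> A} = snd c ` A \<times> UNIV"
    (is "_ = ?R")
proof (intro equalityI subsetI)
  fix z assume "z \<in> ?R"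
  then obtain p u where z: "z = (snd c p, u)" "p \<in> A" by auto
  then have c: "c \<in> charts_at M p" using assms by (auto intro: charts_atI)
  have "z = snd (tangent_chart M c) (tangent_vector_of M c p u)"
    using tangent_vector_of[OF assms(1) c] z by simp
  then show "z \<in> snd (tangent_chart M c) ` {v \<in> tangent_vectors M. fst v \<in> A}"
    by (rule image_eqI) (use tangent_vector_of(1,2)[OF assms(1) c, of u] z(2) in simp)
qed auto

lemma tangent_chart_overlap:
  assumes "banach_manifold M" "c \<in> M"
  shows "snd (tangent_chart M c) ` (fst (tangent_chart M c) \<inter> fst (tangent_chart M d)) =
    snd c ` (fst c \<inter> fst d) \<times> UNIV"
proof -
  have "fst (tangent_chart M c) \<inter> fst (tangent_chart M d) = {v \<in> tangent_vectors M. fst v \<in> fst c \<inter> fst d}"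
    by auto
  then show ?thesis using tangent_chart_image[OF assms, of "fst c \<inter> fst d"] by auto
qed

lemma tangent_chart_domain:
  assumes "banach_manifold M" "c \<in> M"
  shows "snd (tangent_chart M c) ` fst (tangent_chart M c) = snd c ` fst c \<times> UNIV"
  using tangent_chart_overlap[OF assms, of c] by simp

lemma inj_on_tangent_chart:
  assumes "banach_manifold M" "c \<in> M"
  shows "inj_on (snd (tangent_chart M c)) (fst (tangent_chart M c))"
proof (rule inj_onI)
  fix v w assume v: "v \<in> fst (tangent_chart M c)" and w: "w \<in> fst (tangent_chart M c)"
    and eq: "snd (tangent_chart M c) v = snd (tangent_chart M c) w"
  have "inj_on (snd c) (fst c)" using assms by (simp add: banach_manifold_def)
  then have "fst v = fst w" using v w eq by (auto dest: inj_onD)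
  then show "v = w" using v w eq assms(2) by (auto intro!: tangent_vector_eqI[of v M w c] charts_atI)
qed

lemma chart_inv_tangent_chart:
  assumes "banach_manifold M" "c \<in> M" "x \<in> snd c ` fst c"
  shows "chart_inv (tangent_chart M c) (x, u) = tangent_vector_of M c (chart_inv c x) u"
proof -
  have c: "c \<in> charts_at M (chart_inv c x)" using assms chart_inv_image[OF assms(3)] by (auto intro: charts_atI)
  have "snd (tangent_chart M c) (tangent_vector_of M c (chart_inv c x) u) = (x, u)"
    using tangent_vector_of[OF assms(1) c] chart_inv_image[OF assms(3)] by simp
  moreover have "tangent_vector_of M c (chart_inv c x) u \<in> fst (tangent_chart M c)"
    using tangent_vector_of[OF assms(1) c] chart_inv_image[OF assms(3)] by simp
  ultimately show ?thesis
    using inv_into_f_f[OF inj_on_tangent_chart[OF assms(1,2)]] unfolding chart_inv_def by metis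
qed

text \<open>
  The transition maps of the tangent bundle are the tangent maps of the transition maps of \<open>M\<close>, which
  gives their smoothness.
\<close>
lemma transition_tangent_chart:
  assumes "banach_manifold M" "c \<in> M" "d \<in> M" "x \<in> snd c ` (fst c \<inter> fst d)"
  shows "local_rep (tangent_chart M c) (tangent_chart M d) id (x, u) =
    (local_rep c d id x, deriv_at (local_rep c d id) x u)"
proof -
  obtain p where p: "x = snd c p" "p \<in> fst c" "p \<in> fst d" using assms(4) by auto
  have c: "c \<in> charts_at M p" "d \<in> charts_at M p" using assms p by (auto intro: charts_atI)
  have "chart_inv (tangent_chart M c) (x, u) = tangent_vector_of M c p u"
    using chart_inv_tangent_chart[OF assms(1,2), of x u] chart_inv_coordinate[OF assms(1,2) p(2)] p by simp
  moreover have "snd (tangent_vector_of M c p u) d = deriv_at (local_rep c d id) x u"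
    using c p by (simp add: tangent_vector_of_def)
  ultimately show ?thesis
    using local_rep_coordinate[OF assms(1,2) p(2), of d id] p
    by (simp add: local_rep_def[of "tangent_chart M c"] fst_tangent_vector_of[OF assms(1) c(1)])
qed

theorem banach_manifold_tangent_bundle:
  assumes "banach_manifold M"
  shows "banach_manifold (tangent_bundle M)"
proof -
  have "smooth_on (snd (tangent_chart M c) ` (fst (tangent_chart M c) \<inter> fst (tangent_chart M d)))
         (local_rep (tangent_chart M c) (tangent_chart M d) id)" if cd: "c \<in> M" "d \<in> M" for c d
  proof -
    let ?U = "snd c ` (fst c \<inter> fst d)" and ?\<phi> = "local_rep c d id"
    have sm: "smooth_on ?U ?\<phi>" by (rule transition_smooth[OF assms cd])
    have "open (?U \<times> (UNIV :: 'b set))" by (intro open_Times smooth_on_open[OF sm]) simp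
    then have "smooth_on (?U \<times> (UNIV :: 'b set)) (\<lambda>z. ?\<phi> (fst z))"
      by (intro smooth_on_compose[OF sm smooth_on_bounded_linear[OF bounded_linear_fst]]) auto
    from smooth_on_Pair[OF this smooth_on_deriv[OF sm]]
    have "smooth_on (?U \<times> UNIV) (local_rep (tangent_chart M c) (tangent_chart M d) id)"
      by (rule smooth_on_cong) (auto simp: transition_tangent_chart[OF assms cd])
    then show ?thesis using tangent_chart_overlap[OF assms cd(1), of d] by simp
  qed
  moreover have "open (snd (tangent_chart M c) ` fst (tangent_chart M c))" if "c \<in> M" for c
    unfolding tangent_chart_domain[OF assms that] by (intro open_Times open_chart_image[OF assms that]) simp
  ultimately show ?thesis
    unfolding banach_manifold_def tangent_bundle_def using inj_on_tangent_chart[OF assms] by auto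
qed

lemma points_tangent_bundle: "points (tangent_bundle M) = tangent_vectors M"
  using tangent_vector_base by (fastforce simp: points_def tangent_bundle_def)

lemma charts_at_tangent_bundle:
  "v \<in> tangent_vectors M \<Longrightarrow> charts_at (tangent_bundle M) v = tangent_chart M ` charts_at M (fst v)"
  by (auto simp: charts_at_def tangent_bundle_def)

lemma tangent_chart_at:
  "v \<in> tangent_vectors M \<Longrightarrow> c \<in> charts_at M (fst v) \<Longrightarrow>
    tangent_chart M c \<in> charts_at (tangent_bundle M) v"
  by (simp add: charts_at_tangent_bundle)

lemma tangent_bundle_base: "w \<in> tangent_vectors (tangent_bundle M) \<Longrightarrow> fst w \<in> tangent_vectors M"
  using tangent_vector_base points_tangent_bundle by blast

text \<open>
  The transformation law for coordinates on the second tangent bundle. The second derivative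
  of the transition map is the only part that mixes the two tangent directions.
\<close>
lemma transition_deriv_tangent_chart:
  assumes M: "banach_manifold M" and v: "v \<in> tangent_vectors M"
    and c: "c \<in> charts_at M (fst v)" and d: "d \<in> charts_at M (fst v)"
  shows "transition_deriv (tangent_chart M c) (tangent_chart M d) v (h, k) =
    (transition_deriv c d (fst v) h,
     second_deriv (local_rep c d id) (snd c (fst v)) h (snd v c) + transition_deriv c d (fst v) k)"
proof -
  note cM = charts_atD[OF c] and dM = charts_atD[OF d]
  let ?U = "snd c ` (fst c \<inter> fst d)" and ?\<phi> = "local_rep c d id" and ?x = "snd c (fst v)"
  have sm: "smooth_on ?U ?\<phi>" by (rule transition_smooth[OF M cM(1) dM(1)])
  have x: "?x \<in> ?U" using cM dM by auto
  have "((\<lambda>z. ?\<phi> (fst z)) has_derivative (\<lambda>z. deriv_at ?\<phi> ?x (fst z))) (at (?x, snd v c))"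
    by (rule has_derivative_compose[where f = fst, OF has_derivative_fst[OF has_derivative_ident]])
       (unfold fst_conv, rule smooth_on_has_derivative[OF sm x])
  from has_derivative_Pair[OF this deriv_has_derivative[OF sm x]]
  have "((\<lambda>z. (?\<phi> (fst z), (case z of (y, w) \<Rightarrow> deriv_at ?\<phi> y w))) has_derivative
     (\<lambda>(h, k). (deriv_at ?\<phi> ?x h, second_deriv ?\<phi> ?x h (snd v c) + deriv_at ?\<phi> ?x k))) (at (?x, snd v c))"
    by (simp add: case_prod_unfold)
  then have "(local_rep (tangent_chart M c) (tangent_chart M d) id has_derivative
     (\<lambda>(h, k). (deriv_at ?\<phi> ?x h, second_deriv ?\<phi> ?x h (snd v c) + deriv_at ?\<phi> ?x k))) (at (?x, snd v c))"
    by (rule has_derivative_transform_within_open[where s = "?U \<times> UNIV"])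
       (use x smooth_on_open[OF sm] in \<open>auto intro!: open_Times simp: transition_tangent_chart[OF M cM(1) dM(1)]\<close>)
  from frechet_derivative_at[OF this] show ?thesis by (simp add: fun_eq_iff)
qed

section \<open>Tangent maps\<close>

text \<open>
  The definition of \<open>tangent_map\<close> chooses a chart at the base point; the coordinate formula in an
  arbitrary chart follows from \<open>deriv_local_rep_change\<close>.
\<close>
lemma tangent_map:
  assumes M: "banach_manifold M" and Q: "banach_manifold Q" and f: "smooth_map M Q f"
    and v: "v \<in> tangent_vectors M"
  shows fst_tangent_map: "fst (tangent_map M Q f v) = f (fst v)"
    and snd_tangent_map: "\<And>c d. c \<in> charts_at M (fst v) \<Longrightarrow> d \<in> charts_at Q (f (fst v)) \<Longrightarrow>
      snd (tangent_map M Q f v) d = deriv_at (local_rep c d f) (snd c (fst v)) (snd v c)"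
    and tangent_map_in: "tangent_map M Q f v \<in> tangent_vectors Q"
proof -
  define e where "e = (SOME c. c \<in> charts_at M (fst v))"
  have e: "e \<in> charts_at M (fst v)" unfolding e_def using tangent_vector_base_chart[OF v] by (metis someI)
  have eq: "tangent_map M Q f v = (f (fst v), \<lambda>d\<in>charts_at Q (f (fst v)).
         deriv_at (local_rep e d f) (snd e (fst v)) (snd v e))"
    by (simp add: tangent_map_def e_def Let_def)
  show 1: "fst (tangent_map M Q f v) = f (fst v)" by (simp add: eq)
  show 2: "snd (tangent_map M Q f v) d = deriv_at (local_rep c d f) (snd c (fst v)) (snd v c)"
    if c: "c \<in> charts_at M (fst v)" and d: "d \<in> charts_at Q (f (fst v))" for c d
    using deriv_local_rep_change[OF M Q f e c d d, of "snd v e"] d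
    by (simp add: eq tangent_vector_change[OF v e c] transition_deriv_self[OF Q d])
  show "tangent_map M Q f v \<in> tangent_vectors Q"
  proof (rule tangent_vectorI)
    show "fst (tangent_map M Q f v) \<in> points Q"
      using f tangent_vector_base[OF v] by (auto simp: 1 smooth_map_def)
    show "snd (tangent_map M Q f v) \<in> extensional (charts_at Q (fst (tangent_map M Q f v)))"
      by (simp add: eq)
    fix d d' assume "d \<in> charts_at Q (fst (tangent_map M Q f v))" "d' \<in> charts_at Q (fst (tangent_map M Q f v))"
    then have d: "d \<in> charts_at Q (f (fst v))" "d' \<in> charts_at Q (f (fst v))" by (simp_all add: 1)
    show "snd (tangent_map M Q f v) d' =
        transition_deriv d d' (fst (tangent_map M Q f v)) (snd (tangent_map M Q f v) d)"
      using deriv_local_rep_change[OF M Q f e e d, of "snd v e"]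
      by (simp add: 1 2[OF e] d transition_deriv_self[OF M e])
  qed
qed

section \<open>The canonical flip\<close>

abbreviation double_coordinates ::
    "('m, 'e::banach) chart set \<Rightarrow> ('m, 'e) chart \<Rightarrow> (('m, 'e) tvec, 'e \<times> 'e) tvec \<Rightarrow> ('e \<times> 'e) \<times> ('e \<times> 'e)" where
  "double_coordinates M c \<equiv> snd (tangent_chart (tangent_bundle M) (tangent_chart M c))"

lemma double_tangent_vector_eqI:
  assumes w: "w \<in> tangent_vectors (tangent_bundle M)" and w': "w' \<in> tangent_vectors (tangent_bundle M)"
    and base: "fst (fst w) = fst (fst w')" and c: "c \<in> charts_at M (fst (fst w))"
    and eq: "double_coordinates M c w = double_coordinates M c w'"
  shows "w = w'"
proof (rule tangent_vector_eqI[OF w w'])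
  note b = tangent_bundle_base[OF w] tangent_bundle_base[OF w']
  show "fst w = fst w'" by (rule tangent_vector_eqI[OF b base c]) (use eq in simp)
  show "tangent_chart M c \<in> charts_at (tangent_bundle M) (fst w)" by (rule tangent_chart_at[OF b(1) c])
qed (use eq in simp)

text \<open>
  The description that defines the flip is satisfied: prescribing the flipped coordinates in a single
  chart determines a candidate, and the transformation law carries the prescription to every other chart,
  because exchanging the two tangent directions only exchanges the arguments of a
  symmetric second derivative.
\<close>
lemma canonical_flip:
  assumes M: "banach_manifold M" and w: "w \<in> tangent_vectors (tangent_bundle M)"
  shows "canonical_flip M w \<in> tangent_vectors (tangent_bundle M)"
    and "fst (fst (canonical_flip M w)) = fst (fst w)"
    and "\<And>c. c \<in> charts_at M (fst (fst w)) \<Longrightarrow>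
      double_coordinates M c (canonical_flip M w) = flip_coords (double_coordinates M c w)"
proof -
  define p where "p = fst (fst w)"
  define P where "P w' \<longleftrightarrow> w' \<in> tangent_vectors (tangent_bundle M) \<and> fst (fst w') = p \<and>
     (\<forall>c\<in>charts_at M p. double_coordinates M c w' = flip_coords (double_coordinates M c w))" for w'
  note v = tangent_bundle_base[OF w] and TM = banach_manifold_tangent_bundle[OF M]
  obtain c where c: "c \<in> charts_at M p" using tangent_vector_base_chart[OF v] unfolding p_def by blast
  define v' where "v' = tangent_vector_of M c p (fst (snd w (tangent_chart M c)))"
  have v': "v' \<in> tangent_vectors M" "fst v' = p" "snd v' c = fst (snd w (tangent_chart M c))"
    unfolding v'_def by (rule tangent_vector_of[OF M c])+
  have tc: "tangent_chart M c \<in> charts_at (tangent_bundle M) v'"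
    "tangent_chart M c \<in> charts_at (tangent_bundle M) (fst w)"
    using c v' v by (auto simp: p_def intro!: tangent_chart_at)
  define w' where "w' = tangent_vector_of (tangent_bundle M) (tangent_chart M c) v'
     (snd (fst w) c, snd (snd w (tangent_chart M c)))"
  have w': "w' \<in> tangent_vectors (tangent_bundle M)" "fst w' = v'"
    "snd w' (tangent_chart M c) = (snd (fst w) c, snd (snd w (tangent_chart M c)))"
    unfolding w'_def by (rule tangent_vector_of[OF TM tc(1)])+
  have "P w'"
    unfolding P_def
  proof (intro conjI ballI)
    fix d assume d: "d \<in> charts_at M p"
    have td: "tangent_chart M d \<in> charts_at (tangent_bundle M) v'"
      "tangent_chart M d \<in> charts_at (tangent_bundle M) (fst w)"
      using d v' v by (auto simp: p_def intro!: tangent_chart_at)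
    let ?\<phi> = "local_rep c d id" and ?x = "snd c p"
    obtain \<xi> \<eta> where \<xi>: "snd w (tangent_chart M c) = (\<xi>, \<eta>)" by fastforce
    have a: "snd (fst w) d = deriv_at ?\<phi> ?x (snd (fst w) c)"
      using tangent_vector_change[OF v, of c d] c d by (simp add: p_def)
    have a': "snd v' d = deriv_at ?\<phi> ?x \<xi>"
      using tangent_vector_change[OF v'(1), of c d] c d v' \<xi> by simp
    have b: "snd w (tangent_chart M d) = (deriv_at ?\<phi> ?x \<xi>, second_deriv ?\<phi> ?x \<xi> (snd (fst w) c) + deriv_at ?\<phi> ?x \<eta>)"
      using tangent_vector_change[OF w tc(2) td(2)] transition_deriv_tangent_chart[OF M v, of c d \<xi> \<eta>] c d
      by (simp add: \<xi> p_def)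
    have b': "snd w' (tangent_chart M d) = (deriv_at ?\<phi> ?x (snd (fst w) c),
        second_deriv ?\<phi> ?x (snd (fst w) c) \<xi> + deriv_at ?\<phi> ?x \<eta>)"
      using tangent_vector_change[OF w'(1), of "tangent_chart M c" "tangent_chart M d"] tc(1) td(1) w' v' c d \<xi>
        transition_deriv_tangent_chart[OF M v'(1), of c d "snd (fst w) c" \<eta>]
      by simp
    have sym: "second_deriv ?\<phi> ?x \<xi> (snd (fst w) c) = second_deriv ?\<phi> ?x (snd (fst w) c) \<xi>"
      by (rule second_deriv_sym[OF transition_smooth[OF M, of c d]]) (use c d in \<open>auto simp: charts_at_def\<close>)
    show "double_coordinates M d w' = flip_coords (double_coordinates M d w)"
      using a a' b b' sym by (simp add: flip_coords_def w'(2) v'(2) p_def[symmetric])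
  qed (use w' v' in auto)
  moreover have "w'' = w'" if "P w''" for w''
  proof (rule double_tangent_vector_eqI)
    show "c \<in> charts_at M (fst (fst w''))" "fst (fst w'') = fst (fst w')"
      "double_coordinates M c w'' = double_coordinates M c w'"
      using that \<open>P w'\<close> c by (simp_all add: P_def del: snd_tangent_chart)
  qed (use that \<open>P w'\<close> in \<open>simp_all add: P_def\<close>)
  ultimately have "(THE w. P w) = w'" by (rule the_equality)
  moreover have "canonical_flip M w = (THE w. P w)"
    by (simp add: canonical_flip_def P_def p_def Let_def)
  ultimately have "P (canonical_flip M w)" using \<open>P w'\<close> by simp
  then show "canonical_flip M w \<in> tangent_vectors (tangent_bundle M)"
    "fst (fst (canonical_flip M w)) = fst (fst w)"
    "\<And>c. c \<in> charts_at M (fst (fst w)) \<Longrightarrow>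
      double_coordinates M c (canonical_flip M w) = flip_coords (double_coordinates M c w)"
    by (auto simp: P_def p_def)
qed

section \<open>Operators in charts\<close>

lemma N_operator_in:
  assumes "N_operator M N" "v \<in> tangent_vectors M"
  shows "N v \<in> tangent_vectors M"
  using assms by (auto simp: N_operator_def smooth_map_def points_tangent_bundle)

lemma N_operator_base: "N_operator M N \<Longrightarrow> v \<in> tangent_vectors M \<Longrightarrow> fst (N v) = fst v"
  by (simp add: N_operator_def)

text \<open>
  The fibre component of the coordinate form of \<open>N\<close>; the base component is the identity
  (\<open>local_rep_operator\<close>).
\<close>
definition operator_rep ::
    "('m, 'e::banach) chart set \<Rightarrow> ('m, 'e) chart \<Rightarrow> (('m, 'e) tvec \<Rightarrow> ('m, 'e) tvec) \<Rightarrow> 'e \<times> 'e \<Rightarrow> 'e" where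
  "operator_rep M c N z = snd (local_rep (tangent_chart M c) (tangent_chart M c) N z)"

lemma operator_rep_coordinate:
  assumes M: "banach_manifold M" and v: "v \<in> tangent_vectors M" and c: "c \<in> charts_at M (fst v)"
  shows "operator_rep M c N (snd c (fst v), snd v c) = snd (N v) c"
proof -
  have tc: "tangent_chart M c \<in> charts_at (tangent_bundle M) v" by (rule tangent_chart_at[OF v c])
  show ?thesis
    using local_rep_coordinate[OF banach_manifold_tangent_bundle[OF M] charts_atD[OF tc], of "tangent_chart M c" N]
    by (simp add: operator_rep_def)
qed

lemma operator_rep_tangent_vector_of:
  assumes "banach_manifold M" "c \<in> charts_at M p"
  shows "operator_rep M c N (snd c p, u) = snd (N (tangent_vector_of M c p u)) c"
  using operator_rep_coordinate[OF assms(1) tangent_vector_of_in[OF assms], of c u] assms(2)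
  by (simp add: tangent_vector_of[OF assms])

lemma operator_rep_smooth:
  assumes M: "banach_manifold M" and N: "N_operator M N" and c: "c \<in> M"
  shows "smooth_on (snd c ` fst c \<times> UNIV) (operator_rep M c N)"
proof -
  let ?tc = "tangent_chart M c"
  have "?tc \<in> tangent_bundle M" using c by (simp add: tangent_bundle_def)
  then have "smooth_on (snd ?tc ` {v \<in> fst ?tc. N v \<in> fst ?tc}) (local_rep ?tc ?tc N)"
    using N by (intro smooth_map_local_rep) (auto simp: N_operator_def)
  moreover have "{v \<in> fst ?tc. N v \<in> fst ?tc} = fst ?tc"
    using N_operator_in[OF N] N_operator_base[OF N] by auto
  ultimately have "smooth_on (snd c ` fst c \<times> UNIV) (local_rep ?tc ?tc N)"
    using tangent_chart_domain[OF M c] by simp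
  from smooth_on_linear_compose[OF this bounded_linear_snd] show ?thesis
    by (simp add: operator_rep_def[abs_def])
qed

lemma local_rep_operator:
  assumes M: "banach_manifold M" and N: "N_operator M N" and c: "c \<in> M" and x: "x \<in> snd c ` fst c"
  shows "local_rep (tangent_chart M c) (tangent_chart M c) N (x, u) = (x, operator_rep M c N (x, u))"
proof -
  have c': "c \<in> charts_at M (chart_inv c x)" using chart_inv_image[OF x] c by (auto intro: charts_atI)
  have "fst (N (tangent_vector_of M c (chart_inv c x) u)) = chart_inv c x"
    using N_operator_base[OF N tangent_vector_of_in[OF M c']] fst_tangent_vector_of[OF M c'] by simp
  then have "fst (local_rep (tangent_chart M c) (tangent_chart M c) N (x, u)) = x"
    using chart_inv_tangent_chart[OF M c x, of u] chart_inv_image[OF x] by (simp add: local_rep_def)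
  then show ?thesis by (simp add: operator_rep_def prod_eq_iff)
qed

lemma operator_rep_linear:
  assumes M: "banach_manifold M" and N: "N_operator M N" and c: "c \<in> M" and x: "x \<in> snd c ` fst c"
  shows "bounded_linear (\<lambda>u. operator_rep M c N (x, u))"
proof -
  obtain p where p: "x = snd c p" "p \<in> fst c" using x by auto
  have c': "c \<in> charts_at M p" using c p by (auto intro: charts_atI)
  then have "p \<in> points M" unfolding in_points_iff by blast
  with N c' obtain L where L: "bounded_linear L"
    "\<And>v. v \<in> tangent_vectors M \<Longrightarrow> fst v = p \<Longrightarrow> snd (N v) c = L (snd v c)"
    unfolding N_operator_def by meson
  have "operator_rep M c N (x, u) = L u" for u
    using L(2)[OF tangent_vector_of_in[OF M c'], of u] tangent_vector_of[OF M c', of u]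
    by (simp add: p operator_rep_tangent_vector_of[OF M c'])
  then show ?thesis using L(1) by simp
qed

text \<open>
  For a map covering the identity it suffices to look at coordinate forms with the same chart on both
  sides: a different target chart only adds a smooth transition map.
\<close>
lemma N_operatorI:
  fixes M :: "('m, 'e::banach) chart set"
  assumes M: "banach_manifold M"
    and N: "\<And>v. v \<in> tangent_vectors M \<Longrightarrow> N v \<in> tangent_vectors M"
      "\<And>v. v \<in> tangent_vectors M \<Longrightarrow> fst (N v) = fst v"
    and n: "\<And>v c. v \<in> tangent_vectors M \<Longrightarrow> c \<in> charts_at M (fst v) \<Longrightarrow>
        snd (N v) c = n c (snd c (fst v), snd v c)"
    and smooth: "\<And>c. c \<in> M \<Longrightarrow> smooth_on (snd c ` fst c \<times> UNIV) (n c)"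
    and linear: "\<And>c x. c \<in> M \<Longrightarrow> x \<in> snd c ` fst c \<Longrightarrow> bounded_linear (\<lambda>u. n c (x, u))"
  shows "N_operator M N"
  unfolding N_operator_def
proof (intro conjI ballI)
  have TM: "banach_manifold (tangent_bundle M)" by (rule banach_manifold_tangent_bundle[OF M])
  have "smooth_on (snd (tangent_chart M c) ` {v \<in> fst (tangent_chart M c). N v \<in> fst (tangent_chart M d)})
      (local_rep (tangent_chart M c) (tangent_chart M d) N)" if c: "c \<in> M" and d: "d \<in> M" for c d
  proof -
    let ?U = "snd c ` fst c" and ?W = "snd c ` (fst c \<inter> fst d)"
    let ?T = "local_rep (tangent_chart M c) (tangent_chart M d) id"
    have W: "snd (tangent_chart M c) ` {v \<in> fst (tangent_chart M c). N v \<in> fst (tangent_chart M d)} = ?W \<times> UNIV"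
      (is "_ ` ?A = _")
    proof -
      have "?A = {v \<in> tangent_vectors M. fst v \<in> fst c \<inter> fst d}" using N by auto
      then show ?thesis using tangent_chart_image[OF M c, of "fst c \<inter> fst d"] by simp
    qed
    have tc: "tangent_chart M c \<in> tangent_bundle M" "tangent_chart M d \<in> tangent_bundle M"
      using c d by (auto simp: tangent_bundle_def)
    have "smooth_on (?W \<times> UNIV) ?T"
      using transition_smooth[OF TM tc] tangent_chart_overlap[OF M c, of d] by simp
    moreover have op: "open (?W \<times> (UNIV :: 'e set))"
      by (intro open_Times open_chart_overlap[OF M c d]) simp
    then have "smooth_on (?W \<times> UNIV) (\<lambda>z. (fst z, n c z))"
      by (intro smooth_on_Pair smooth_on_bounded_linear[OF bounded_linear_fst] smooth_on_subset[OF smooth[OF c]]) auto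
    ultimately have "smooth_on (?W \<times> UNIV) (\<lambda>z. ?T (fst z, n c z))"
      by (rule smooth_on_compose) auto
    then have "smooth_on (?W \<times> UNIV) (local_rep (tangent_chart M c) (tangent_chart M d) N)"
    proof (rule smooth_on_cong)
      fix z assume "z \<in> ?W \<times> (UNIV :: 'e set)"
      then obtain v where v: "v \<in> tangent_vectors M" "fst v \<in> fst c" "N v \<in> fst (tangent_chart M d)"
          and z: "z = (snd c (fst v), snd v c)"
        unfolding W[symmetric] by auto
      have c': "c \<in> charts_at M (fst v)" using c v by (auto intro: charts_atI)
      have "?T (fst z, n c z) = ?T (snd (tangent_chart M c) (N v))"
        using N(2)[OF v(1)] n[OF v(1) c'] z by simp
      also have "\<dots> = snd (tangent_chart M d) (N v)"
        using local_rep_coordinate[OF TM tc(1), of "N v" "tangent_chart M d" id] N v by simp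
      also have "\<dots> = local_rep (tangent_chart M c) (tangent_chart M d) N z"
        using local_rep_coordinate[OF TM tc(1), of v "tangent_chart M d" N] v z by simp
      finally show "?T (fst z, n c z) = local_rep (tangent_chart M c) (tangent_chart M d) N z" .
    qed
    then show ?thesis unfolding W .
  qed
  then have "\<forall>c\<in>tangent_bundle M. \<forall>d\<in>tangent_bundle M.
      smooth_on (snd c ` {v \<in> fst c. N v \<in> fst d}) (local_rep c d N)"
    unfolding tangent_bundle_def by blast
  then show "smooth_map (tangent_bundle M) (tangent_bundle M) N"
    unfolding smooth_map_def points_tangent_bundle using N(1) by blast
  show "fst (N v) = fst v" if "v \<in> tangent_vectors M" for v by (rule N(2)[OF that])
  show "\<exists>L. bounded_linear L \<and> (\<forall>v\<in>tangent_vectors M. fst v = p \<longrightarrow> snd (N v) c = L (snd v c))"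
    if "c \<in> charts_at M p" for p c
  proof (intro exI[of _ "\<lambda>u. n c (snd c p, u)"] conjI)
    show "bounded_linear (\<lambda>u. n c (snd c p, u))"
      using that by (intro linear) (auto dest: charts_atD)
    show "\<forall>v\<in>tangent_vectors M. fst v = p \<longrightarrow> snd (N v) c = n c (snd c p, snd v c)"
      using n that by blast
  qed
qed

section \<open>Vector fields and the Lie bracket\<close>

lemma vector_field_at:
  assumes "vector_field_on M W X" "p \<in> W"
  shows "X p \<in> tangent_vectors M" "fst (X p) = p"
  using assms by (auto simp: vector_field_on_def)

lemma vector_field_smooth:
  "vector_field_on M W X \<Longrightarrow> c \<in> M \<Longrightarrow> smooth_on (snd c ` (fst c \<inter> W)) (field_rep c X)"
  by (simp add: vector_field_on_def)

lemma field_rep_coordinate: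
  assumes "banach_manifold M" "c \<in> charts_at M p"
  shows "field_rep c X (snd c p) = snd (X p) c"
  using chart_inv_coordinate[OF assms(1) charts_atD[OF assms(2)]] by (simp add: field_rep_def)

lemma field_rep_has_derivative:
  assumes "vector_field_on M W X" "p \<in> W" "c \<in> charts_at M p"
  shows "(field_rep c X has_derivative deriv_at (field_rep c X) (snd c p)) (at (snd c p))"
  by (rule smooth_on_has_derivative[OF vector_field_smooth[OF assms(1), of c]])
     (use assms in \<open>auto dest: charts_atD\<close>)

text \<open>
  A coordinate form of a vector field transforms by \<open>X_d (\<phi> x) = D\<phi> x (X_c x)\<close>; this is the
  derivative of that identity.
\<close>
lemma deriv_field_rep_change:
  assumes M: "banach_manifold M" and X: "vector_field_on M W X" and p: "p \<in> W"
    and c: "c \<in> charts_at M p" and d: "d \<in> charts_at M p"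
  shows "deriv_at (field_rep d X) (snd d p) (transition_deriv c d p h) =
    second_deriv (local_rep c d id) (snd c p) h (snd (X p) c) +
    transition_deriv c d p (deriv_at (field_rep c X) (snd c p) h)"
proof -
  note cM = charts_atD[OF c] and dM = charts_atD[OF d]
  let ?\<phi> = "local_rep c d id" and ?x = "snd c p"
  define S where "S = snd c ` ((fst c \<inter> fst d) \<inter> (fst c \<inter> W))"
  have sm: "smooth_on (snd c ` (fst c \<inter> fst d)) ?\<phi>" by (rule transition_smooth[OF M cM(1) dM(1)])
  have "S = snd c ` (fst c \<inter> fst d) \<inter> snd c ` (fst c \<inter> W)"
    unfolding S_def by (rule chart_image_Int[OF M cM(1)]) auto
  then have S: "open S" using smooth_on_open[OF sm] smooth_on_open[OF vector_field_smooth[OF X cM(1)]] by auto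
  have x: "?x \<in> S" "?x \<in> snd c ` (fst c \<inter> fst d)" using cM dM p by (auto simp: S_def)
  have \<phi>x: "?\<phi> ?x = snd d p" using local_rep_coordinate[OF M cM, of d id] by simp
  have 1: "((\<lambda>x. field_rep d X (?\<phi> x)) has_derivative
      (\<lambda>h. deriv_at (field_rep d X) (snd d p) (transition_deriv c d p h))) (at ?x)"
    by (rule has_derivative_compose[OF transition_has_derivative[OF M c d]])
       (unfold \<phi>x, rule field_rep_has_derivative[OF X p d])
  have pair: "((\<lambda>x. (x, field_rep c X x)) has_derivative (\<lambda>h. (h, deriv_at (field_rep c X) ?x h))) (at ?x)"
    by (intro has_derivative_Pair has_derivative_ident field_rep_has_derivative[OF X p c])
  have 2: "((\<lambda>x. case (x, field_rep c X x) of (y, w) \<Rightarrow> deriv_at ?\<phi> y w) has_derivative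
      (\<lambda>h. case (h, deriv_at (field_rep c X) ?x h) of
         (h, k) \<Rightarrow> second_deriv ?\<phi> ?x h (snd (X p) c) + transition_deriv c d p k)) (at ?x)"
    by (rule has_derivative_compose[OF pair])
       (unfold field_rep_coordinate[OF M c], rule deriv_has_derivative[OF sm x(2)])
  have "field_rep d X (?\<phi> x) = (case (x, field_rep c X x) of (y, w) \<Rightarrow> deriv_at ?\<phi> y w)" if xS: "x \<in> S" for x
  proof -
    obtain q where q: "x = snd c q" "q \<in> fst c" "q \<in> fst d" "q \<in> W" using xS by (auto simp: S_def)
    then have c': "c \<in> charts_at M q" "d \<in> charts_at M q" using cM dM by (auto intro: charts_atI)
    then show ?thesis
      using tangent_vector_change[of "X q" M c d] vector_field_at[OF X q(4)]
      by (simp add: q field_rep_coordinate[OF M] local_rep_coordinate[OF M cM(1) q(2)])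
  qed
  from has_derivative_transform_within_open[OF 1 S x(1) this]
  have "((\<lambda>x. case (x, field_rep c X x) of (y, w) \<Rightarrow> deriv_at ?\<phi> y w) has_derivative
     (\<lambda>h. deriv_at (field_rep d X) (snd d p) (transition_deriv c d p h))) (at ?x)" .
  from fun_cong[OF has_derivative_unique[OF this 2], of h] show ?thesis by simp
qed

lemma transition_deriv_linear:
  "banach_manifold M \<Longrightarrow> c \<in> charts_at M p \<Longrightarrow> d \<in> charts_at M p \<Longrightarrow> linear (transition_deriv c d p)"
  by (rule has_derivative_linear[OF transition_has_derivative])

text \<open>
  The second derivatives of the transition map, which prevent a single derivative of a field from
  being tensorial, cancel in the bracket by symmetry. Membership is needed because an
  operator is only constrained on tangent vectors.
\<close>
lemma lie_bracket_in:
  assumes M: "banach_manifold M" and X: "vector_field_on M W X" and Y: "vector_field_on M W Y" and p: "p \<in> W"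
  shows "lie_bracket M X Y p \<in> tangent_vectors M"
proof (rule tangent_vectorI)
  note Xp = vector_field_at[OF X p] and Yp = vector_field_at[OF Y p]
  show "fst (lie_bracket M X Y p) \<in> points M"
    using tangent_vector_base[OF Xp(1)] Xp(2) by (simp add: lie_bracket_def)
  show "snd (lie_bracket M X Y p) \<in> extensional (charts_at M (fst (lie_bracket M X Y p)))"
    by (simp add: lie_bracket_def)
  fix c d assume "c \<in> charts_at M (fst (lie_bracket M X Y p))" "d \<in> charts_at M (fst (lie_bracket M X Y p))"
  then have c: "c \<in> charts_at M p" and d: "d \<in> charts_at M p" by (simp_all add: lie_bracket_def)
  have X': "snd (X p) d = transition_deriv c d p (snd (X p) c)"
    using tangent_vector_change[OF Xp(1), of c d] c d Xp(2) by simp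
  have Y': "snd (Y p) d = transition_deriv c d p (snd (Y p) c)"
    using tangent_vector_change[OF Yp(1), of c d] c d Yp(2) by simp
  have sym: "second_deriv (local_rep c d id) (snd c p) (snd (X p) c) (snd (Y p) c) =
      second_deriv (local_rep c d id) (snd c p) (snd (Y p) c) (snd (X p) c)"
    by (rule second_deriv_sym[OF transition_smooth[OF M, of c d]]) (use c d in \<open>auto dest: charts_atD\<close>)
  show "snd (lie_bracket M X Y p) d = transition_deriv c d (fst (lie_bracket M X Y p)) (snd (lie_bracket M X Y p) c)"
    using c d deriv_field_rep_change[OF M X p c d, of "snd (Y p) c"] deriv_field_rep_change[OF M Y p c d, of "snd (X p) c"]
    by (simp add: lie_bracket_def X' Y' sym linear_diff[OF transition_deriv_linear[OF M c d]])
qed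

lemma tangent_add_in:
  assumes M: "banach_manifold M" and v: "v \<in> tangent_vectors M" and w: "w \<in> tangent_vectors M" and eq: "fst v = fst w"
  shows "tangent_add M v w \<in> tangent_vectors M"
proof (rule tangent_vectorI)
  fix c d assume "c \<in> charts_at M (fst (tangent_add M v w))" "d \<in> charts_at M (fst (tangent_add M v w))"
  then have c: "c \<in> charts_at M (fst w)" and d: "d \<in> charts_at M (fst w)" by (simp_all add: tangent_add_def eq)
  show "snd (tangent_add M v w) d = transition_deriv c d (fst (tangent_add M v w)) (snd (tangent_add M v w) c)"
    using tangent_vector_change[OF v, of c d] tangent_vector_change[OF w, of c d] c d
    by (simp add: tangent_add_def eq linear_add[OF transition_deriv_linear[OF M c d]])
qed (use tangent_vector_base[OF v] in \<open>simp_all add: tangent_add_def\<close>)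

lemma tangent_diff_in:
  assumes M: "banach_manifold M" and v: "v \<in> tangent_vectors M" and w: "w \<in> tangent_vectors M" and eq: "fst v = fst w"
  shows "tangent_diff M v w \<in> tangent_vectors M"
proof (rule tangent_vectorI)
  fix c d assume "c \<in> charts_at M (fst (tangent_diff M v w))" "d \<in> charts_at M (fst (tangent_diff M v w))"
  then have c: "c \<in> charts_at M (fst w)" and d: "d \<in> charts_at M (fst w)" by (simp_all add: tangent_diff_def eq)
  show "snd (tangent_diff M v w) d = transition_deriv c d (fst (tangent_diff M v w)) (snd (tangent_diff M v w) c)"
    using tangent_vector_change[OF v, of c d] tangent_vector_change[OF w, of c d] c d
    by (simp add: tangent_diff_def eq linear_diff[OF transition_deriv_linear[OF M c d]])
qed (use tangent_vector_base[OF v] in \<open>simp_all add: tangent_diff_def\<close>)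

lemma field_rep_operator:
  assumes M: "banach_manifold M" and N: "N_operator M N" and X: "vector_field_on M W X"
    and c: "c \<in> M" and x: "x \<in> snd c ` (fst c \<inter> W)"
  shows "field_rep c (N \<circ> X) x = operator_rep M c N (x, field_rep c X x)"
proof -
  obtain p where p: "x = snd c p" "p \<in> fst c" "p \<in> W" using x by auto
  have c': "c \<in> charts_at M p" using c p by (auto intro: charts_atI)
  show ?thesis
    using operator_rep_coordinate[OF M vector_field_at(1)[OF X p(3)], of c N] vector_field_at(2)[OF X p(3)] c'
    by (simp add: p field_rep_coordinate[OF M c'])
qed

lemma vector_field_operator:
  assumes M: "banach_manifold M" and N: "N_operator M N" and X: "vector_field_on M W X"
  shows "vector_field_on M W (N \<circ> X)"
  unfolding vector_field_on_def
proof (intro conjI ballI)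
  show "open_subset M W" using X by (simp add: vector_field_on_def)
  show "(N \<circ> X) p \<in> tangent_vectors M" "fst ((N \<circ> X) p) = p" if "p \<in> W" for p
    using vector_field_at[OF X that] N_operator_in[OF N] N_operator_base[OF N] by simp_all
  fix c assume c: "c \<in> M"
  let ?S = "snd c ` (fst c \<inter> W)"
  have X': "smooth_on ?S (field_rep c X)" by (rule vector_field_smooth[OF X c])
  have "smooth_on ?S (\<lambda>x. (x, field_rep c X x))"
    by (intro smooth_on_Pair X' smooth_on_bounded_linear bounded_linear_ident smooth_on_open[OF X'])
  then have "smooth_on ?S (\<lambda>x. operator_rep M c N (x, field_rep c X x))"
    by (rule smooth_on_compose[OF operator_rep_smooth[OF M N c]]) auto
  then show "smooth_on ?S (field_rep c (N \<circ> X))"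
    by (rule smooth_on_cong) (simp add: field_rep_operator[OF M N X c])
qed

section \<open>The torsion in a chart\<close>

text \<open>
  The torsion of the operator with coordinate form \<open>n\<close>, evaluated on fields with constant coordinates
  \<open>a\<close> and \<open>b\<close>.
\<close>
definition torsion_rep :: "('e::banach \<times> 'e \<Rightarrow> 'e) \<Rightarrow> 'e \<Rightarrow> 'e \<Rightarrow> 'e \<Rightarrow> 'e" where
  "torsion_rep n x a b =
     deriv_at n (x, a) (n (x, b), 0) - deriv_at n (x, b) (n (x, a), 0) -
     n (x, deriv_at n (x, a) (b, 0) - deriv_at n (x, b) (a, 0))"

text \<open>
  In the fibre direction \<open>n\<close> is its own derivative.
\<close>
lemma deriv_fibrewise_linear:
  assumes n: "smooth_on (U \<times> UNIV) n" and x: "x \<in> U" and lin: "bounded_linear (\<lambda>u. n (x, u))"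
  shows "deriv_at n (x, a) (h, k) = deriv_at n (x, a) (h, 0) + n (x, k)"
proof -
  have d: "(n has_derivative deriv_at n (x, a)) (at (x, a))"
    by (rule smooth_on_has_derivative[OF n]) (use x in simp)
  have "((\<lambda>u. n (x, u)) has_derivative (\<lambda>k. deriv_at n (x, a) (0, k))) (at a)"
    by (rule has_derivative_compose[where f = "\<lambda>u. (x, u)", OF _ d]) (auto intro!: derivative_eq_intros)
  from has_derivative_unique[OF this bounded_linear_imp_has_derivative[OF lin]]
  have "deriv_at n (x, a) (0, k) = n (x, k)" by (rule fun_cong)
  then show ?thesis
    using linear_add[OF has_derivative_linear[OF d], of "(h, 0)" "(0, k)"] by simp
qed

lemma deriv_field_rep_operator:
  assumes M: "banach_manifold M" and N: "N_operator M N" and X: "vector_field_on M W X"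
    and p: "p \<in> W" and c: "c \<in> charts_at M p"
  shows "deriv_at (field_rep c (N \<circ> X)) (snd c p) h =
    deriv_at (operator_rep M c N) (snd c p, snd (X p) c) (h, 0) +
    operator_rep M c N (snd c p, deriv_at (field_rep c X) (snd c p) h)"
proof -
  note cM = charts_atD[OF c]
  let ?n = "operator_rep M c N" and ?x = "snd c p" and ?S = "snd c ` (fst c \<inter> W)"
  have x: "?x \<in> snd c ` fst c" "?x \<in> ?S" using cM p by auto
  have sm: "smooth_on (snd c ` fst c \<times> UNIV) ?n" by (rule operator_rep_smooth[OF M N cM(1)])
  have n: "(?n has_derivative deriv_at ?n (?x, snd (X p) c)) (at (?x, snd (X p) c))"
    by (rule smooth_on_has_derivative[OF sm]) (use x in simp)
  have "((\<lambda>x. (x, field_rep c X x)) has_derivative (\<lambda>h. (h, deriv_at (field_rep c X) ?x h))) (at ?x)"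
    by (intro has_derivative_Pair has_derivative_ident field_rep_has_derivative[OF X p c])
  then have "((\<lambda>x. ?n (x, field_rep c X x)) has_derivative
      (\<lambda>h. deriv_at ?n (?x, snd (X p) c) (h, deriv_at (field_rep c X) ?x h))) (at ?x)"
    by (rule has_derivative_compose) (unfold field_rep_coordinate[OF M c], rule n)
  then have "(field_rep c (N \<circ> X) has_derivative
      (\<lambda>h. deriv_at ?n (?x, snd (X p) c) (h, deriv_at (field_rep c X) ?x h))) (at ?x)"
    by (rule has_derivative_transform_within_open[OF _ smooth_on_open[OF vector_field_smooth[OF X cM(1)]] x(2)])
       (simp add: field_rep_operator[OF M N X cM(1)])
  from fun_cong[OF frechet_derivative_at[OF this, symmetric]]
  show ?thesis
    using deriv_fibrewise_linear[OF sm x(1) operator_rep_linear[OF M N cM(1) x(1)], of "snd (X p) c" h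
        "deriv_at (field_rep c X) (snd c p) h"]
    by metis
qed

text \<open>
  Tensoriality: all terms that contain derivatives of the fields \<open>X\<close> and \<open>Y\<close> cancel.
\<close>
lemma nijenhuis_torsion_coordinate:
  assumes M: "banach_manifold M" and N: "N_operator M N"
    and X: "vector_field_on M W X" and Y: "vector_field_on M W Y"
    and p: "p \<in> W" and c: "c \<in> charts_at M p"
  shows "snd (nijenhuis_torsion M N X Y p) c =
    torsion_rep (operator_rep M c N) (snd c p) (snd (X p) c) (snd (Y p) c)"
proof -
  note cM = charts_atD[OF c]
  let ?n = "operator_rep M c N" and ?x = "snd c p"
  note NX = vector_field_operator[OF M N X] and NY = vector_field_operator[OF M N Y]
  have base: "fst (lie_bracket M Z Z' p) = p" for Z Z' by (simp add: lie_bracket_def)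
  have br: "snd (lie_bracket M Z Z' p) c =
      deriv_at (field_rep c Z) ?x (snd (Z' p) c) - deriv_at (field_rep c Z') ?x (snd (Z p) c)" for Z Z'
    using c by (simp add: lie_bracket_def)
  have n: "snd (N v) c = ?n (?x, snd v c)" if "v \<in> tangent_vectors M" "fst v = p" for v
    using operator_rep_coordinate[OF M that(1), of c N] that(2) c by simp
  note XY = lie_bracket_in[OF M X Y p] and NXY = lie_bracket_in[OF M NX Y p] and XNY = lie_bracket_in[OF M X NY p]
  let ?s = "tangent_add M (lie_bracket M (N \<circ> X) Y p) (lie_bracket M X (N \<circ> Y) p)"
  have s: "?s \<in> tangent_vectors M" "fst ?s = p"
    using tangent_add_in[OF M NXY XNY] base by (simp_all add: tangent_add_def)
  let ?t = "tangent_diff M ?s (N (lie_bracket M X Y p))"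
  have t: "?t \<in> tangent_vectors M" "fst ?t = p"
    using tangent_diff_in[OF M s(1) N_operator_in[OF N XY]] s(2) base N_operator_base[OF N XY]
    by (simp_all add: tangent_diff_def)
  have lin: "linear (\<lambda>u. ?n (?x, u))"
    using operator_rep_linear[OF M N cM(1), of ?x] cM bounded_linear.linear by blast
  note D = deriv_field_rep_operator[OF M N _ p c]
  have "snd (nijenhuis_torsion M N X Y p) c = snd (lie_bracket M (N \<circ> X) (N \<circ> Y) p) c - ?n (?x, snd ?t c)"
    unfolding nijenhuis_torsion_def using c base n[OF t] by (simp add: tangent_diff_def[of M "lie_bracket M (N \<circ> X) (N \<circ> Y) p"])
  moreover have "snd ?t c = snd ?s c - ?n (?x, snd (lie_bracket M X Y p) c)"
    using c s(2) n[OF XY base] by (simp add: tangent_diff_def)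
  moreover have "snd ?s c = snd (lie_bracket M (N \<circ> X) Y p) c + snd (lie_bracket M X (N \<circ> Y) p) c"
    using c base by (simp add: tangent_add_def)
  ultimately show ?thesis
    using n[OF vector_field_at[OF X p]] n[OF vector_field_at[OF Y p]]
    by (simp add: br D[OF X] D[OF Y] torsion_rep_def linear_add[OF lin] linear_diff[OF lin])
qed

text \<open>
  Local fields with arbitrary values at a point, on which the torsion can be tested.
\<close>
lemma constant_vector_field:
  assumes M: "banach_manifold M" and c: "c \<in> M"
  shows "vector_field_on M (fst c) (\<lambda>p. tangent_vector_of M c p u)"
  unfolding vector_field_on_def
proof (intro conjI ballI)
  show "open_subset M (fst c)"
    unfolding open_subset_def using c open_chart_overlap[OF M _ c] by (auto simp: points_def)
  show "tangent_vector_of M c p u \<in> tangent_vectors M" "fst (tangent_vector_of M c p u) = p" if "p \<in> fst c" for p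
    using tangent_vector_of[OF M charts_atI[OF c that]] by simp_all
  fix d assume d: "d \<in> M"
  let ?S = "snd d ` (fst d \<inter> fst c)"
  have t: "smooth_on ?S (local_rep d c id)" by (rule transition_smooth[OF M d c])
  have "smooth_on ?S (\<lambda>y. (local_rep d c id y, u))"
    by (intro smooth_on_Pair t smooth_on_const smooth_on_open[OF t])
  then have "smooth_on ?S (\<lambda>y. (\<lambda>(x, v). deriv_at (local_rep c d id) x v) (local_rep d c id y, u))"
    by (rule smooth_on_compose[OF smooth_on_deriv[OF transition_smooth[OF M c d]]])
       (auto simp: local_rep_coordinate[OF M d])
  then show "smooth_on ?S (field_rep d (\<lambda>p. tangent_vector_of M c p u))"
  proof (rule smooth_on_cong)
    fix y assume "y \<in> ?S"
    then obtain q where q: "y = snd d q" "q \<in> fst d" "q \<in> fst c" by auto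
    have d': "d \<in> charts_at M q" by (rule charts_atI[OF d q(2)])
    show "(\<lambda>(x, v). deriv_at (local_rep c d id) x v) (local_rep d c id y, u) =
        field_rep d (\<lambda>p. tangent_vector_of M c p u) y"
      using d' by (simp add: q field_rep_coordinate[OF M d'] local_rep_coordinate[OF M d q(2)] tangent_vector_of_def)
  qed
qed

theorem nijenhuis_operator_iff_torsion_rep:
  assumes M: "banach_manifold M"
  shows "nijenhuis_operator M N \<longleftrightarrow> N_operator M N \<and>
    (\<forall>c\<in>M. \<forall>x\<in>snd c ` fst c. \<forall>a b. torsion_rep (operator_rep M c N) x a b = 0)"
proof (intro iffI conjI ballI allI)
  assume nij: "nijenhuis_operator M N"
  then show N: "N_operator M N" by (simp add: nijenhuis_operator_def)
  fix c x a b assume c: "c \<in> M" and "x \<in> snd c ` fst c"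
  then obtain p where p: "x = snd c p" "p \<in> fst c" by auto
  have c': "c \<in> charts_at M p" by (rule charts_atI[OF c p(2)])
  let ?X = "\<lambda>u p. tangent_vector_of M c p u"
  have "nijenhuis_torsion M N (?X a) (?X b) p = tangent_zero M p"
    by (rule nij[unfolded nijenhuis_operator_def, THEN conjunct2, rule_format,
          OF constant_vector_field[OF M c] constant_vector_field[OF M c] p(2)])
  then show "torsion_rep (operator_rep M c N) x a b = 0"
    using nijenhuis_torsion_coordinate[OF M N constant_vector_field[OF M c] constant_vector_field[OF M c] p(2) c', of a b] c'
    by (simp add: tangent_zero_def snd_tangent_vector_of[OF M c'] p(1))
next
  assume *: "N_operator M N \<and>
    (\<forall>c\<in>M. \<forall>x\<in>snd c ` fst c. \<forall>a b. torsion_rep (operator_rep M c N) x a b = 0)"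
  have "nijenhuis_torsion M N X Y p = tangent_zero M p"
    if X: "vector_field_on M W X" and Y: "vector_field_on M W Y" and p: "p \<in> W" for W X Y p
  proof (rule prod_eqI)
    show "fst (nijenhuis_torsion M N X Y p) = fst (tangent_zero M p)"
      by (simp add: nijenhuis_torsion_def tangent_diff_def lie_bracket_def tangent_zero_def)
    show "snd (nijenhuis_torsion M N X Y p) = snd (tangent_zero M p)"
    proof (rule extensionalityI[of _ "charts_at M p"])
      have "snd (tangent_diff M (lie_bracket M Z Z' p) w) \<in> extensional (charts_at M p)" for Z Z' w
        by (simp add: tangent_diff_def lie_bracket_def)
      then show "snd (nijenhuis_torsion M N X Y p) \<in> extensional (charts_at M p)"
        unfolding nijenhuis_torsion_def .
      show "snd (tangent_zero M p) \<in> extensional (charts_at M p)" by (simp add: tangent_zero_def)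
      fix c assume c: "c \<in> charts_at M p"
      then show "snd (nijenhuis_torsion M N X Y p) c = snd (tangent_zero M p) c"
        using nijenhuis_torsion_coordinate[OF M _ X Y p c, of N] * charts_atD[OF c] by (simp add: tangent_zero_def)
    qed
  qed
  then show "nijenhuis_operator M N" using * by (auto simp: nijenhuis_operator_def)
qed

section \<open>The tangent lift\<close>

text \<open>
  The coordinate form of the tangent lift. It is \<open>(z, \<zeta>) \<mapsto> (n z, Dn z \<zeta>)\<close> after the
  flip \<open>((x, v), (a, a')) \<mapsto> ((x, a), (v, a'))\<close>.
\<close>
definition lift_rep :: "('e::banach \<times> 'e \<Rightarrow> 'e) \<Rightarrow> ('e \<times> 'e) \<times> ('e \<times> 'e) \<Rightarrow> 'e \<times> 'e" where
  "lift_rep n = (\<lambda>((x, v), (a, a')). (n (x, a), deriv_at n (x, a) (v, a')))"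

lemma deriv_chain:
  assumes n: "smooth_on S n" and Z: "(Z has_derivative Z') (at w)" and \<zeta>: "(\<zeta> has_derivative \<zeta>') (at w)"
    and w: "Z w \<in> S"
  shows "((\<lambda>y. deriv_at n (Z y) (\<zeta> y)) has_derivative
     (\<lambda>h. second_deriv n (Z w) (Z' h) (\<zeta> w) + deriv_at n (Z w) (\<zeta>' h))) (at w)"
proof -
  have "((\<lambda>y. case (Z y, \<zeta> y) of (y, w) \<Rightarrow> deriv_at n y w) has_derivative
     (\<lambda>h. case (Z' h, \<zeta>' h) of (h, k) \<Rightarrow> second_deriv n (Z w) h (\<zeta> w) + deriv_at n (Z w) k)) (at w)"
    by (rule has_derivative_compose[OF has_derivative_Pair[OF Z \<zeta>] deriv_has_derivative[OF n w]])
  then show ?thesis by simp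
qed

lemma smooth_chain:
  assumes n: "smooth_on S n" and Z: "(Z has_derivative Z') (at w)" and w: "Z w \<in> S"
  shows "((\<lambda>y. n (Z y)) has_derivative (\<lambda>h. deriv_at n (Z w) (Z' h))) (at w)"
  by (rule has_derivative_compose[OF Z smooth_on_has_derivative[OF n w]])

lemma bounded_linear_flip_coords: "bounded_linear (flip_coords :: ('e::real_normed_vector \<times> 'e) \<times> ('e \<times> 'e) \<Rightarrow> _)"
proof -
  have eq: "flip_coords = (\<lambda>w :: ('e \<times> 'e) \<times> ('e \<times> 'e). ((fst (fst w), fst (snd w)), (snd (fst w), snd (snd w))))"
    by (auto simp: flip_coords_def)
  show ?thesis
    unfolding eq
    by (intro bounded_linear_Pair bounded_linear_compose[OF bounded_linear_fst bounded_linear_fst]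
        bounded_linear_compose[OF bounded_linear_fst bounded_linear_snd]
        bounded_linear_compose[OF bounded_linear_snd bounded_linear_fst]
        bounded_linear_compose[OF bounded_linear_snd bounded_linear_snd])
qed

lemma lift_rep_flip: "lift_rep n w = (n (fst (flip_coords w)), deriv_at n (fst (flip_coords w)) (snd (flip_coords w)))"
  by (cases w) (auto simp: lift_rep_def flip_coords_def)

lemma lift_rep_smooth:
  assumes n: "smooth_on (U \<times> UNIV) n"
  shows "smooth_on ((U \<times> UNIV) \<times> UNIV) (lift_rep n)"
proof -
  have "open (fst ` (U \<times> (UNIV :: 'a set)))"
    using smooth_on_open[OF n] by (rule open_image_fst)
  then have U: "open U" by simp
  let ?W = "(U \<times> UNIV) \<times> (UNIV :: ('a \<times> 'a) set)"
  have W: "open ?W" by (intro open_Times U open_UNIV)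
  have f: "smooth_on ?W flip_coords" by (rule smooth_on_bounded_linear[OF bounded_linear_flip_coords W])
  have 1: "smooth_on ?W (\<lambda>w. n (fst (flip_coords w)))"
    by (rule smooth_on_compose[OF n smooth_on_linear_compose[OF f bounded_linear_fst]]) (auto simp: flip_coords_def)
  have 2: "smooth_on ?W (\<lambda>w. (\<lambda>(z, \<zeta>). deriv_at n z \<zeta>) (flip_coords w))"
    by (rule smooth_on_compose[OF smooth_on_deriv[OF n] f]) (auto simp: flip_coords_def)
  from smooth_on_Pair[OF 1 2] show ?thesis
    by (rule smooth_on_cong) (simp add: lift_rep_flip case_prod_unfold)
qed

lemma deriv_lift_rep:
  assumes n: "smooth_on (U \<times> UNIV) n" and x: "x \<in> U"
  shows "deriv_at (lift_rep n) ((x, v), (a, a')) ((h, h'), (k, k')) =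
    (deriv_at n (x, a) (h, k), second_deriv n (x, a) (h, k) (v, a') + deriv_at n (x, a) (h', k'))"
proof -
  let ?w = "((x, v), (a, a'))"
  have fl: "(flip_coords has_derivative flip_coords) (at ?w)"
    by (rule bounded_linear_imp_has_derivative[OF bounded_linear_flip_coords])
  have in_dom: "fst (flip_coords ?w) \<in> U \<times> UNIV" using x by (simp add: flip_coords_def)
  have "((\<lambda>w. (n (fst (flip_coords w)), deriv_at n (fst (flip_coords w)) (snd (flip_coords w)))) has_derivative
      (\<lambda>w. (deriv_at n (fst (flip_coords ?w)) (fst (flip_coords w)),
        second_deriv n (fst (flip_coords ?w)) (fst (flip_coords w)) (snd (flip_coords ?w)) +
        deriv_at n (fst (flip_coords ?w)) (snd (flip_coords w))))) (at ?w)"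
    by (intro has_derivative_Pair smooth_chain[OF n has_derivative_fst[OF fl] in_dom]
        deriv_chain[OF n has_derivative_fst[OF fl] has_derivative_snd[OF fl] in_dom])
  then have "(lift_rep n has_derivative
      (\<lambda>w. (deriv_at n (fst (flip_coords ?w)) (fst (flip_coords w)),
        second_deriv n (fst (flip_coords ?w)) (fst (flip_coords w)) (snd (flip_coords ?w)) +
        deriv_at n (fst (flip_coords ?w)) (snd (flip_coords w))))) (at ?w)"
    unfolding lift_rep_flip[abs_def] .
  from fun_cong[OF frechet_derivative_at[OF this], of "((h, h'), (k, k'))"]
  show ?thesis by (simp add: flip_coords_def)
qed

text \<open>
  A homogeneous map agrees with its derivative at the origin, as its difference quotients along rays are
  constant. Linearity and boundedness of the lift on fibres thus follow from its
  homogeneity and smoothness.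
\<close>
lemma bounded_linear_of_homogeneous:
  assumes hom: "\<And>r u. f (r *\<^sub>R u) = r *\<^sub>R f u" and f: "(f has_derivative f') (at 0)"
  shows "bounded_linear f"
proof -
  have "f u = f' u" for u
  proof -
    have "((\<lambda>r. f (r *\<^sub>R u)) has_derivative (\<lambda>r. f' (r *\<^sub>R u))) (at (0::real))"
      by (rule has_derivative_compose[where f = "\<lambda>r. r *\<^sub>R u" and g = f]) (auto intro!: derivative_eq_intros f)
    moreover have "((\<lambda>r. f (r *\<^sub>R u)) has_derivative (\<lambda>r. r *\<^sub>R f u)) (at (0::real))"
      unfolding hom by (auto intro!: derivative_eq_intros)
    ultimately have "(\<lambda>r. f' (r *\<^sub>R u)) = (\<lambda>r. r *\<^sub>R f u)" by (rule has_derivative_unique)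
    from fun_cong[OF this, of 1] show ?thesis by simp
  qed
  then show ?thesis using has_derivative_bounded_linear[OF f] by (metis ext)
qed

text \<open>
  Homogeneity of the lift comes from differentiating \<open>n (y, r a) = r n (y, a)\<close> at \<open>(x, a)\<close>.
\<close>
lemma lift_rep_linear:
  assumes n: "smooth_on (U \<times> UNIV) n" and lin: "\<And>x. x \<in> U \<Longrightarrow> bounded_linear (\<lambda>u. n (x, u))" and x: "x \<in> U"
  shows "bounded_linear (\<lambda>\<xi>. lift_rep n ((x, v), \<xi>))"
proof (rule bounded_linear_of_homogeneous)
  have op: "open (U \<times> (UNIV :: 'a set))" by (rule smooth_on_open[OF n])
  fix r :: real and \<xi> :: "'a \<times> 'a"
  obtain a a' where \<xi>: "\<xi> = (a, a')" by fastforce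
  have scale: "n (y, r *\<^sub>R u) = r *\<^sub>R n (y, u)" if "y \<in> U" for y u
    using bounded_linear.linear[OF lin[OF that]] unfolding linear_iff by blast
  have S: "((\<lambda>z. (fst z, r *\<^sub>R snd z)) has_derivative (\<lambda>z. (fst z, r *\<^sub>R snd z))) (at (x, a))"
    by (auto intro!: derivative_eq_intros)
  have 1: "((\<lambda>z. n (fst z, r *\<^sub>R snd z)) has_derivative (\<lambda>z. deriv_at n (x, r *\<^sub>R a) (fst z, r *\<^sub>R snd z))) (at (x, a))"
    using smooth_chain[OF n S] x by simp
  have 2: "((\<lambda>z. r *\<^sub>R n z) has_derivative (\<lambda>z. r *\<^sub>R deriv_at n (x, a) z)) (at (x, a))"
    by (intro has_derivative_scaleR_right smooth_on_has_derivative[OF n]) (use x in simp)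
  have "((\<lambda>z. n (fst z, r *\<^sub>R snd z)) has_derivative (\<lambda>z. r *\<^sub>R deriv_at n (x, a) z)) (at (x, a))"
    by (rule has_derivative_transform_within_open[OF 2 op]) (use x scale in auto)
  from has_derivative_unique[OF 1 this]
  have "deriv_at n (x, r *\<^sub>R a) (fst z, r *\<^sub>R snd z) = r *\<^sub>R deriv_at n (x, a) z" for z by (rule fun_cong)
  from this[of "(v, a')"] show "lift_rep n ((x, v), r *\<^sub>R \<xi>) = r *\<^sub>R lift_rep n ((x, v), \<xi>)"
    using scale[OF x] by (simp add: lift_rep_def \<xi>)
next
  have "((\<lambda>\<xi>. ((x, v), \<xi>)) has_derivative (\<lambda>\<xi>. (0, \<xi>))) (at (0 :: 'a \<times> 'a))"
    by (auto intro!: derivative_eq_intros)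
  from smooth_chain[OF lift_rep_smooth[OF n] this]
  show "((\<lambda>\<xi>. lift_rep n ((x, v), \<xi>)) has_derivative
      (\<lambda>\<xi>. deriv_at (lift_rep n) ((x, v), 0) (0, \<xi>))) (at 0)" using x by simp
qed

text \<open>
  The map \<open>(x, a, b) \<mapsto> torsion_rep n x a b\<close> vanishes, hence so does its derivative in the direction
  \<open>(v, a', b')\<close>. Term by term this derivative is the second component of the torsion of the lift:
  the two agree up to the order of the arguments of the second derivative of \<open>n\<close>.
\<close>
theorem torsion_lift_rep:
  assumes n: "smooth_on (U \<times> UNIV) n" and tor: "\<And>x a b. x \<in> U \<Longrightarrow> torsion_rep n x a b = 0" and x: "x \<in> U"
  shows "torsion_rep (lift_rep n) (x, v) (a, a') (b, b') = 0"
proof -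
  let ?D = "deriv_at n" and ?D2 = "second_deriv n"
  have op: "open (U \<times> (UNIV :: 'a set))" by (rule smooth_on_open[OF n])
  then have U: "open U" using open_image_fst[OF op] by simp
  \<comment> \<open>\<open>q\<close> is the vector to which \<open>torsion_rep\<close> applies \<open>n\<close> last, and \<open>q'\<close> its derivative in the
      direction \<open>(v, a', b')\<close>.\<close>
  define q q' where "q = ?D (x, a) (b, 0) - ?D (x, b) (a, 0)"
    and "q' = (?D2 (x, a) (v, a') (b, 0) + ?D (x, a) (b', 0)) - (?D2 (x, b) (v, b') (a, 0) + ?D (x, b) (a', 0))"
  have sym: "?D2 (x, u) s t = ?D2 (x, u) t s" for u s t
    by (rule second_deriv_sym[OF n]) (use x in simp)
  let ?A = "\<lambda>w :: 'a \<times> 'a \<times> 'a. (fst w, fst (snd w))" and ?B = "\<lambda>w :: 'a \<times> 'a \<times> 'a. (fst w, snd (snd w))"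
  let ?w = "(x, a, b)"
  have A: "(?A has_derivative ?A) (at ?w)" and B: "(?B has_derivative ?B) (at ?w)"
    and a: "((\<lambda>w. (fst (snd w), 0 :: 'a)) has_derivative (\<lambda>w. (fst (snd w), 0))) (at ?w)"
    and b: "((\<lambda>w. (snd (snd w), 0 :: 'a)) has_derivative (\<lambda>w. (snd (snd w), 0))) (at ?w)"
    by (auto intro!: derivative_eq_intros)
  have xU: "?A ?w \<in> U \<times> UNIV" "?B ?w \<in> U \<times> UNIV" using x by auto
  have nA: "((\<lambda>w. (n (?A w), 0 :: 'a)) has_derivative (\<lambda>h. (?D (?A ?w) (?A h), 0))) (at ?w)"
    and nB: "((\<lambda>w. (n (?B w), 0 :: 'a)) has_derivative (\<lambda>h. (?D (?B ?w) (?B h), 0))) (at ?w)"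
    by (intro has_derivative_Pair has_derivative_const smooth_chain[OF n A xU(1)] smooth_chain[OF n B xU(2)])+
  let ?q = "\<lambda>w. ?D (?A w) (snd (snd w), 0) - ?D (?B w) (fst (snd w), 0)"
  let ?q' = "\<lambda>h. (?D2 (?A ?w) (?A h) (snd (snd ?w), 0) + ?D (?A ?w) (snd (snd h), 0)) -
      (?D2 (?B ?w) (?B h) (fst (snd ?w), 0) + ?D (?B ?w) (fst (snd h), 0))"
  have "((\<lambda>w. (fst w, ?q w)) has_derivative (\<lambda>h. (fst h, ?q' h))) (at ?w)"
    by (intro has_derivative_Pair has_derivative_diff deriv_chain[OF n A b xU(1)] deriv_chain[OF n B a xU(2)]
        has_derivative_fst has_derivative_ident)
  from smooth_chain[OF n this]
  have nq: "((\<lambda>w. n (fst w, ?q w)) has_derivative (\<lambda>h. ?D (x, q) (fst h, ?q' h))) (at ?w)"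
    using x by (simp add: q_def)
  let ?t = "\<lambda>w. ?D (?A w) (n (?B w), 0) - ?D (?B w) (n (?A w), 0) - n (fst w, ?q w)"
  let ?t' = "\<lambda>h. (?D2 (?A ?w) (?A h) (n (?B ?w), 0) + ?D (?A ?w) (?D (?B ?w) (?B h), 0)) -
     (?D2 (?B ?w) (?B h) (n (?A ?w), 0) + ?D (?B ?w) (?D (?A ?w) (?A h), 0)) - ?D (x, q) (fst h, ?q' h)"
  have t: "(?t has_derivative ?t') (at ?w)"
    by (intro has_derivative_diff deriv_chain[OF n A nB xU(1)] deriv_chain[OF n B nA xU(2)] nq)
  have "((\<lambda>w. 0) has_derivative ?t') (at ?w)"
    by (rule has_derivative_transform_within_open[OF t, of "U \<times> UNIV"])
       (use x U tor in \<open>auto intro!: open_Times simp: torsion_rep_def\<close>)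
  from has_derivative_unique[OF this has_derivative_const]
  have "?t' (v, a', b') = 0" by (rule fun_cong)
  then have "(?D2 (x, a) (v, a') (n (x, b), 0) + ?D (x, a) (?D (x, b) (v, b'), 0)) -
     (?D2 (x, b) (v, b') (n (x, a), 0) + ?D (x, b) (?D (x, a) (v, a'), 0)) - ?D (x, q) (v, q') = 0"
    by (simp add: q'_def)
  moreover have "?D (x, a) (n (x, b), 0) - ?D (x, b) (n (x, a), 0) - n (x, q) = 0"
    using tor[OF x, of a b] by (simp add: torsion_rep_def q_def)
  moreover have "deriv_at (lift_rep n) ((x, v), (a, a')) ((h, h'), 0) =
      (?D (x, a) (h, 0), ?D2 (x, a) (v, a') (h, 0) + ?D (x, a) (h', 0))" for a a' h h'
    unfolding zero_prod_def deriv_lift_rep[OF n x] sym[of a "(h, 0)"] ..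
  moreover have "lift_rep n ((x, v), (u, u')) = (n (x, u), ?D (x, u) (v, u'))" for u u'
    by (simp add: lift_rep_def)
  ultimately show ?thesis
    unfolding torsion_rep_def by (simp add: q_def q'_def zero_prod_def)
qed

lemma deriv_local_rep_operator:
  assumes M: "banach_manifold M" and N: "N_operator M N" and c: "c \<in> M" and x: "x \<in> snd c ` fst c"
  shows "deriv_at (local_rep (tangent_chart M c) (tangent_chart M c) N) (x, u) (h, k) =
    (h, deriv_at (operator_rep M c N) (x, u) (h, k))"
proof -
  let ?n = "operator_rep M c N"
  have sm: "smooth_on (snd c ` fst c \<times> UNIV) ?n" by (rule operator_rep_smooth[OF M N c])
  have "((\<lambda>z. (fst z, ?n z)) has_derivative (\<lambda>z. (fst z, deriv_at ?n (x, u) z))) (at (x, u))"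
    by (intro has_derivative_Pair has_derivative_fst has_derivative_ident smooth_on_has_derivative[OF sm])
       (use x in simp)
  then have "(local_rep (tangent_chart M c) (tangent_chart M c) N has_derivative
      (\<lambda>z. (fst z, deriv_at ?n (x, u) z))) (at (x, u))"
    by (rule has_derivative_transform_within_open[OF _ smooth_on_open[OF sm]])
       (use x local_rep_operator[OF M N c] in auto)
  from fun_cong[OF frechet_derivative_at[OF this], of "(h, k)"] show ?thesis by simp
qed

text \<open>
  Chasing coordinates through the flip, the tangent map of \<open>N\<close> and the flip again:
  \<open>((x, v), (a, a'))\<close> goes to \<open>((x, a), (v, a'))\<close>, then to
  \<open>((x, n (x, a)), (v, Dn (x, a) (v, a')))\<close>, and finally to
  \<open>((x, v), (n (x, a), Dn (x, a) (v, a')))\<close>.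
\<close>
lemma tangent_lift:
  assumes M: "banach_manifold M" and N: "N_operator M N" and w: "w \<in> tangent_vectors (tangent_bundle M)"
  shows tangent_lift_in: "tangent_lift M N w \<in> tangent_vectors (tangent_bundle M)"
    and fst_tangent_lift: "fst (tangent_lift M N w) = fst w"
    and snd_tangent_lift: "\<And>c. c \<in> charts_at M (fst (fst w)) \<Longrightarrow>
      snd (tangent_lift M N w) (tangent_chart M c) =
      lift_rep (operator_rep M c N) (double_coordinates M c w)"
proof -
  let ?TM = "tangent_bundle M"
  note TM = banach_manifold_tangent_bundle[OF M]
  have Nsm: "smooth_map ?TM ?TM N" using N by (simp add: N_operator_def)
  define p where "p = fst (fst w)"
  define w1 where "w1 = canonical_flip M w"
  define w2 where "w2 = tangent_map ?TM ?TM N w1"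
  define w3 where "w3 = canonical_flip M w2"
  have lift: "tangent_lift M N w = w3" by (simp add: tangent_lift_def w1_def w2_def w3_def)
  have w1: "w1 \<in> tangent_vectors ?TM" "fst (fst w1) = p"
    "\<And>c. c \<in> charts_at M p \<Longrightarrow> double_coordinates M c w1 = flip_coords (double_coordinates M c w)"
    using canonical_flip[OF M w] by (simp_all only: w1_def p_def)
  note v1 = tangent_bundle_base[OF w1(1)]
  have w2: "w2 \<in> tangent_vectors ?TM" "fst w2 = N (fst w1)"
    unfolding w2_def using tangent_map_in[OF TM TM Nsm w1(1)] fst_tangent_map[OF TM TM Nsm w1(1)] by simp_all
  have p2: "fst (fst w2) = p" using N_operator_base[OF N v1] by (simp add: w2(2) w1(2))
  have w3: "w3 \<in> tangent_vectors ?TM" "fst (fst w3) = p"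
    "\<And>c. c \<in> charts_at M p \<Longrightarrow> double_coordinates M c w3 = flip_coords (double_coordinates M c w2)"
    using canonical_flip[OF M w2(1)] by (simp_all only: w3_def p2)
  have coords: "double_coordinates M c w3 =
      ((snd c p, snd (fst w) c), lift_rep (operator_rep M c N) (double_coordinates M c w))"
    if c: "c \<in> charts_at M p" for c
  proof -
    note cM = charts_atD[OF c]
    obtain a a' where a: "snd w (tangent_chart M c) = (a, a')" by fastforce
    let ?v = "snd (fst w) c" and ?x = "snd c p"
    have 1: "snd (fst w1) c = a" "snd w1 (tangent_chart M c) = (?v, a')"
      using w1(3)[OF c] a by (simp_all add: flip_coords_def w1(2) p_def[symmetric])
    have tc: "tangent_chart M c \<in> charts_at ?TM (fst w1)" "tangent_chart M c \<in> charts_at ?TM (N (fst w1))"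
      using c w1(2) N_operator_base[OF N v1] N_operator_in[OF N v1] v1 by (auto intro!: tangent_chart_at)
    have x: "?x \<in> snd c ` fst c" using cM by simp
    have 2: "snd w2 (tangent_chart M c) = (?v, deriv_at (operator_rep M c N) (?x, a) (?v, a'))"
      unfolding w2_def snd_tangent_map[OF TM TM Nsm w1(1) tc]
      by (simp add: 1 w1(2) deriv_local_rep_operator[OF M N cM(1) x])
    have 3: "snd (fst w2) c = operator_rep M c N (?x, a)"
      using operator_rep_coordinate[OF M v1, of c N] c by (simp add: w2(2) w1(2) 1)
    show ?thesis
      unfolding w3(3)[OF c] by (simp add: 2 3 p2 a p_def[symmetric] flip_coords_def lift_rep_def)
  qed
  show "tangent_lift M N w \<in> tangent_vectors ?TM" by (simp add: lift w3)
  obtain c where c: "c \<in> charts_at M p"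
    using tangent_vector_base_chart[OF tangent_bundle_base[OF w]] unfolding p_def by blast
  show "fst (tangent_lift M N w) = fst w"
    unfolding lift
  proof (rule tangent_vector_eqI[OF tangent_bundle_base[OF w3(1)] tangent_bundle_base[OF w]])
    show "fst (fst w3) = fst (fst w)" by (simp add: w3(2) p_def)
    show "c \<in> charts_at M (fst (fst w3))" using c by (simp add: w3(2))
    show "snd (fst w3) c = snd (fst w) c" using coords[OF c] by simp
  qed
  show "snd (tangent_lift M N w) (tangent_chart M c) = lift_rep (operator_rep M c N) (double_coordinates M c w)"
    if "c \<in> charts_at M (fst (fst w))" for c
    using coords[of c] that by (simp add: lift p_def)
qed

lemma operator_rep_tangent_lift:
  assumes M: "banach_manifold M" and N: "N_operator M N" and c: "c \<in> M" and z: "z \<in> snd c ` fst c \<times> UNIV"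
  shows "operator_rep (tangent_bundle M) (tangent_chart M c) (tangent_lift M N) (z, \<zeta>) =
    lift_rep (operator_rep M c N) (z, \<zeta>)"
proof -
  note TM = banach_manifold_tangent_bundle[OF M]
  obtain v where v: "z = snd (tangent_chart M c) v" "v \<in> tangent_vectors M" "fst v \<in> fst c"
    using z unfolding tangent_chart_domain[OF M c, symmetric] by auto
  have c': "c \<in> charts_at M (fst v)" by (rule charts_atI[OF c v(3)])
  have tc: "tangent_chart M c \<in> charts_at (tangent_bundle M) v" by (rule tangent_chart_at[OF v(2) c'])
  let ?w = "tangent_vector_of (tangent_bundle M) (tangent_chart M c) v \<zeta>"
  note w = tangent_vector_of[OF TM tc, of \<zeta>]
  have "operator_rep (tangent_bundle M) (tangent_chart M c) (tangent_lift M N) (z, \<zeta>) =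
      snd (tangent_lift M N ?w) (tangent_chart M c)"
    unfolding v(1) by (rule operator_rep_tangent_vector_of[OF TM tc])
  also have "\<dots> = lift_rep (operator_rep M c N) (double_coordinates M c ?w)"
    by (rule snd_tangent_lift[OF M N w(1)]) (use c' w(2) in simp)
  also have "double_coordinates M c ?w = (z, \<zeta>)" using w v(1) by simp
  finally show ?thesis .
qed

theorem N_operator_tangent_lift:
  assumes M: "banach_manifold M" and N: "N_operator M N"
  shows "N_operator (tangent_bundle M) (tangent_lift M N)"
proof (rule N_operatorI[where n = "\<lambda>c. operator_rep (tangent_bundle M) c (tangent_lift M N)"])
  let ?n = "\<lambda>c. operator_rep (tangent_bundle M) c (tangent_lift M N)"
  show TM: "banach_manifold (tangent_bundle M)" by (rule banach_manifold_tangent_bundle[OF M])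
  show "tangent_lift M N w \<in> tangent_vectors (tangent_bundle M)" "fst (tangent_lift M N w) = fst w"
    if "w \<in> tangent_vectors (tangent_bundle M)" for w
    using tangent_lift[OF M N that] by simp_all
  show "snd (tangent_lift M N w) c = ?n c (snd c (fst w), snd w c)"
    if "w \<in> tangent_vectors (tangent_bundle M)" "c \<in> charts_at (tangent_bundle M) (fst w)" for w c
    by (rule operator_rep_coordinate[OF TM that, symmetric])
  fix C assume "C \<in> tangent_bundle M"
  then obtain c where C: "C = tangent_chart M c" and c: "c \<in> M" by (auto simp: tangent_bundle_def)
  note sm = operator_rep_smooth[OF M N c]
  show "smooth_on (snd C ` fst C \<times> UNIV) (?n C)"
    unfolding C tangent_chart_domain[OF M c]
    by (rule smooth_on_cong[OF lift_rep_smooth[OF sm]]) (use operator_rep_tangent_lift[OF M N c] in auto)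
  fix z assume "z \<in> snd C ` fst C"
  then have z: "z \<in> snd c ` fst c \<times> UNIV" using tangent_chart_domain[OF M c] C by simp
  then have "bounded_linear (\<lambda>\<zeta>. lift_rep (operator_rep M c N) (z, \<zeta>))"
    using lift_rep_linear[OF sm operator_rep_linear[OF M N c], of "fst z" "snd z"] by auto
  then show "bounded_linear (\<lambda>\<zeta>. ?n C (z, \<zeta>))"
    unfolding C operator_rep_tangent_lift[OF M N c z] .
qed

text \<open>
  The charts of the tangent bundle all come from charts of \<open>M\<close>, and in these the torsion of the lift is
  \<open>torsion_rep (lift_rep n)\<close>. The coordinate form and \<open>lift_rep n\<close> agree on an open set,
  hence have the same derivatives there.
\<close>
theorem nijenhuis_operator_tangent_lift:
  assumes M: "banach_manifold M" and nij: "nijenhuis_operator M N"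
  shows "nijenhuis_operator (tangent_bundle M) (tangent_lift M N)"
proof -
  have N: "N_operator M N" and tor: "\<And>c x a b. c \<in> M \<Longrightarrow> x \<in> snd c ` fst c \<Longrightarrow> torsion_rep (operator_rep M c N) x a b = 0"
    using nij by (auto simp: nijenhuis_operator_iff_torsion_rep[OF M])
  let ?TM = "tangent_bundle M"
  have "torsion_rep (operator_rep ?TM (tangent_chart M c) (tangent_lift M N)) z \<alpha> \<beta> = 0"
    if c: "c \<in> M" and z: "z \<in> snd c ` fst c \<times> UNIV" for c z \<alpha> \<beta>
  proof -
    let ?n = "operator_rep M c N" and ?m = "operator_rep ?TM (tangent_chart M c) (tangent_lift M N)"
    note sm = operator_rep_smooth[OF M N c]
    note lsm = lift_rep_smooth[OF sm]
    note eq = operator_rep_tangent_lift[OF M N c]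
    have "deriv_at ?m (z, \<zeta>) = deriv_at (lift_rep ?n) (z, \<zeta>)" for \<zeta>
    proof (rule frechet_derivative_transform_within_open[symmetric, OF _ smooth_on_open[OF lsm]])
      show "lift_rep ?n differentiable at (z, \<zeta>)"
        using smooth_on_has_derivative[OF lsm, of "(z, \<zeta>)"] z by (auto simp: differentiable_def)
    qed (use z eq in auto)
    then have "torsion_rep ?m z \<alpha> \<beta> = torsion_rep (lift_rep ?n) z \<alpha> \<beta>"
      unfolding torsion_rep_def eq[OF z] by simp
    also have "\<dots> = torsion_rep (lift_rep ?n) (fst z, snd z) (fst \<alpha>, snd \<alpha>) (fst \<beta>, snd \<beta>)" by simp
    also have "\<dots> = 0" by (rule torsion_lift_rep[OF sm tor[OF c]]) (use z in auto)
    finally show ?thesis .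
  qed
  then have "\<forall>C\<in>?TM. \<forall>z\<in>snd C ` fst C. \<forall>\<alpha> \<beta>. torsion_rep (operator_rep ?TM C (tangent_lift M N)) z \<alpha> \<beta> = 0"
    using tangent_chart_domain[OF M] unfolding tangent_bundle_def by blast
  then show ?thesis
    unfolding nijenhuis_operator_iff_torsion_rep[OF banach_manifold_tangent_bundle[OF M]]
    using N_operator_tangent_lift[OF M N] by blast
qed

section \<open>Projectability\<close>

lemma tangent_proj_overlap:
  assumes "banach_manifold M" "c \<in> M"
  shows "snd (tangent_chart M c) ` {v \<in> fst (tangent_chart M c). fst v \<in> fst d} = snd c ` (fst c \<inter> fst d) \<times> UNIV"
proof -
  have "{v \<in> fst (tangent_chart M c). fst v \<in> fst d} = {v \<in> tangent_vectors M. fst v \<in> fst c \<inter> fst d}"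
    by auto
  then show ?thesis using tangent_chart_image[OF assms, of "fst c \<inter> fst d"] by simp
qed

lemma local_rep_tangent_proj:
  assumes M: "banach_manifold M" and c: "c \<in> M" and x: "x \<in> snd c ` fst c"
  shows "local_rep (tangent_chart M c) d fst (x, u) = local_rep c d id x"
proof -
  have "c \<in> charts_at M (chart_inv c x)" using c chart_inv_image[OF x] by (auto intro: charts_atI)
  then show ?thesis
    using chart_inv_tangent_chart[OF M c x, of u] fst_tangent_vector_of[OF M] by (simp add: local_rep_def)
qed

lemma smooth_map_tangent_proj:
  assumes M: "banach_manifold M"
  shows "smooth_map (tangent_bundle M) M fst"
proof -
  have "smooth_on (snd (tangent_chart M c) ` {v \<in> fst (tangent_chart M c). fst v \<in> fst d})
      (local_rep (tangent_chart M c) d fst)" if c: "c \<in> M" and d: "d \<in> M" for c d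
  proof -
    let ?W = "snd c ` (fst c \<inter> fst d) \<times> (UNIV :: 'b set)"
    have "open ?W" by (intro open_Times open_chart_overlap[OF M c d]) simp
    then have "smooth_on ?W (\<lambda>z. local_rep c d id (fst z))"
      by (intro smooth_on_compose[OF transition_smooth[OF M c d] smooth_on_bounded_linear[OF bounded_linear_fst]]) auto
    then have "smooth_on ?W (local_rep (tangent_chart M c) d fst)"
      by (rule smooth_on_cong) (use local_rep_tangent_proj[OF M c, of _ d] in auto)
    then show ?thesis unfolding tangent_proj_overlap[OF M c] .
  qed
  moreover have "fst ` tangent_vectors M \<subseteq> points M" using tangent_vector_base by blast
  ultimately show ?thesis
    unfolding smooth_map_def points_tangent_bundle by (auto simp: tangent_bundle_def)
qed

lemma deriv_tangent_proj:
  assumes M: "banach_manifold M" and v: "v \<in> tangent_vectors M"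
    and c: "c \<in> charts_at M (fst v)" and d: "d \<in> charts_at M (fst v)"
  shows "deriv_at (local_rep (tangent_chart M c) d fst) (snd (tangent_chart M c) v) z =
    transition_deriv c d (fst v) (fst z)"
proof -
  note cM = charts_atD[OF c] and dM = charts_atD[OF d]
  let ?x = "snd c (fst v)"
  have "((\<lambda>z. local_rep c d id (fst z)) has_derivative (\<lambda>z. transition_deriv c d (fst v) (fst z))) (at (?x, snd v c))"
    by (rule has_derivative_compose[where f = fst, OF has_derivative_fst[OF has_derivative_ident]])
       (unfold fst_conv, rule transition_has_derivative[OF M c d])
  then have "(local_rep (tangent_chart M c) d fst has_derivative (\<lambda>z. transition_deriv c d (fst v) (fst z))) (at (?x, snd v c))"
  proof (rule has_derivative_transform_within_open)
    show "open (snd c ` fst c \<times> (UNIV :: 'b set))" by (intro open_Times open_chart_image[OF M cM(1)]) simp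
  qed (use cM local_rep_tangent_proj[OF M cM(1), of _ d] in auto)
  from fun_cong[OF frechet_derivative_at[OF this], of z] show ?thesis by simp
qed

text \<open>
  In charts the derivative of the projection is the first factor projection followed by an invertible
  derivative of a transition map, so its kernel is the second factor.
\<close>
lemma fibration_tangent_proj:
  assumes M: "banach_manifold M"
  shows "fibration (tangent_bundle M) M fst"
proof -
  have "surj L \<and> (\<exists>Q. bounded_linear Q \<and> Q \<circ> Q = Q \<and> range Q = {z. L z = 0})"
    if v: "v \<in> tangent_vectors M" and C: "C \<in> charts_at (tangent_bundle M) v" and d: "d \<in> charts_at M (fst v)"
      and L: "L = deriv_at (local_rep C d fst) (snd C v)" for v C d L
  proof -
    obtain c where C: "C = tangent_chart M c" and c: "c \<in> charts_at M (fst v)"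
      using C charts_at_tangent_bundle[OF v] by auto
    have L: "L z = transition_deriv c d (fst v) (fst z)" for z
      unfolding L C by (rule deriv_tangent_proj[OF M v c d])
    have inv: "transition_deriv c d (fst v) (transition_deriv d c (fst v) u) = u"
      "transition_deriv d c (fst v) (transition_deriv c d (fst v) u) = u" for u
      using transition_deriv_compose[OF M] transition_deriv_self[OF M] c d by metis+
    have zero: "transition_deriv e e' (fst v) 0 = 0" if "e \<in> charts_at M (fst v)" "e' \<in> charts_at M (fst v)" for e e'
      using linear_0[OF transition_deriv_linear[OF M that]] .
    have ker: "L z = 0 \<longleftrightarrow> fst z = 0" for z
      unfolding L using inv(2)[of "fst z"] zero[OF c d] zero[OF d c] by metis
    have "surj L"
    proof (rule surjI)
      show "L (transition_deriv d c (fst v) u, 0) = u" for u by (simp add: L inv)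
    qed
    moreover have "bounded_linear (\<lambda>z :: 'b \<times> 'b. (0 :: 'b, snd z))"
      by (intro bounded_linear_Pair bounded_linear_zero bounded_linear_snd)
    moreover have "range (\<lambda>z :: 'b \<times> 'b. (0 :: 'b, snd z)) = {z. L z = 0}"
      unfolding ker by (auto simp: image_iff prod_eq_iff)
    ultimately show ?thesis by (intro conjI exI[of _ "\<lambda>z. (0, snd z)"]) auto
  qed
  then have "submersion (tangent_bundle M) M fst"
    unfolding submersion_def points_tangent_bundle Let_def using smooth_map_tangent_proj[OF M] by blast
  moreover have "fst ` tangent_vectors M = points M"
  proof (intro equalityI subsetI)
    fix p assume "p \<in> points M"
    then obtain c where c: "c \<in> charts_at M p" unfolding in_points_iff by blast
    show "p \<in> fst ` tangent_vectors M"
      using tangent_vector_of(1,2)[OF M c, of 0] by (metis image_eqI)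
  qed (use tangent_vector_base in blast)
  ultimately show ?thesis unfolding fibration_def points_tangent_bundle by blast
qed

lemma tangent_map_proj_coordinate:
  assumes M: "banach_manifold M" and w: "w \<in> tangent_vectors (tangent_bundle M)"
    and c: "c \<in> charts_at M (fst (fst w))"
  shows "snd (tangent_map (tangent_bundle M) M fst w) c = fst (snd w (tangent_chart M c))"
proof -
  note v = tangent_bundle_base[OF w]
  have "snd (tangent_map (tangent_bundle M) M fst w) c =
      deriv_at (local_rep (tangent_chart M c) c fst) (snd (tangent_chart M c) (fst w)) (snd w (tangent_chart M c))"
    by (rule snd_tangent_map[OF banach_manifold_tangent_bundle[OF M] M smooth_map_tangent_proj[OF M] w tangent_chart_at[OF v c] c])
  also have "\<dots> = fst (snd w (tangent_chart M c))"
    unfolding deriv_tangent_proj[OF M v c c] by (rule transition_deriv_self[OF M c])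
  finally show ?thesis .
qed

text \<open>
  Both sides are tangent vectors at the same point of \<open>M\<close>, so one chart decides. There the tangent map
  of the projection reads off the component \<open>n (x, a)\<close> of \<open>lift_rep\<close>.
\<close>
theorem projectable_tangent_lift:
  assumes M: "banach_manifold M" and N: "N_operator M N"
  shows "projectable (tangent_bundle M) M fst (tangent_lift M N) N"
proof -
  let ?T = "tangent_map (tangent_bundle M) M fst"
  note TM = banach_manifold_tangent_bundle[OF M]
  note T = tangent_map_in[OF TM M smooth_map_tangent_proj[OF M]] fst_tangent_map[OF TM M smooth_map_tangent_proj[OF M]]
  have "?T (tangent_lift M N w) = N (?T w)" if w: "w \<in> tangent_vectors (tangent_bundle M)" for w
  proof -
    note lw = tangent_lift_in[OF M N w]
    have b: "fst (?T (tangent_lift M N w)) = fst (fst w)"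
      using T(2)[OF lw] fst_tangent_lift[OF M N w] by simp
    obtain c where c: "c \<in> charts_at M (fst (fst w))"
      using tangent_vector_base_chart[OF tangent_bundle_base[OF w]] by blast
    show ?thesis
    proof (rule tangent_vector_eqI[OF T(1)[OF lw] N_operator_in[OF N T(1)[OF w]]])
      show "fst (?T (tangent_lift M N w)) = fst (N (?T w))"
        using N_operator_base[OF N T(1)[OF w]] T(2)[OF w] b by simp
      show "c \<in> charts_at M (fst (?T (tangent_lift M N w)))" using c b by simp
      have "snd (?T (tangent_lift M N w)) c = fst (lift_rep (operator_rep M c N) (double_coordinates M c w))"
        using tangent_map_proj_coordinate[OF M lw, of c] fst_tangent_lift[OF M N w] snd_tangent_lift[OF M N w c] c by simp
      also have "\<dots> = operator_rep M c N (snd c (fst (fst w)), fst (snd w (tangent_chart M c)))"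
        by (simp add: lift_rep_def case_prod_unfold)
      also have "\<dots> = operator_rep M c N (snd c (fst (?T w)), snd (?T w) c)"
        using T(2)[OF w] tangent_map_proj_coordinate[OF M w c] by simp
      also have "\<dots> = snd (N (?T w)) c"
        by (rule operator_rep_coordinate[OF M T(1)[OF w]]) (use c T(2)[OF w] in simp)
      finally show "snd (?T (tangent_lift M N w)) c = snd (N (?T w)) c" .
    qed
  qed
  then show ?thesis
    unfolding projectable_def using fibration_tangent_proj[OF M] N_operator_tangent_lift[OF M N] N by blast
qed

theorem theorem5p1:
  fixes M :: "('m, 'e::banach) chart set"
    and N :: "('m, 'e) tvec \<Rightarrow> ('m, 'e) tvec"
  assumes "banach_manifold M"
    and "nijenhuis_operator M N"
  shows "banach_manifold (tangent_bundle M) \<and>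
    nijenhuis_operator (tangent_bundle M) (tangent_lift M N) \<and>
    projectable (tangent_bundle M) M tangent_proj (tangent_lift M N) N"
proof (intro conjI)
  show "banach_manifold (tangent_bundle M)" by (rule banach_manifold_tangent_bundle[OF assms(1)])
  show "nijenhuis_operator (tangent_bundle M) (tangent_lift M N)"
    by (rule nijenhuis_operator_tangent_lift[OF assms])
  have "N_operator M N" using assms(2) by (simp add: nijenhuis_operator_def)
  then show "projectable (tangent_bundle M) M tangent_proj (tangent_lift M N) N"
    by (rule projectable_tangent_lift[OF assms(1)])
qed

end
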